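(* Let $c>0$, $\alpha>0$ and $s>0$. Then there exist constants $K>0$ and $\delta>0$ such that, whenever $N>m_\alpha c$ with $m_\alpha=4.13\left(1.28+\frac{2\alpha+1}{1.9}\right)^{0.55}$ ($N$ a positive integer) and $f\in H^s_\alpha(I)$, one has $$\|f-S_N(f)\|_{L^2(I,\omega_\alpha)}\le K\left(1+\left(\frac N2\right)^2\right)^{-\frac s2}\|f\|_{H^s_\alpha}+K e^{-\delta N}\|f\|_{L^2(I,\omega_\alpha)},$$ where $S_N(f)=\sum_{n=0}^N\langle f,\psi_{n,c}^{(\alpha)}\rangle_{L^2(I,\omega_\alpha)}\,\psi_{n,c}^{(\alpha)}$.
   Context: Let $I=[-1,1]$, $\omega_\alpha(x)=(1-x^2)^\alpha$, and let $L^2(I,\omega_\alpha)$ carry the inner product $\langle f,g\rangle=\int_{-1}^1 f(x)\overline{g(x)}\,\omega_\alpha(x)\,dx$. GPSWFs: for $c>0$, consider the Sturm-Liouville operator $\mathcal L_c^{(\alpha)}f(x)=-\frac{1}{\omega_\alpha(x)}\frac{d}{dx}\left[\omega_\alpha(x)(1-x^2)f'(x)\right]+c^2x^2f(x)$ on $I$. Its eigenvalues are listed in increasing order as $\chi_0^\alpha(c)<\chi_1^\alpha(c)<\cdots$. The generalized prolate spheroidal wave function $\psi_{n,c}^{(\alpha)}$, $n\ge 0$, is the (real-valued) eigenfunction, bounded on $I$, of $\mathcal L_c^{(\alpha)}$ for the eigenvalue $\chi_n^\alpha(c)$, normalized by $\|\psi_{n,c}^{(\alpha)}\|_{L^2(I,\omega_\alpha)}=1$.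 These functions form an orthonormal basis of $L^2(I,\omega_\alpha)$. Weighted Sobolev spaces: for an integer $r\ge0$, $H^r_\alpha(I)=\{f\in L^2(I,\omega_\alpha):\|f\|_{\alpha,r}<\infty\}$, where $\|f\|_{\alpha,r}^2=\sum_{k=0}^r\|f^{(k)}\|_{L^2(I,\omega_\alpha)}^2$. For real $r\ge 0$, $H^r_\alpha(I)$ is defined by interpolation between $H^{[r]}_\alpha(I)$ and $H^{[r]+1}_\alpha(I)$ ($[r]$ the integer part of $r$), with the corresponding norm. We write $\|f\|_{H^s_\alpha}=\|f\|_{\alpha,s}$. *)

theory Defs
  imports "HOL-Analysis.Analysis"
begin

definition jacobi_weight :: "real \<Rightarrow> real \<Rightarrow> real" where
  "jacobi_weight \<alpha> x = (1 - x\<^sup>2) powr \<alpha>"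

definition weighted_measure :: "real \<Rightarrow> real measure" where
  "weighted_measure \<alpha> = density (lebesgue_on {-1..1}) (\<lambda>x. ennreal (jacobi_weight \<alpha> x))"


text \<open>
  Elements of \<open>L\<^sup>2\<close> are represented by functions rather than by almost-everywhere classes;
  their values outside \<open>[-1, 1]\<close> play no role.
\<close>

definition weighted_L2 :: "real \<Rightarrow> (real \<Rightarrow> complex) set" where
  "weighted_L2 \<alpha> = {f. f \<in> borel_measurable (weighted_measure \<alpha>) \<and>
     integrable (weighted_measure \<alpha>) (\<lambda>x. (norm (f x))\<^sup>2)}"

definition weighted_inner :: "real \<Rightarrow> (real \<Rightarrow> complex) \<Rightarrow> (real \<Rightarrow> complex) \<Rightarrow> complex" where
  "weighted_inner \<alpha> f g = (\<integral>x. f x * cnj (g x) \<partial>weighted_measure \<alpha>)"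

definition weighted_norm :: "real \<Rightarrow> (real \<Rightarrow> complex) \<Rightarrow> real" where
  "weighted_norm \<alpha> f = sqrt (\<integral>x. (norm (f x))\<^sup>2 \<partial>weighted_measure \<alpha>)"


definition sturm_liouville :: "real \<Rightarrow> real \<Rightarrow> (real \<Rightarrow> real) \<Rightarrow> real \<Rightarrow> real" where
  "sturm_liouville \<alpha> c f x =
     - (1 / jacobi_weight \<alpha> x) * deriv (\<lambda>t. jacobi_weight \<alpha> t * (1 - t\<^sup>2) * deriv f t) x
     + c\<^sup>2 * x\<^sup>2 * f x"

text \<open>
  The differential equation is imposed on the open interval, since the weight vanishes at
  \<open>-1\<close> and \<open>1\<close>; boundedness takes the place of boundary conditions.
\<close>

definition bounded_eigenfunction :: "real \<Rightarrow> real \<Rightarrow> real \<Rightarrow> (real \<Rightarrow> real) \<Rightarrow> bool" where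
  "bounded_eigenfunction \<alpha> c \<mu> f \<longleftrightarrow>
     bounded (f ` {-1..1}) \<and>
     (\<exists>x\<in>{-1<..<1}. f x \<noteq> 0) \<and>
     (\<forall>x\<in>{-1<..<1}.
        f differentiable (at x) \<and>
        (\<lambda>t. jacobi_weight \<alpha> t * (1 - t\<^sup>2) * deriv f t) differentiable (at x) \<and>
        sturm_liouville \<alpha> c f x = \<mu> * f x)"

definition eigenvalues :: "real \<Rightarrow> real \<Rightarrow> real set" where
  "eigenvalues \<alpha> c = {\<mu>. \<exists>f. bounded_eigenfunction \<alpha> c \<mu> f}"

text \<open>
  \<open>chi\<close> is the increasing enumeration of all eigenvalues. The functions \<open>\<psi> n\<close> are only
  determined up to sign (and up to their values at the two end points), hence a predicate
  rather than a choice of functions.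
\<close>

definition gpswf_family :: "real \<Rightarrow> real \<Rightarrow> (nat \<Rightarrow> real) \<Rightarrow> (nat \<Rightarrow> real \<Rightarrow> real) \<Rightarrow> bool" where
  "gpswf_family \<alpha> c chi \<psi> \<longleftrightarrow>
     strict_mono chi \<and> range chi = eigenvalues \<alpha> c \<and>
     (\<forall>n. bounded_eigenfunction \<alpha> c (chi n) (\<psi> n) \<and>
          weighted_norm \<alpha> (\<lambda>x. complex_of_real (\<psi> n x)) = 1)"

definition gpswf_partial_sum ::
    "real \<Rightarrow> (nat \<Rightarrow> real \<Rightarrow> real) \<Rightarrow> nat \<Rightarrow> (real \<Rightarrow> complex) \<Rightarrow> real \<Rightarrow> complex" where
  "gpswf_partial_sum \<alpha> \<psi> N f x =
     (\<Sum>n=0..N. weighted_inner \<alpha> f (\<lambda>t. complex_of_real (\<psi> n t)) * complex_of_real (\<psi> n x))"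


definition test_function :: "(real \<Rightarrow> real) \<Rightarrow> bool" where
  "test_function \<phi> \<longleftrightarrow>
     (\<forall>k x. (deriv ^^ k) \<phi> differentiable (at x)) \<and>
     (\<exists>a b. -1 < a \<and> b < 1 \<and> (\<forall>x. x \<notin> {a..b} \<longrightarrow> \<phi> x = 0))"

definition locally_integrable :: "(real \<Rightarrow> complex) \<Rightarrow> bool" where
  "locally_integrable f \<longleftrightarrow> (\<forall>a b. -1 < a \<and> b < 1 \<longrightarrow> set_integrable lebesgue {a..b} f)"

text \<open>Derivatives in Sobolev spaces are distributional derivatives on the open interval.\<close>

definition has_weak_deriv :: "nat \<Rightarrow> (real \<Rightarrow> complex) \<Rightarrow> (real \<Rightarrow> complex) \<Rightarrow> bool" where
  "has_weak_deriv k f g \<longleftrightarrow>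
     locally_integrable f \<and> locally_integrable g \<and>
     (\<forall>\<phi>. test_function \<phi> \<longrightarrow>
        (LINT x:{-1<..<1}|lebesgue. (deriv ^^ k) \<phi> x *\<^sub>R f x) =
        (-1) ^ k * (LINT x:{-1<..<1}|lebesgue. \<phi> x *\<^sub>R g x))"

definition weak_deriv :: "nat \<Rightarrow> (real \<Rightarrow> complex) \<Rightarrow> real \<Rightarrow> complex" where
  "weak_deriv k f = (SOME g. has_weak_deriv k f g)"

definition sobolev_int :: "real \<Rightarrow> nat \<Rightarrow> (real \<Rightarrow> complex) set" where
  "sobolev_int \<alpha> r = {f \<in> weighted_L2 \<alpha>.
     \<forall>k\<le>r. (\<exists>g. has_weak_deriv k f g) \<and> weak_deriv k f \<in> weighted_L2 \<alpha>}"

definition sobolev_int_norm :: "real \<Rightarrow> nat \<Rightarrow> (real \<Rightarrow> complex) \<Rightarrow> real" where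
  "sobolev_int_norm \<alpha> r f = sqrt (\<Sum>k=0..r. (weighted_norm \<alpha> (weak_deriv k f))\<^sup>2)"


text \<open>
  Real interpolation \<open>(X\<^sub>0, X\<^sub>1)\<^bsub>\<theta>,2\<^esub>\<close> of a couple of normed function spaces by
  Peetre's K-method. For couples of Hilbert spaces it agrees, up to equivalence of norms,
  with complex (and Lions--Magenes) interpolation.
\<close>

definition decompositions ::
    "(real \<Rightarrow> complex) set \<Rightarrow> (real \<Rightarrow> complex) set \<Rightarrow> (real \<Rightarrow> complex) \<Rightarrow>
     ((real \<Rightarrow> complex) \<times> (real \<Rightarrow> complex)) set" where
  "decompositions X0 X1 f = {(f0, f1). f0 \<in> X0 \<and> f1 \<in> X1 \<and> f = (\<lambda>x. f0 x + f1 x)}"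

definition K_functional ::
    "(real \<Rightarrow> complex) set \<Rightarrow> ((real \<Rightarrow> complex) \<Rightarrow> real) \<Rightarrow>
     (real \<Rightarrow> complex) set \<Rightarrow> ((real \<Rightarrow> complex) \<Rightarrow> real) \<Rightarrow> real \<Rightarrow> (real \<Rightarrow> complex) \<Rightarrow> real" where
  "K_functional X0 n0 X1 n1 t f = (INF (f0, f1) \<in> decompositions X0 X1 f. n0 f0 + t * n1 f1)"

definition interpolation_space ::
    "(real \<Rightarrow> complex) set \<Rightarrow> ((real \<Rightarrow> complex) \<Rightarrow> real) \<Rightarrow>
     (real \<Rightarrow> complex) set \<Rightarrow> ((real \<Rightarrow> complex) \<Rightarrow> real) \<Rightarrow> real \<Rightarrow> (real \<Rightarrow> complex) set" where
  "interpolation_space X0 n0 X1 n1 \<theta> = {f. decompositions X0 X1 f \<noteq> {} \<and>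
     set_integrable lborel {0<..} (\<lambda>t. (t powr (- \<theta>) * K_functional X0 n0 X1 n1 t f)\<^sup>2 / t)}"

definition interpolation_norm ::
    "(real \<Rightarrow> complex) set \<Rightarrow> ((real \<Rightarrow> complex) \<Rightarrow> real) \<Rightarrow>
     (real \<Rightarrow> complex) set \<Rightarrow> ((real \<Rightarrow> complex) \<Rightarrow> real) \<Rightarrow> real \<Rightarrow> (real \<Rightarrow> complex) \<Rightarrow> real" where
  "interpolation_norm X0 n0 X1 n1 \<theta> f =
     sqrt (LINT t:{0<..}|lborel. (t powr (- \<theta>) * K_functional X0 n0 X1 n1 t f)\<^sup>2 / t)"

definition sobolev :: "real \<Rightarrow> real \<Rightarrow> (real \<Rightarrow> complex) set" where
  "sobolev \<alpha> r = (let m = nat \<lfloor>r\<rfloor> in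
     if frac r = 0 then sobolev_int \<alpha> m
     else interpolation_space (sobolev_int \<alpha> m) (sobolev_int_norm \<alpha> m)
            (sobolev_int \<alpha> (m + 1)) (sobolev_int_norm \<alpha> (m + 1)) (frac r))"

definition sobolev_norm :: "real \<Rightarrow> real \<Rightarrow> (real \<Rightarrow> complex) \<Rightarrow> real" where
  "sobolev_norm \<alpha> r = (let m = nat \<lfloor>r\<rfloor> in
     if frac r = 0 then sobolev_int_norm \<alpha> m
     else interpolation_norm (sobolev_int \<alpha> m) (sobolev_int_norm \<alpha> m)
            (sobolev_int \<alpha> (m + 1)) (sobolev_int_norm \<alpha> (m + 1)) (frac r))"


definition m_const :: "real \<Rightarrow> real" where
  "m_const \<alpha> = 4.13 * (1.28 + (2 * \<alpha> + 1) / 1.9) powr 0.55"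

end

theory Submission
  imports Defs
    "HOL-Computational_Algebra.Polynomial"
    "HOL-Complex_Analysis.Great_Picard"
    "HOL-Real_Asymp.Real_Asymp"
begin

text \<open>
  Let \<open>E\<close> be the projection \<open>f \<mapsto> f - S\<^sub>N f\<close>. The orthonormal Gegenbauer polynomials
  \<open>p\<^sub>k\<close> diagonalise the Sturm--Liouville operator for \<open>c = 0\<close>, with eigenvalues
  \<open>k (k + 2 \<alpha> + 1)\<close>. In the coordinates that they provide, the operator for general \<open>c\<close>,
  increased by \<open>1\<close>, becomes \<open>A = \<Lambda> + B\<close> on square-summable sequences: \<open>\<Lambda>\<close> is diagonal with
  entries \<open>k (k + 2 \<alpha> + 1) + 1\<close>, and \<open>B\<close> is \<open>c\<^sup>2\<close> times multiplication by \<open>x\<^sup>2\<close>, a bounded,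
  symmetric, nonnegative matrix with five nonzero diagonals. Everything is then read off
  from this matrix, and four ideas carry the proof.

  \<^item> Spectral gap. On the orthogonal complement of \<open>\<psi>\<^sub>0, \<dots>, \<psi>\<^sub>N\<close> the quadratic form of \<open>A\<close> is at
    least \<open>\<chi>\<^sub>N\<^sub>+\<^sub>1 + 1\<close>. It has a minimiser on the unit sphere of this complement, because
    \<open>\<Lambda>\<close> to the power \<open>-1/2\<close> is compact (\<open>energy_minimizer\<close>), and a minimiser is an eigenvector of \<open>A\<close>
    (\<open>energy_lower_bound\<close>). Conjugating \<open>B\<close> with powers of \<open>\<Lambda>\<close> keeps it bounded, so
    eigenvectors decay faster than any power of \<open>k\<close>, and their Gegenbauer series are bounded
    solutions of the differential equation (\<open>eigenfunction_of_eigenvector\<close>). Hence the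
    minimum is some \<open>\<chi>\<^sub>j + 1\<close>, and \<open>j \<le> N\<close> is impossible since eigenvalues are simple
    (\<open>eigenvalue_simple\<close>). This step contains the completeness of the eigenfunctions.

  \<^item> Growth. The unit vectors \<open>\<psi>\<^sub>0, \<dots>, \<psi>\<^sub>N\<close> have total mass \<open>N + 1\<close>, of which at most \<open>J\<close> lies
    in the first \<open>J\<close> coordinates, by Bessel's inequality; the remaining mass makes the sum of
    their quadratic forms large. Hence \<open>\<chi>\<^sub>N + 1 \<ge> (1 + (N / 2)\<^sup>2) / 2\<close> (\<open>family_growth\<close>).

  \<^item> Rate. With \<open>X = \<chi>\<^sub>N\<^sub>+\<^sub>1 + 1\<close>, the gap yields \<open>X \<parallel>E f\<parallel>\<^sup>2 \<le> \<langle>A f, f\<rangle>\<close> and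
    \<open>X \<parallel>E f\<parallel> \<le> \<parallel>E (A f)\<parallel>\<close>. Starting from \<open>\<parallel>E f\<parallel> \<le> \<parallel>f\<parallel>\<close> and the first of these bounds, the
    second one gives by steps of two that \<open>\<parallel>E f\<parallel>\<close> is at most a constant times \<open>X\<close> to the power
    \<open>-m/2\<close> times the norm of \<open>\<Lambda>\<close> to the power \<open>m/2\<close> applied to \<open>f\<close> (\<open>proj_compl_rate\<close>).

  \<^item> Regularity. A function in the Sobolev space of integer order \<open>r\<close> has coefficients for which that
    norm with \<open>m = r\<close> is finite (\<open>sobolev_int_decay\<close>). Indeed, the derivatives \<open>p\<^sub>k\<^sup>(\<^sup>j\<^sup>)\<close> are
    orthogonal for the weight of exponent \<open>\<alpha> + j\<close>, and each weak derivative of \<open>f\<close> multiplies the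
    \<open>k\<close>-th coefficient by a number of order \<open>k\<close> once everything is normalised.

  For fractional order, \<open>E\<close> is linear and bounded on both end points of the interpolation couple
  with powers of \<open>Y = 1 + (N / 2)\<^sup>2\<close>; so \<open>\<parallel>E f\<parallel>\<close> is controlled by the K-functional at the single
  scale \<open>Y\<close> to the power \<open>-1/2\<close>, and this value is controlled by the interpolation norm because the K-functional
  is increasing (\<open>K_functional_le_interpolation_norm\<close>).
\<close>

section \<open>Square-summable sequences and band matrices\<close>

text \<open>
  A type, rather than a set of sequences, so that inner products, norms and limits are those of
  the class of real inner product spaces.
\<close>

typedef ell2 = "{u :: nat \<Rightarrow> real. summable (\<lambda>k. (u k)\<^sup>2)}" morphisms coord Ell2
  by (rule exI[of _ "\<lambda>_. 0"]) auto

setup_lifting type_definition_ell2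

lemma summable_sq_add:
  fixes u v :: "nat \<Rightarrow> real"
  assumes "summable (\<lambda>k. (u k)\<^sup>2)" "summable (\<lambda>k. (v k)\<^sup>2)"
  shows "summable (\<lambda>k. (u k + v k)\<^sup>2)"
proof (rule summable_comparison_test'[where N = 0])
  show "summable (\<lambda>k. 2 * (u k)\<^sup>2 + 2 * (v k)\<^sup>2)"
    using assms by (intro summable_add summable_mult)
  show "norm ((u n + v n)\<^sup>2) \<le> 2 * (u n)\<^sup>2 + 2 * (v n)\<^sup>2" for n
    using sum_squares_bound[of "u n" "v n"] zero_le_power2[of "u n + v n"] unfolding real_norm_def
    by (simp add: power2_sum del: zero_le_power2)
qed

lemma summable_sq_mult:
  fixes u v :: "nat \<Rightarrow> real"
  assumes "summable (\<lambda>k. (u k)\<^sup>2)" "summable (\<lambda>k. (v k)\<^sup>2)"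
  shows "summable (\<lambda>k. u k * v k)"
proof (rule summable_comparison_test'[where N = 0])
  show "summable (\<lambda>k. (u k)\<^sup>2 + (v k)\<^sup>2)"
    using assms by (intro summable_add)
  show "norm (u n * v n) \<le> (u n)\<^sup>2 + (v n)\<^sup>2" for n
  proof -
    have "0 \<le> (\<bar>u n\<bar> - \<bar>v n\<bar>)\<^sup>2" by simp
    then have "2 * (\<bar>u n\<bar> * \<bar>v n\<bar>) \<le> (u n)\<^sup>2 + (v n)\<^sup>2" by (simp add: power2_diff)
    moreover have "0 \<le> \<bar>u n\<bar> * \<bar>v n\<bar>" by simp
    ultimately show ?thesis unfolding real_norm_def abs_mult by linarith
  qed
qed

instantiation ell2 :: real_vector
begin

lift_definition zero_ell2 :: ell2 is "\<lambda>_. 0" by simp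
lift_definition plus_ell2 :: "ell2 \<Rightarrow> ell2 \<Rightarrow> ell2" is "\<lambda>u v k. u k + v k"
  by (rule summable_sq_add)
lift_definition uminus_ell2 :: "ell2 \<Rightarrow> ell2" is "\<lambda>u k. - u k" by simp
lift_definition minus_ell2 :: "ell2 \<Rightarrow> ell2 \<Rightarrow> ell2" is "\<lambda>u v k. u k - v k"
  subgoal for u v using summable_sq_add[of u "\<lambda>k. - v k"] by simp
  done
lift_definition scaleR_ell2 :: "real \<Rightarrow> ell2 \<Rightarrow> ell2" is "\<lambda>r u k. r * u k"
  by (simp add: power_mult_distrib summable_mult)

instance
proof
  fix x y z :: ell2 and r s :: real
  show "x + y + z = x + (y + z)" by transfer (simp add: add.assoc)
  show "x + y = y + x" by transfer (simp add: add.commute)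
  show "0 + x = x" by transfer simp
  show "- x + x = 0" by transfer simp
  show "x - y = x + - y" by transfer simp
  show "r *\<^sub>R (x + y) = r *\<^sub>R x + r *\<^sub>R y" by transfer (simp add: algebra_simps)
  show "(r + s) *\<^sub>R x = r *\<^sub>R x + s *\<^sub>R x" by transfer (simp add: algebra_simps)
  show "r *\<^sub>R s *\<^sub>R x = (r * s) *\<^sub>R x" by transfer (simp add: algebra_simps)
  show "1 *\<^sub>R x = x" by transfer simp
qed

end

instantiation ell2 :: real_inner
begin

lift_definition inner_ell2 :: "ell2 \<Rightarrow> ell2 \<Rightarrow> real" is "\<lambda>u v. \<Sum>k. u k * v k" .

definition norm_ell2 :: "ell2 \<Rightarrow> real" where "norm_ell2 u = sqrt (inner u u)"
definition dist_ell2 :: "ell2 \<Rightarrow> ell2 \<Rightarrow> real" where "dist_ell2 u v = norm (u - v)"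
definition sgn_ell2 :: "ell2 \<Rightarrow> ell2" where "sgn_ell2 u = u /\<^sub>R norm u"
definition uniformity_ell2 :: "(ell2 \<times> ell2) filter" where
  "uniformity_ell2 = (INF e\<in>{0<..}. principal {(x, y). dist x y < e})"
definition open_ell2 :: "ell2 set \<Rightarrow> bool" where
  "open_ell2 U = (\<forall>x\<in>U. eventually (\<lambda>(x', y). x' = x \<longrightarrow> y \<in> U) uniformity)"

instance
proof
  fix x y z :: ell2 and r :: real and U :: "ell2 set"
  show "dist x y = norm (x - y)" by (rule dist_ell2_def)
  show "sgn x = x /\<^sub>R norm x" by (rule sgn_ell2_def)
  show "uniformity = (INF e\<in>{0<..}. principal {(x :: ell2, y). dist x y < e})"
    by (rule uniformity_ell2_def)
  show "open U = (\<forall>x\<in>U. \<forall>\<^sub>F (x', y) in uniformity. x' = x \<longrightarrow> y \<in> U)"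
    by (rule open_ell2_def)
  show "inner x y = inner y x" by transfer (simp add: mult.commute)
  show "inner (x + y) z = inner x z + inner y z"
    by transfer (simp add: distrib_right suminf_add summable_sq_mult)
  show "inner (r *\<^sub>R x) y = r * inner x y"
    by transfer (simp add: mult.assoc suminf_mult summable_sq_mult)
  show "0 \<le> inner x x"
    by transfer (simp add: power2_eq_square suminf_nonneg)
  show "inner x x = 0 \<longleftrightarrow> x = 0"
    by transfer (simp add: power2_eq_square suminf_eq_zero_iff fun_eq_iff)
  show "norm x = sqrt (inner x x)" by (rule norm_ell2_def)
qed

end

lemma coord_zero [simp]: "coord 0 k = 0" by transfer simp
lemma coord_add [simp]: "coord (u + v) k = coord u k + coord v k" by transfer simp
lemma coord_diff [simp]: "coord (u - v) k = coord u k - coord v k" by transfer simp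
lemma coord_scaleR [simp]: "coord (r *\<^sub>R u) k = r * coord u k" by transfer simp
lemma coord_sum [simp]: "coord (\<Sum>i\<in>I. f i) k = (\<Sum>i\<in>I. coord (f i) k)"
  by (induction I rule: infinite_finite_induct) auto

lemma ell2_eqI: "(\<And>k. coord u k = coord v k) \<Longrightarrow> u = v"
  by (metis coord_inject ext)

lemma summable_coord_sq: "summable (\<lambda>k. (coord u k)\<^sup>2)"
  using coord[of u] by simp

lemma inner_ell2_sums: "(\<lambda>k. coord u k * coord v k) sums inner u v"
  unfolding inner_ell2.rep_eq
  by (intro summable_sums summable_sq_mult summable_coord_sq)

lemma norm_ell2_sums: "(\<lambda>k. (coord u k)\<^sup>2) sums (norm u)\<^sup>2"
  using inner_ell2_sums[of u u] by (simp only: power2_norm_eq_inner power2_eq_square[of "coord u k" for k])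

lemma sum_coord_sq_le:
  assumes "finite J"
  shows "(\<Sum>k\<in>J. (coord u k)\<^sup>2) \<le> (norm u)\<^sup>2"
  using sum_le_suminf[OF summable_coord_sq assms, of u] norm_ell2_sums[of u]
  by (simp add: sums_iff)

lemma coord_le_norm: "\<bar>coord u k\<bar> \<le> norm u"
  using sum_coord_sq_le[of "{k}" u] by (simp add: abs_le_square_iff[symmetric])

lemma ell2_of_bounded_sums:
  fixes f :: "nat \<Rightarrow> real"
  assumes "\<And>n. (\<Sum>k<n. (f k)\<^sup>2) \<le> C"
  shows "coord (Ell2 f) = f" "(norm (Ell2 f))\<^sup>2 \<le> C"
proof -
  have s: "summable (\<lambda>k. (f k)\<^sup>2)"
    using assms by (intro summableI_nonneg_bounded[where x = C]) auto
  then show *: "coord (Ell2 f) = f" by (simp add: Ell2_inverse)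
  have "(norm (Ell2 f))\<^sup>2 = (\<Sum>k. (f k)\<^sup>2)"
    using norm_ell2_sums[of "Ell2 f"] by (simp add: * sums_iff)
  also have "\<dots> \<le> C" using s assms by (intro suminf_le_const) auto
  finally show "(norm (Ell2 f))\<^sup>2 \<le> C" .
qed

definition unit_seq :: "nat \<Rightarrow> ell2" where
  "unit_seq k = Ell2 (\<lambda>j. if j = k then 1 else 0)"

lemma coord_unit_seq [simp]: "coord (unit_seq k) j = (if j = k then 1 else 0)"
proof -
  have "(\<Sum>i<n. (if i = k then 1 else 0 :: real)\<^sup>2) \<le> 1" for n
    by (simp add: if_distrib[of "\<lambda>x. x\<^sup>2"] cong: if_cong)
  from ell2_of_bounded_sums(1)[OF this] show ?thesis by (simp add: unit_seq_def)
qed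

lemma inner_unit_seq [simp]: "inner u (unit_seq k) = coord u k"
proof -
  have "(\<lambda>j. if j = k then coord u k else 0) sums coord u k"
    by (rule sums_single)
  moreover have "(\<lambda>j. coord u j * coord (unit_seq k) j) = (\<lambda>j. if j = k then coord u k else 0)"
    by auto
  ultimately show ?thesis using inner_ell2_sums[of u "unit_seq k"] sums_unique2 by metis
qed

definition truncate :: "nat \<Rightarrow> ell2 \<Rightarrow> ell2" where
  "truncate n u = (\<Sum>k<n. coord u k *\<^sub>R unit_seq k)"

lemma coord_truncate: "coord (truncate n u) k = (if k < n then coord u k else 0)"
  unfolding truncate_def by (simp add: if_distrib cong: if_cong)

lemma truncate_tendsto: "(\<lambda>n. truncate n u) \<longlonglongrightarrow> u"
proof -
  have eq: "(norm (u - truncate n u))\<^sup>2 = (norm u)\<^sup>2 - (\<Sum>k<n. (coord u k)\<^sup>2)" for n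
  proof -
    have "(\<lambda>k. (coord (u - truncate n u) k)\<^sup>2) sums ((norm u)\<^sup>2 - (\<Sum>k<n. (coord u k)\<^sup>2))"
    proof -
      have "(\<lambda>k. if k \<in> {..<n} then (coord u k)\<^sup>2 else 0) sums (\<Sum>k<n. (coord u k)\<^sup>2)"
        by (rule sums_If_finite_set) simp
      from sums_diff[OF norm_ell2_sums[of u] this] show ?thesis
        by (rule sums_cong[THEN iffD1, rotated]) (auto simp: coord_truncate)
    qed
    then show ?thesis using norm_ell2_sums sums_unique2 by blast
  qed
  have "(\<lambda>n. (norm u)\<^sup>2 - (\<Sum>k<n. (coord u k)\<^sup>2)) \<longlonglongrightarrow> (norm u)\<^sup>2 - (norm u)\<^sup>2"
    using norm_ell2_sums[of u] unfolding sums_def by (intro tendsto_intros)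
  then have "(\<lambda>n. sqrt ((norm (u - truncate n u))\<^sup>2)) \<longlonglongrightarrow> sqrt 0"
    unfolding eq by (intro tendsto_real_sqrt) simp
  then have "(\<lambda>n. norm (truncate n u - u)) \<longlonglongrightarrow> 0"
    by (simp add: norm_minus_commute)
  then show ?thesis using Lim_null tendsto_norm_zero_iff by blast
qed

definition diag_op :: "(nat \<Rightarrow> real) \<Rightarrow> ell2 \<Rightarrow> ell2" where
  "diag_op t u = Ell2 (\<lambda>k. t k * coord u k)"

lemma diag_op_bound:
  assumes "\<And>k. \<bar>t k\<bar> \<le> 1"
  shows "coord (diag_op t u) = (\<lambda>k. t k * coord u k)" "(norm (diag_op t u))\<^sup>2 \<le> (norm u)\<^sup>2"
proof -
  have "(\<Sum>k<n. (t k * coord u k)\<^sup>2) \<le> (norm u)\<^sup>2" for n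
  proof -
    have "(t k)\<^sup>2 \<le> 1" for k using assms[of k] by (simp add: abs_square_le_1)
    then have "(\<Sum>k<n. (t k * coord u k)\<^sup>2) \<le> (\<Sum>k<n. (coord u k)\<^sup>2)"
      by (intro sum_mono) (simp add: power_mult_distrib mult_left_le_one_le)
    also have "\<dots> \<le> (norm u)\<^sup>2" by (rule sum_coord_sq_le) simp
    finally show ?thesis .
  qed
  from ell2_of_bounded_sums[OF this]
  show "coord (diag_op t u) = (\<lambda>k. t k * coord u k)" "(norm (diag_op t u))\<^sup>2 \<le> (norm u)\<^sup>2"
    by (simp_all add: diag_op_def)
qed

definition band_op :: "(nat \<Rightarrow> nat \<Rightarrow> real) \<Rightarrow> ell2 \<Rightarrow> ell2" where
  "band_op b u = Ell2 (\<lambda>k. \<Sum>j\<le>k+2. b k j * coord u j)"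

text \<open>
  The second conjunct confines the matrix to its five central diagonals: multiplication by
  \<open>x\<^sup>2\<close> changes the degree of a polynomial by at most two.
\<close>

definition band_matrix :: "(nat \<Rightarrow> nat \<Rightarrow> real) \<Rightarrow> real \<Rightarrow> bool" where
  "band_matrix b \<beta> \<longleftrightarrow> (\<forall>k j. \<bar>b k j\<bar> \<le> \<beta>) \<and> (\<forall>k j. k + 2 < j \<or> j + 2 < k \<longrightarrow> b k j = 0)"

text \<open>
  Schur's test by hand: each row has at most five entries of size \<open>\<beta>\<close>, and each coordinate of
  \<open>u\<close> enters at most five rows, so Cauchy--Schwarz in every row costs a factor \<open>(5 \<beta>)\<^sup>2\<close> in the
  squared norm.
\<close>

lemma band_op_bound:
  assumes b: "band_matrix b \<beta>"
  shows "coord (band_op b u) = (\<lambda>k. \<Sum>j\<le>k+2. b k j * coord u j)"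
    and "norm (band_op b u) \<le> 5 * \<beta> * norm u"
proof -
  have \<beta>: "0 \<le> \<beta>" using b unfolding band_matrix_def by (metis abs_ge_zero order_trans)
  define J where "J k = {j. j \<le> k + 2 \<and> k \<le> j + 2}" for k :: nat
  have J: "finite (J k)" "card (J k) \<le> 5" for k
  proof -
    have sub: "J k \<subseteq> {k - 2..k + 2}" by (auto simp: J_def)
    then show "finite (J k)" using finite_subset by blast
    have "card (J k) \<le> card {k - 2..k + 2}" using sub by (intro card_mono) auto
    then show "card (J k) \<le> 5" by simp
  qed
  have row: "(\<Sum>j\<le>k+2. b k j * coord u j)\<^sup>2 \<le> 5 * \<beta>\<^sup>2 * (\<Sum>j\<in>J k. (coord u j)\<^sup>2)" for k
  proof -
    have "(\<Sum>j\<le>k+2. b k j * coord u j) = (\<Sum>j\<in>J k. b k j * coord u j)"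
      using b unfolding band_matrix_def
      by (intro sum.mono_neutral_right) (fastforce simp: J_def not_le)+
    also have "(\<dots>)\<^sup>2 \<le> (\<Sum>j\<in>J k. (b k j)\<^sup>2) * (\<Sum>j\<in>J k. (coord u j)\<^sup>2)"
      by (rule Cauchy_Schwarz_ineq_sum)
    also have "(\<Sum>j\<in>J k. (b k j)\<^sup>2) \<le> (\<Sum>j\<in>J k. \<beta>\<^sup>2)"
    proof (rule sum_mono)
      fix j show "(b k j)\<^sup>2 \<le> \<beta>\<^sup>2"
        using b \<beta> unfolding band_matrix_def by (metis abs_le_square_iff abs_of_nonneg)
    qed
    also have "(\<Sum>j\<in>J k. \<beta>\<^sup>2) = real (card (J k)) * \<beta>\<^sup>2" by simp
    also have "\<dots> \<le> 5 * \<beta>\<^sup>2" using J(2)[of k] by (intro mult_right_mono) auto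
    finally show ?thesis by (simp add: mult_right_mono sum_nonneg)
  qed
  have "(\<Sum>k<n. (\<Sum>j\<le>k+2. b k j * coord u j)\<^sup>2) \<le> (5 * \<beta> * norm u)\<^sup>2" for n
  proof -
    have "(\<Sum>k<n. (\<Sum>j\<le>k+2. b k j * coord u j)\<^sup>2)
        \<le> (\<Sum>k<n. 5 * \<beta>\<^sup>2 * (\<Sum>j\<in>J k. (coord u j)\<^sup>2))"
      by (intro sum_mono row)
    also have "\<dots> = 5 * \<beta>\<^sup>2 * (\<Sum>k<n. \<Sum>j\<in>J k. (coord u j)\<^sup>2)"
      by (simp add: sum_distrib_left)
    also have "(\<Sum>k<n. \<Sum>j\<in>J k. (coord u j)\<^sup>2)
        = (\<Sum>k<n. \<Sum>j<n+2. if j \<in> J k then (coord u j)\<^sup>2 else 0)"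
    proof (rule sum.cong[OF refl])
      fix k assume "k \<in> {..<n}"
      then have "J k = {j \<in> {..<n+2}. j \<in> J k}" by (auto simp: J_def)
      then show "(\<Sum>j\<in>J k. (coord u j)\<^sup>2) = (\<Sum>j<n+2. if j \<in> J k then (coord u j)\<^sup>2 else 0)"
        by (subst sum.inter_filter[symmetric]) auto
    qed
    also have "\<dots> = (\<Sum>j<n+2. \<Sum>k<n. if k \<in> J j then (coord u j)\<^sup>2 else 0)"
      by (subst sum.swap) (auto simp: J_def intro!: sum.cong)
    also have "\<dots> \<le> (\<Sum>j<n+2. 5 * (coord u j)\<^sup>2)"
    proof (rule sum_mono)
      fix j
      have "(\<Sum>k<n. if k \<in> J j then (coord u j)\<^sup>2 else 0) = (\<Sum>k\<in>{k\<in>{..<n}. k \<in> J j}. (coord u j)\<^sup>2)"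
        by (subst sum.inter_filter) auto
      also have "\<dots> \<le> (\<Sum>k\<in>J j. (coord u j)\<^sup>2)" using J(1) by (intro sum_mono2) auto
      also have "\<dots> \<le> 5 * (coord u j)\<^sup>2" using J(2)[of j] by (simp add: mult_right_mono)
      finally show "(\<Sum>k<n. if k \<in> J j then (coord u j)\<^sup>2 else 0) \<le> 5 * (coord u j)\<^sup>2" .
    qed
    also have "\<dots> = 5 * (\<Sum>j<n+2. (coord u j)\<^sup>2)"
      by (rule sum_distrib_left[symmetric])
    also have "\<dots> \<le> 5 * (norm u)\<^sup>2"
      by (intro mult_left_mono sum_coord_sq_le) auto
    finally show ?thesis by (simp add: power_mult_distrib mult_left_mono)
  qed
  note * = ell2_of_bounded_sums[OF this]
  from * show "coord (band_op b u) = (\<lambda>k. \<Sum>j\<le>k+2. b k j * coord u j)"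
    by (simp add: band_op_def)
  from *(2) show "norm (band_op b u) \<le> 5 * \<beta> * norm u"
    using \<beta> unfolding band_op_def by (meson mult_nonneg_nonneg norm_ge_zero power2_le_imp_le zero_le_numeral)
qed

lemma bounded_linear_band_op:
  assumes b: "band_matrix b \<beta>"
  shows "bounded_linear (band_op b)"
proof (rule bounded_linear_intro[where K = "5 * \<beta>"])
  show "band_op b (x + y) = band_op b x + band_op b y" for x y
    by (rule ell2_eqI) (simp add: band_op_bound(1)[OF b] sum.distrib distrib_left)
  show "band_op b (r *\<^sub>R x) = r *\<^sub>R band_op b x" for r x
    by (rule ell2_eqI) (simp add: band_op_bound(1)[OF b] sum_distrib_left distrib_left mult.left_commute)
  show "norm (band_op b x) \<le> norm x * (5 * \<beta>)" for x
    using band_op_bound(2)[OF b, of x] by (simp add: mult.commute)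
qed

lemma band_op_unit_seq:
  assumes b: "band_matrix b \<beta>"
  shows "coord (band_op b (unit_seq j)) k = b k j"
proof -
  have "(\<Sum>i\<le>k+2. b k i * coord (unit_seq j) i) = (\<Sum>i\<le>k+2. if i = j then b k j else 0)"
    by (intro sum.cong) auto
  also have "\<dots> = b k j" using b unfolding band_matrix_def by (auto simp: not_le)
  finally show ?thesis by (simp add: band_op_bound(1)[OF b])
qed

lemma inner_truncate_band_op:
  assumes b: "band_matrix b \<beta>"
  shows "inner (band_op b (truncate n u)) (truncate n v)
       = (\<Sum>k<n. \<Sum>j<n. b k j * coord u j * coord v k)"
proof -
  have lin: "linear (band_op b)" using bounded_linear_band_op[OF b] bounded_linear.linear by blast
  have "band_op b (truncate n u) = (\<Sum>j<n. coord u j *\<^sub>R band_op b (unit_seq j))"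
    unfolding truncate_def by (simp add: linear_sum[OF lin] linear_cmul[OF lin])
  then have "inner (band_op b (truncate n u)) (truncate n v)
     = (\<Sum>k<n. coord v k * (\<Sum>j<n. coord u j * b k j))"
    unfolding truncate_def[of n v]
    by (simp add: inner_sum_right band_op_unit_seq[OF b])
  then show ?thesis by (simp add: sum_distrib_left mult_ac)
qed

text \<open>
  Symmetry is an identity between finite double sums for truncated sequences, and truncations
  converge in norm.
\<close>

lemma band_op_symmetric:
  assumes b: "band_matrix b \<beta>" and sym: "\<And>k j. b k j = b j k"
  shows "inner (band_op b u) v = inner u (band_op b v)"
proof -
  have eq: "inner (band_op b (truncate n u)) (truncate n v)
      = inner (truncate n u) (band_op b (truncate n v))" for n
    unfolding inner_truncate_band_op[OF b] inner_commute[of "truncate n u"]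
    by (subst sum.swap) (simp add: sym mult_ac)
  note [tendsto_intros] = truncate_tendsto bounded_linear.tendsto[OF bounded_linear_band_op[OF b]]
  have "(\<lambda>n. inner (band_op b (truncate n u)) (truncate n v)) \<longlonglongrightarrow> inner (band_op b u) v"
    by (intro tendsto_intros)
  moreover have "(\<lambda>n. inner (truncate n u) (band_op b (truncate n v))) \<longlonglongrightarrow> inner u (band_op b v)"
    by (intro tendsto_intros)
  ultimately show ?thesis unfolding eq using LIMSEQ_unique by blast
qed

lemma band_op_nonneg:
  assumes b: "band_matrix b \<beta>"
    and pos: "\<And>n (x :: nat \<Rightarrow> real). 0 \<le> (\<Sum>k<n. \<Sum>j<n. b k j * x j * x k)"
  shows "0 \<le> inner (band_op b u) u"
proof -
  note [tendsto_intros] = truncate_tendsto bounded_linear.tendsto[OF bounded_linear_band_op[OF b]]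
  have "(\<lambda>n. inner (band_op b (truncate n u)) (truncate n u)) \<longlonglongrightarrow> inner (band_op b u) u"
    by (intro tendsto_intros)
  then show ?thesis
    by (rule LIMSEQ_le_const) (auto simp: inner_truncate_band_op[OF b] pos)
qed

section \<open>Diagonal plus bounded operators: minimisation of the energy\<close>

definition orthonormal_upto :: "nat \<Rightarrow> (nat \<Rightarrow> 'a::real_inner) \<Rightarrow> bool" where
  "orthonormal_upto N v \<longleftrightarrow> (\<forall>i\<le>N. \<forall>j\<le>N. inner (v i) (v j) = (if i = j then 1 else 0))"

definition proj_compl :: "nat \<Rightarrow> (nat \<Rightarrow> 'a::real_inner) \<Rightarrow> 'a \<Rightarrow> 'a" where
  "proj_compl N v u = u - (\<Sum>i\<le>N. inner u (v i) *\<^sub>R v i)"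

lemma inner_proj_compl:
  assumes "orthonormal_upto N v" "j \<le> N"
  shows "inner (proj_compl N v u) (v j) = 0"
proof -
  have "(\<Sum>i\<le>N. inner u (v i) * inner (v i) (v j)) = (\<Sum>i\<le>N. if i = j then inner u (v j) else 0)"
    using assms unfolding orthonormal_upto_def by (intro sum.cong) auto
  then show ?thesis using assms(2)
    by (simp add: proj_compl_def inner_diff_left inner_sum_left)
qed

lemma norm_proj_compl:
  assumes "orthonormal_upto N v"
  shows "(norm (proj_compl N v u))\<^sup>2 = (norm u)\<^sup>2 - (\<Sum>i\<le>N. (inner u (v i))\<^sup>2)"
proof -
  have "(norm (proj_compl N v u))\<^sup>2 = inner (proj_compl N v u) u"
    unfolding power2_norm_eq_inner
    by (subst (2) proj_compl_def) (simp add: inner_diff_right inner_sum_right inner_proj_compl[OF assms])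
  also have "\<dots> = (norm u)\<^sup>2 - (\<Sum>i\<le>N. (inner u (v i))\<^sup>2)"
    by (simp add: proj_compl_def inner_diff_left inner_sum_left power2_norm_eq_inner
        power2_eq_square[of "inner u _"] inner_commute[of "v _" u])
  finally show ?thesis .
qed

lemma norm_proj_compl_le:
  assumes "orthonormal_upto N v"
  shows "norm (proj_compl N v u) \<le> norm u"
proof (rule power2_le_imp_le)
  show "(norm (proj_compl N v u))\<^sup>2 \<le> (norm u)\<^sup>2"
    by (simp add: norm_proj_compl[OF assms] sum_nonneg)
qed simp

lemma Bessel_upto:
  assumes "orthonormal_upto N v"
  shows "(\<Sum>i\<le>N. (inner u (v i))\<^sup>2) \<le> (norm u)\<^sup>2"
  using norm_proj_compl[OF assms, of u] zero_le_power2[of "norm (proj_compl N v u)"] by linarith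

text \<open>
  The first-variation principle: a quadratic polynomial in \<open>s\<close> that is nonnegative and vanishes
  at \<open>0\<close> has no linear term.
\<close>

lemma linear_form_zero:
  fixes a b :: real
  assumes "\<And>s. 0 \<le> 2 * s * a + s\<^sup>2 * b"
  shows "a = 0"
proof (rule ccontr)
  assume "a \<noteq> 0"
  \<comment> \<open>near-minimiser of the polynomial, with a positive leading coefficient in place of \<open>b\<close>\<close>
  define s where "s = - a / (\<bar>b\<bar> + 1)"
  have p: "0 < \<bar>b\<bar> + 1" by simp
  have "s\<^sup>2 * b \<le> s\<^sup>2 * (\<bar>b\<bar> + 1)" by (intro mult_left_mono) auto
  also have "\<dots> = a\<^sup>2 / (\<bar>b\<bar> + 1)"
    using p by (simp add: s_def power_divide power2_eq_square[of "\<bar>b\<bar> + 1"])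
  finally have "2 * s * a + s\<^sup>2 * b \<le> - (a\<^sup>2 / (\<bar>b\<bar> + 1))"
    by (simp add: s_def power2_eq_square)
  also have "\<dots> < 0" using \<open>a \<noteq> 0\<close> p by simp
  finally show False using assms[of s] by simp
qed

text \<open>
  The unbounded operator \<open>A\<close> with diagonal \<open>lam\<close> plus \<open>B\<close> is never named. Its form domain is
  the range of the compact operator \<open>T\<close>, the multiplication by the inverse square roots of
  \<open>lam\<close>, and \<open>energy w w'\<close> is the quadratic form of \<open>A\<close> at \<open>T w\<close> and \<open>T w'\<close>. Working with
  \<open>w\<close> instead of \<open>T w\<close> keeps every vector square-summable.
\<close>

locale discrete_spectrum =
  fixes lam :: "nat \<Rightarrow> real" and B :: "ell2 \<Rightarrow> ell2"
  assumes lam_ge_1: "\<And>k. 1 \<le> lam k"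
    and lam_at_top: "filterlim lam at_top sequentially"
    and bounded_linear_B: "bounded_linear B"
    and B_symmetric: "\<And>u v. inner (B u) v = inner u (B v)"
    and B_nonneg: "\<And>u. 0 \<le> inner (B u) u"
begin

definition T :: "ell2 \<Rightarrow> ell2" where "T = diag_op (\<lambda>k. 1 / sqrt (lam k))"

definition energy :: "ell2 \<Rightarrow> ell2 \<Rightarrow> real" where
  "energy w w' = inner w w' + inner (B (T w)) (T w')"

definition eigen :: "real \<Rightarrow> ell2 \<Rightarrow> bool" where
  "eigen \<mu> v \<longleftrightarrow> (\<forall>k. lam k * coord v k + coord (B v) k = \<mu> * coord v k)"

lemma lam_pos [simp]: "0 < lam k" "0 \<le> lam k" "lam k \<noteq> 0"
  using lam_ge_1[of k] by linarith+

lemma T_weight_le_1: "\<bar>1 / sqrt (lam k)\<bar> \<le> 1"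
  using lam_ge_1[of k] by simp

lemma coord_T [simp]: "coord (T u) k = coord u k / sqrt (lam k)"
  unfolding T_def by (subst diag_op_bound(1)) (use T_weight_le_1 in auto)

lemma norm_T_le: "norm (T u) \<le> norm u"
  unfolding T_def by (rule power2_le_imp_le[OF diag_op_bound(2)]) (use T_weight_le_1 in auto)

lemma linear_T: "linear T"
  by (rule linearI) (rule ell2_eqI, simp add: add_divide_distrib)+

lemmas T_linear = linear_add[OF linear_T] linear_diff[OF linear_T] linear_cmul[OF linear_T]
  linear_sum[OF linear_T]

lemma linear_T_power: "linear (T ^^ m)"
proof (induction m)
  case (Suc m)
  show ?case using linear_compose[OF Suc linear_T] by (simp add: o_def)
qed (simp add: linear_iff)

lemma linear_B: "linear B" using bounded_linear_B bounded_linear.linear by blast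

lemmas B_linear = linear_add[OF linear_B] linear_diff[OF linear_B] linear_cmul[OF linear_B]
  linear_sum[OF linear_B]

lemma T_symmetric: "inner (T u) v = inner u (T v)"
  using inner_ell2_sums[of "T u" v] inner_ell2_sums[of u "T v"]
  by (simp add: sums_iff)

lemma energy_linear:
  "energy (u + v) w = energy u w + energy v w" "energy (u - v) w = energy u w - energy v w"
  "energy (r *\<^sub>R u) w = r * energy u w"
  "energy (\<Sum>i\<in>I. f i) w = (\<Sum>i\<in>I. energy (f i) w)"
  by (simp_all add: energy_def T_linear B_linear inner_add_left inner_diff_left
      inner_sum_left algebra_simps sum.distrib)

lemma energy_commute: "energy u v = energy v u"
  unfolding energy_def by (metis B_symmetric inner_commute)

lemma energy_linear_right:
  "energy w (u + v) = energy w u + energy w v" "energy w (u - v) = energy w u - energy w v"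
  "energy w (r *\<^sub>R u) = r * energy w u"
  "energy w (\<Sum>i\<in>I. f i) = (\<Sum>i\<in>I. energy w (f i))"
  by (simp_all add: energy_commute[of w] energy_linear)

lemma norm_sq_le_energy: "(norm w)\<^sup>2 \<le> energy w w"
  unfolding energy_def power2_norm_eq_inner using B_nonneg by simp

lemma eigen_eq_T:
  assumes "eigen \<mu> v"
  shows "v = T (T (\<mu> *\<^sub>R v - B v))"
proof (rule ell2_eqI)
  fix k
  have "\<mu> * coord v k - coord (B v) k = lam k * coord v k"
    using assms unfolding eigen_def by (metis add_diff_cancel_right')
  moreover have "sqrt (lam k) * sqrt (lam k) = lam k"
    using lam_pos(2) by (simp add: real_sqrt_mult_self)
  ultimately show "coord v k = coord (T (T (\<mu> *\<^sub>R v - B v))) k" by (simp add: divide_divide_eq_left)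
qed

text \<open>
  For an eigenvector \<open>v\<close> the equation \<open>A v = \<mu> v\<close> exhibits \<open>v\<close> as \<open>T (T (\<mu> v - B v))\<close>; this is
  the vector that \<open>T\<close> sends to \<open>v\<close>.
\<close>

definition form_preimage :: "real \<Rightarrow> ell2 \<Rightarrow> ell2" where "form_preimage \<mu> v = T (\<mu> *\<^sub>R v - B v)"

lemma T_form_preimage: "eigen \<mu> v \<Longrightarrow> T (form_preimage \<mu> v) = v"
  using eigen_eq_T unfolding form_preimage_def by simp

lemma energy_form_preimage:
  assumes "eigen \<mu> v"
  shows "energy w (form_preimage \<mu> v) = \<mu> * inner (T w) v"
  unfolding energy_def T_form_preimage[OF assms] B_symmetric
  unfolding form_preimage_def T_symmetric[symmetric]
  by (simp add: inner_diff_right)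

lemma eigen_orthogonal:
  assumes "eigen \<mu> v" "eigen \<mu>' v'" "\<mu> \<noteq> \<mu>'"
  shows "inner v v' = 0"
proof -
  have "\<mu>' * inner v v' = \<mu> * inner v v'"
    using energy_form_preimage[OF assms(1), of "form_preimage \<mu>' v'"] energy_form_preimage[OF assms(2), of "form_preimage \<mu> v"]
    unfolding T_form_preimage[OF assms(1)] T_form_preimage[OF assms(2)]
    by (metis energy_commute inner_commute)
  then show ?thesis using assms(3) by auto
qed

text \<open>
  Testing with the vector that \<open>T\<close> maps to the \<open>k\<close>-th unit sequence gives the \<open>k\<close>-th coordinate of the eigenvalue
  equation.
\<close>

lemma weak_eigen_imp_eigen:
  assumes "\<And>w'. energy w w' = m * inner (T w) (T w')"
  shows "eigen m (T w)"
  unfolding eigen_def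
proof
  fix k
  have sq: "sqrt (lam k) * sqrt (lam k) = lam k" "sqrt (lam k) \<noteq> 0"
    using lam_pos[of k] by simp_all
  have T: "T (sqrt (lam k) *\<^sub>R unit_seq k) = unit_seq k"
    by (rule ell2_eqI) (use sq in auto)
  have "sqrt (lam k) * coord w k + coord (B (T w)) k = m * coord (T w) k"
    using assms[of "sqrt (lam k) *\<^sub>R unit_seq k"] unfolding energy_def T by simp
  moreover have "sqrt (lam k) * coord w k = lam k * coord (T w) k"
    using sq by (simp add: field_simps)
  ultimately show "lam k * coord (T w) k + coord (B (T w)) k = m * coord (T w) k" by simp
qed

text \<open>
  Compactness in the only form needed: \<open>T\<close> turns bounded, coordinatewise null sequences into
  norm-null ones. The first coordinates are few, and the tail is small because \<open>lam\<close> tends to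
  infinity.
\<close>

lemma T_compact:
  assumes bd: "\<And>i. norm (w i) \<le> C" and conv: "\<And>k. (\<lambda>i. coord (w i) k) \<longlonglongrightarrow> 0"
  shows "(\<lambda>i. T (w i)) \<longlonglongrightarrow> 0"
proof -
  have "(\<lambda>i. (norm (T (w i)))\<^sup>2) \<longlonglongrightarrow> 0"
  proof (rule LIMSEQ_I)
    fix e :: real assume e: "0 < e"
    have C: "0 \<le> C" using bd[of 0] norm_ge_zero order_trans by blast
    obtain n where n: "\<And>k. k \<ge> n \<Longrightarrow> 2 * (C\<^sup>2 + 1) / e \<le> lam k"
      using lam_at_top unfolding filterlim_at_top eventually_sequentially by blast
    have est: "(norm (T (w i)))\<^sup>2 \<le> (\<Sum>k<n. (coord (w i) k)\<^sup>2) + e / (2 * (C\<^sup>2 + 1)) * C\<^sup>2" for i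
    proof -
      have p: "0 < C\<^sup>2 + 1" by (rule add_nonneg_pos) auto
      have le: "(coord (T (w i)) k)\<^sup>2 \<le> (if k \<in> {..<n} then (coord (w i) k)\<^sup>2 else 0) + e / (2 * (C\<^sup>2 + 1)) * (coord (w i) k)\<^sup>2" for k
      proof (cases "k < n")
        case True
        have "(coord (w i) k)\<^sup>2 / lam k \<le> (coord (w i) k)\<^sup>2 / 1"
          by (intro divide_left_mono) (use lam_ge_1[of k] in auto)
        moreover have "0 \<le> e / (2 * (C\<^sup>2 + 1)) * (coord (w i) k)\<^sup>2" using e p by simp
        ultimately show ?thesis using True lam_pos(2)[of k] by (simp add: power_divide)
      next
        case False
        then have "2 * (C\<^sup>2 + 1) / e \<le> lam k" using n by simp
        then have "1 / lam k \<le> 1 / (2 * (C\<^sup>2 + 1) / e)"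
          using e p by (intro divide_left_mono) auto
        then have "1 / lam k * (coord (w i) k)\<^sup>2 \<le> e / (2 * (C\<^sup>2 + 1)) * (coord (w i) k)\<^sup>2"
          by (intro mult_right_mono) auto
        then show ?thesis using False lam_pos(2)[of k] by (simp add: power_divide)
      qed
      have su: "(\<lambda>k. (if k \<in> {..<n} then (coord (w i) k)\<^sup>2 else 0) + e / (2 * (C\<^sup>2 + 1)) * (coord (w i) k)\<^sup>2)
          sums ((\<Sum>k<n. (coord (w i) k)\<^sup>2) + e / (2 * (C\<^sup>2 + 1)) * (norm (w i))\<^sup>2)"
        by (intro sums_add sums_mult norm_ell2_sums sums_If_finite_set) simp
      have "(norm (T (w i)))\<^sup>2 \<le> (\<Sum>k<n. (coord (w i) k)\<^sup>2) + e / (2 * (C\<^sup>2 + 1)) * (norm (w i))\<^sup>2"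
        by (rule sums_le[OF le norm_ell2_sums su])
      moreover have "e / (2 * (C\<^sup>2 + 1)) * (norm (w i))\<^sup>2 \<le> e / (2 * (C\<^sup>2 + 1)) * C\<^sup>2"
        using e p bd[of i] by (intro mult_left_mono power_mono) auto
      ultimately show ?thesis by linarith
    qed
    have "(\<lambda>i. \<Sum>k<n. (coord (w i) k)\<^sup>2) \<longlonglongrightarrow> (\<Sum>k<n. 0\<^sup>2)"
      by (intro tendsto_intros conv)
    then obtain M where M: "\<And>i. i \<ge> M \<Longrightarrow> (\<Sum>k<n. (coord (w i) k)\<^sup>2) < e / 2"
      using LIMSEQ_D[of "\<lambda>i. \<Sum>k<n. (coord (w i) k)\<^sup>2" _ "e/2"] e by fastforce
    have small: "e / (2 * (C\<^sup>2 + 1)) * C\<^sup>2 \<le> e / 2"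
    proof -
      have p: "0 < C\<^sup>2 + 1" by (rule add_nonneg_pos) auto
      then have "C\<^sup>2 / (C\<^sup>2 + 1) \<le> 1" by simp
      then have "e / 2 * (C\<^sup>2 / (C\<^sup>2 + 1)) \<le> e / 2 * 1" using e by (intro mult_left_mono) auto
      then show ?thesis by simp
    qed
    show "\<exists>no. \<forall>i\<ge>no. norm ((norm (T (w i)))\<^sup>2 - 0) < e"
    proof (intro exI[of _ M] allI impI)
      fix i assume "M \<le> i"
      from M[OF this] est[of i] small have "(norm (T (w i)))\<^sup>2 < e" by linarith
      then show "norm ((norm (T (w i)))\<^sup>2 - 0) < e" by simp
    qed
  qed
  then have "(\<lambda>i. sqrt ((norm (T (w i)))\<^sup>2)) \<longlonglongrightarrow> sqrt 0" by (rule tendsto_real_sqrt)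
  then have "(\<lambda>i. norm (T (w i))) \<longlonglongrightarrow> 0" by simp
  then show ?thesis using tendsto_norm_zero_iff by blast
qed

text \<open>
  The direct method. A minimising sequence is bounded since the energy dominates the norm; a
  subsequence converges in every coordinate, its images under \<open>T\<close> converge in norm, so the
  constraints and the part of the energy that contains \<open>B\<close> pass to the limit, while the norm
  can only drop.
\<close>

lemma energy_minimizer:
  fixes v :: "nat \<Rightarrow> ell2"
  assumes w0: "T w0 \<noteq> 0" "\<forall>i\<le>N. inner (T w0) (v i) = 0"
  shows "\<exists>w. norm (T w) = 1 \<and> (\<forall>i\<le>N. inner (T w) (v i) = 0) \<and>
    (\<forall>w'. (\<forall>i\<le>N. inner (T w') (v i) = 0) \<longrightarrow> energy w w * (norm (T w'))\<^sup>2 \<le> energy w' w')"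
proof -
  define Adm where "Adm = {w. norm (T w) = 1 \<and> (\<forall>i\<le>N. inner (T w) (v i) = 0)}"
  define m where "m = (INF w\<in>Adm. energy w w)"
  have scale: "(1 / norm (T w)) *\<^sub>R w \<in> Adm"
    if "T w \<noteq> 0" "\<forall>i\<le>N. inner (T w) (v i) = 0" for w
    using that by (simp add: Adm_def T_linear)
  have ne: "Adm \<noteq> {}" using scale[OF w0] by blast
  have e0: "0 \<le> energy w w" for w using norm_sq_le_energy[of w] zero_le_power2[of "norm w"] by linarith
  have bdd: "bdd_below ((\<lambda>w. energy w w) ` Adm)" using e0 by (auto intro: bdd_belowI[of _ 0])
  have min: "m * (norm (T w'))\<^sup>2 \<le> energy w' w'"
    if orth: "\<forall>i\<le>N. inner (T w') (v i) = 0" for w'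
  proof (cases "T w' = 0")
    case True then show ?thesis using e0 by simp
  next
    case False
    have "m \<le> energy ((1 / norm (T w')) *\<^sub>R w') ((1 / norm (T w')) *\<^sub>R w')"
      unfolding m_def by (rule cINF_lower[OF bdd scale[OF False orth]])
    also have "\<dots> = energy w' w' / (norm (T w'))\<^sup>2"
      by (simp add: energy_linear energy_linear_right power2_eq_square)
    finally show ?thesis using False by (simp add: field_simps)
  qed
  have "\<exists>w\<in>Adm. energy w w < m + 1 / real (Suc n)" for n
  proof (rule ccontr)
    assume "\<not> ?thesis"
    then have "m + 1 / real (Suc n) \<le> m" unfolding m_def using ne
      by (intro cINF_greatest) (auto simp: not_less m_def)
    then show False by simp
  qed
  then obtain y where y: "\<And>n. y n \<in> Adm" "\<And>n. energy (y n) (y n) < m + 1 / real (Suc n)"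
    by metis
  have y_bd: "(norm (y n))\<^sup>2 \<le> m + 1" for n
  proof -
    have "1 / real (Suc n) \<le> 1" by simp
    then show ?thesis using norm_sq_le_energy[of "y n"] y(2)[of n] by linarith
  qed
  then have y_bd': "norm (y n) \<le> sqrt (m + 1)" for n by (rule real_le_rsqrt)
  obtain r :: "nat \<Rightarrow> nat" where r: "strict_mono r"
    and conv: "\<And>k. k \<in> UNIV \<Longrightarrow> \<exists>l. (\<lambda>n. coord (y (r n)) k) \<longlonglongrightarrow> l"
  proof (rule function_convergent_subsequence[of "UNIV :: nat set" "\<lambda>n k. coord (y n) k" "sqrt (m + 1)"])
    show "norm (coord (y n) k) \<le> sqrt (m + 1)" for n k
      using coord_le_norm[of "y n" k] y_bd'[of n] by simp
  qed auto
  then obtain l where l: "\<And>k. (\<lambda>n. coord (y (r n)) k) \<longlonglongrightarrow> l k" by (metis UNIV_I)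
  have l_bd: "(\<Sum>k<n. (l k)\<^sup>2) \<le> m + 1" for n
  proof (rule LIMSEQ_le_const2)
    show "(\<lambda>i. \<Sum>k<n. (coord (y (r i)) k)\<^sup>2) \<longlonglongrightarrow> (\<Sum>k<n. (l k)\<^sup>2)"
      by (intro tendsto_intros l)
    show "\<exists>N. \<forall>i\<ge>N. (\<Sum>k<n. (coord (y (r i)) k)\<^sup>2) \<le> m + 1"
      using sum_coord_sq_le[of "{..<n}"] y_bd order_trans by blast
  qed
  define w where "w = Ell2 l"
  have cw: "coord w = l" using ell2_of_bounded_sums(1)[OF l_bd] by (simp add: w_def)
  have "(\<lambda>i. T (y (r i) - w)) \<longlonglongrightarrow> 0"
  proof (rule T_compact)
    show "norm (y (r i) - w) \<le> sqrt (m + 1) + norm w" for i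
      using norm_triangle_ineq4[of "y (r i)" w] y_bd'[of "r i"] by linarith
    show "(\<lambda>i. coord (y (r i) - w) k) \<longlonglongrightarrow> 0" for k
      using tendsto_diff[OF l[of k] tendsto_const[of "l k"]] by (simp add: cw)
  qed
  then have Ty: "(\<lambda>i. T (y (r i))) \<longlonglongrightarrow> T w"
    unfolding T_linear using Lim_null by blast
  have w1: "norm (T w) = 1"
  proof (rule LIMSEQ_unique[OF tendsto_norm[OF Ty]])
    show "(\<lambda>i. norm (T (y (r i)))) \<longlonglongrightarrow> 1" using y(1) by (simp add: Adm_def)
  qed
  have w2: "inner (T w) (v i) = 0" if "i \<le> N" for i
  proof (rule LIMSEQ_unique[OF tendsto_inner[OF Ty tendsto_const]])
    show "(\<lambda>n. inner (T (y (r n))) (v i)) \<longlonglongrightarrow> 0" using y(1) that by (simp add: Adm_def)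
  qed
  have "energy w w \<le> m"
  proof -
    let ?b = "\<lambda>w. inner (B (T w)) (T w)"
    have lb: "(\<lambda>i. ?b (y (r i))) \<longlonglongrightarrow> ?b w"
      by (intro tendsto_intros bounded_linear.tendsto[OF bounded_linear_B] Ty)
    have "(\<Sum>k<n. (coord w k)\<^sup>2) \<le> m - ?b w" for n
    proof (rule LIMSEQ_le)
      show "(\<lambda>i. \<Sum>k<n. (coord (y (r i)) k)\<^sup>2) \<longlonglongrightarrow> (\<Sum>k<n. (coord w k)\<^sup>2)"
        unfolding cw by (intro tendsto_intros l)
      have "(\<lambda>i. 1 / real (Suc (r i))) \<longlonglongrightarrow> 0"
        using LIMSEQ_subseq_LIMSEQ[OF LIMSEQ_Suc[OF lim_1_over_n] r] by (simp add: o_def)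
      then show "(\<lambda>i. m + 1 / real (Suc (r i)) - ?b (y (r i))) \<longlonglongrightarrow> m - ?b w"
        using tendsto_diff[OF tendsto_add[OF tendsto_const] lb, of _ 0 m] by simp
      show "\<exists>N. \<forall>i\<ge>N. (\<Sum>k<n. (coord (y (r i)) k)\<^sup>2) \<le> m + 1 / real (Suc (r i)) - ?b (y (r i))"
      proof (intro exI allI impI)
        fix i
        have "(\<Sum>k<n. (coord (y (r i)) k)\<^sup>2) \<le> (norm (y (r i)))\<^sup>2" by (rule sum_coord_sq_le) simp
        also have "\<dots> = energy (y (r i)) (y (r i)) - ?b (y (r i))"
          by (simp add: energy_def power2_norm_eq_inner)
        finally show "(\<Sum>k<n. (coord (y (r i)) k)\<^sup>2) \<le> m + 1 / real (Suc (r i)) - ?b (y (r i))"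
          using y(2)[of "r i"] by linarith
      qed
    qed
    then have "(norm w)\<^sup>2 \<le> m - ?b w"
      using norm_ell2_sums[of w] unfolding sums_def by (intro LIMSEQ_le_const2) auto
    then show ?thesis by (simp add: energy_def power2_norm_eq_inner)
  qed
  moreover have "m \<le> energy w w" using min[of w] w1 w2 by simp
  ultimately have "energy w w = m" by simp
  then show ?thesis using w1 w2 min by blast
qed

definition eigen_upto :: "nat \<Rightarrow> (nat \<Rightarrow> real) \<Rightarrow> (nat \<Rightarrow> ell2) \<Rightarrow> bool" where
  "eigen_upto N \<mu> v \<longleftrightarrow> orthonormal_upto N v \<and> (\<forall>i\<le>N. eigen (\<mu> i) (v i))"

definition spectral_gap :: "nat \<Rightarrow> (nat \<Rightarrow> ell2) \<Rightarrow> real \<Rightarrow> bool" where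
  "spectral_gap N v X \<longleftrightarrow>
     (\<forall>m u. eigen m u \<longrightarrow> u \<noteq> 0 \<longrightarrow> (\<forall>i\<le>N. inner u (v i) = 0) \<longrightarrow> X \<le> m)"

text \<open>
  The minimiser of the energy on the complement satisfies the Euler--Lagrange equation for
  variations in the complement, and also for variations along the \<open>v i\<close>, where both sides
  vanish. So it is an eigenvector, and the minimum is an eigenvalue.
\<close>

lemma energy_lower_bound:
  assumes ev: "eigen_upto N \<mu> v" and gap: "spectral_gap N v X"
    and orth: "\<And>i. i \<le> N \<Longrightarrow> inner (T w) (v i) = 0"
  shows "X * (norm (T w))\<^sup>2 \<le> energy w w"
proof (cases "T w = 0")
  case True
  then show ?thesis using order_trans[OF zero_le_power2 norm_sq_le_energy[of w]] by simp
next
  case False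
  obtain y where y: "norm (T y) = 1" "\<And>i. i \<le> N \<Longrightarrow> inner (T y) (v i) = 0"
    and min: "\<And>w'. \<forall>i\<le>N. inner (T w') (v i) = 0 \<Longrightarrow> energy y y * (norm (T w'))\<^sup>2 \<le> energy w' w'"
    using energy_minimizer[OF False] orth by blast
  define m where "m = energy y y"
  have y3: "energy y y = m" by (simp add: m_def)
  note min = min[folded m_def]
  have crit: "energy y w' = m * inner (T y) (T w')"
    if o: "\<And>i. i \<le> N \<Longrightarrow> inner (T w') (v i) = 0" for w'
  proof -
    have "energy y w' - m * inner (T y) (T w') = 0"
    proof (rule linear_form_zero[where b = "energy w' w' - m * (norm (T w'))\<^sup>2"])
      fix s
      have "m * (norm (T (y + s *\<^sub>R w')))\<^sup>2 \<le> energy (y + s *\<^sub>R w') (y + s *\<^sub>R w')"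
        by (rule min) (simp add: T_linear inner_add_left o y(2))
      moreover have "(norm (T (y + s *\<^sub>R w')))\<^sup>2 = 1 + 2 * s * inner (T y) (T w') + s\<^sup>2 * (norm (T w'))\<^sup>2"
        using y(1) unfolding power2_norm_eq_inner norm_eq_1 T_linear
        by (simp add: inner_add_left inner_add_right
            inner_commute[of "T w'" "T y"] power2_eq_square algebra_simps)
      moreover have "energy (y + s *\<^sub>R w') (y + s *\<^sub>R w') = m + 2 * s * energy y w' + s\<^sup>2 * energy w' w'"
        using y3 by (simp add: energy_linear energy_linear_right energy_commute[of w' y]
            power2_eq_square algebra_simps)
      ultimately show "0 \<le> 2 * s * (energy y w' - m * inner (T y) (T w'))
            + s\<^sup>2 * (energy w' w' - m * (norm (T w'))\<^sup>2)"
        by (simp add: algebra_simps)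
    qed
    then show ?thesis by simp
  qed
  have crit_all: "energy y w' = m * inner (T y) (T w')" for w'
  proof -
    \<comment> \<open>the component of the variation in the complement, lifted through \<open>T\<close>\<close>
    define z where "z = w' - (\<Sum>i\<le>N. inner (T w') (v i) *\<^sub>R form_preimage (\<mu> i) (v i))"
    have Tp: "T (form_preimage (\<mu> i) (v i)) = v i" if "i \<le> N" for i
      using ev that unfolding eigen_upto_def by (simp add: T_form_preimage)
    have Tz: "T z = proj_compl N v (T w')"
      unfolding z_def proj_compl_def by (simp add: T_linear Tp)
    have "energy y z = m * inner (T y) (T z)"
      using ev unfolding eigen_upto_def by (intro crit) (simp add: Tz inner_proj_compl)
    moreover have "energy y (form_preimage (\<mu> i) (v i)) = 0" if "i \<le> N" for i
      using ev that y(2) unfolding eigen_upto_def by (simp add: energy_form_preimage)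
    then have "energy y z = energy y w'"
      unfolding z_def by (simp add: energy_linear_right)
    moreover have "inner (T y) (T z) = inner (T y) (T w')"
      unfolding Tz proj_compl_def by (simp add: inner_diff_right inner_sum_right y(2))
    ultimately show ?thesis by simp
  qed
  have "eigen m (T y)" by (rule weak_eigen_imp_eigen) (rule crit_all)
  then have "X \<le> m" using gap y(1,2) unfolding spectral_gap_def by (metis norm_zero zero_neq_one)
  then have "X * (norm (T w))\<^sup>2 \<le> m * (norm (T w))\<^sup>2" by (intro mult_right_mono) auto
  also have "\<dots> \<le> energy w w" using min orth by blast
  finally show ?thesis .
qed

text \<open>
  Since the \<open>v i\<close> are eigenvectors, projecting them away also splits the energy orthogonally,
  and the parts removed have nonnegative energy.
\<close>

lemma proj_compl_energy:
  assumes ev: "eigen_upto N \<mu> v" and gap: "spectral_gap N v X"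
  obtains y where "T y = proj_compl N v (T w)" "X * (norm (T y))\<^sup>2 \<le> energy w y"
    "energy w y \<le> energy w w"
proof -
  define p where "p i = form_preimage (\<mu> i) (v i)" for i
  define y where "y = w - (\<Sum>i\<le>N. inner (T w) (v i) *\<^sub>R p i)"
  have orth: "orthonormal_upto N v" and eig: "\<And>i. i \<le> N \<Longrightarrow> eigen (\<mu> i) (v i)"
    using ev by (auto simp: eigen_upto_def)
  have Tp: "T (p i) = v i" if "i \<le> N" for i using eig that by (simp add: T_form_preimage p_def)
  have Ty: "T y = proj_compl N v (T w)"
    unfolding y_def proj_compl_def by (simp add: T_linear Tp)
  have oy: "inner (T y) (v i) = 0" if "i \<le> N" for i
    unfolding Ty using orth that by (rule inner_proj_compl)
  have en: "energy z (p i) = \<mu> i * inner (T z) (v i)" if "i \<le> N" for i z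
    unfolding p_def using eig[OF that] by (rule energy_form_preimage)
  have "energy y y = energy w y"
    by (subst (1) y_def) (simp add: energy_linear energy_commute[of "p _"] en oy)
  moreover have "energy w y = energy w w - (\<Sum>i\<le>N. \<mu> i * (inner (T w) (v i))\<^sup>2)"
    by (simp add: y_def energy_linear_right en power2_eq_square mult_ac)
  moreover have "0 \<le> \<mu> i * (inner (T w) (v i))\<^sup>2" if "i \<le> N" for i
  proof -
    have "energy (p i) (p i) = \<mu> i"
      using that orth by (simp add: en Tp orthonormal_upto_def)
    then have "0 \<le> \<mu> i" using norm_sq_le_energy[of "p i"] zero_le_power2[of "norm (p i)"] by linarith
    then show ?thesis by simp
  qed
  then have "0 \<le> (\<Sum>i\<le>N. \<mu> i * (inner (T w) (v i))\<^sup>2)" by (intro sum_nonneg) auto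
  moreover have "X * (norm (T y))\<^sup>2 \<le> energy y y" using energy_lower_bound[OF ev gap oy] .
  ultimately show ?thesis using that[OF Ty] by simp
qed

lemma energy_T: "energy (T z) y = inner (z + B (T (T z))) (T y)"
  by (simp add: energy_def inner_add_left T_symmetric)

lemma inner_proj_compl_eq:
  assumes "\<And>i. i \<le> N \<Longrightarrow> inner u (v i) = 0"
  shows "inner x u = inner (proj_compl N v x) u"
proof -
  have "inner (v i) u = 0" if "i \<le> N" for i using assms[OF that] by (simp add: inner_commute)
  then show ?thesis by (simp add: proj_compl_def inner_diff_left inner_sum_left)
qed

text \<open>
  One application of the gap gains two powers of \<open>T\<close>: for \<open>u = T (T z)\<close> the energy of the
  projection of \<open>u\<close> is its inner product with the projection of \<open>A u = z + B u\<close>, so \<open>X\<close> times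
  its norm is at most the norm of the projection of \<open>A u\<close>. The assumption, that \<open>B\<close> can be
  pulled through powers of \<open>T\<close>, makes \<open>A u\<close> again a vector in the range of a power of \<open>T\<close>.
\<close>

lemma proj_compl_rate:
  assumes B_conjugate: "\<And>m. \<exists>Bm \<beta>. \<forall>z. B ((T ^^ m) z) = (T ^^ m) (Bm z) \<and> norm (Bm z) \<le> \<beta> * norm z"
  shows "\<exists>K\<ge>0. \<forall>N \<mu> v X w. eigen_upto N \<mu> v \<longrightarrow> spectral_gap N v X \<longrightarrow> 0 < X \<longrightarrow>
     norm (proj_compl N v ((T ^^ m) w)) \<le> K * X powr (- real m / 2) * norm w"
proof (induction m rule: induct_nat_012)
  case 0
  show ?case
    by (rule exI[of _ 1]) (auto simp: eigen_upto_def norm_proj_compl_le)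
next
  case 1
  obtain b where b: "\<And>u. norm (B u) \<le> norm u * b" "b > 0"
    using bounded_linear.pos_bounded[OF bounded_linear_B] by blast
  show ?case
  proof (rule exI[of _ "sqrt (1 + b)"], intro conjI allI impI)
    show "0 \<le> sqrt (1 + b)" using b(2) by simp
    fix N \<mu> v X w
    assume ev: "eigen_upto N \<mu> v" and gap: "spectral_gap N v X" and X: "0 < X"
    obtain y where y: "T y = proj_compl N v (T w)" "X * (norm (T y))\<^sup>2 \<le> energy w y"
      "energy w y \<le> energy w w" using proj_compl_energy[OF ev gap] by blast
    have "inner (B (T w)) (T w) \<le> norm (B (T w)) * norm (T w)" by (rule norm_cauchy_schwarz)
    also have "\<dots> \<le> (norm (T w) * b) * norm (T w)" by (intro mult_right_mono b) auto
    also have "\<dots> \<le> (norm w * b) * norm w"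
      using norm_T_le[of w] b(2) by (intro mult_mono) auto
    finally have "energy w w \<le> (1 + b) * (norm w)\<^sup>2"
      by (simp add: energy_def power2_norm_eq_inner[symmetric] power2_eq_square algebra_simps)
    then have "X * (norm (proj_compl N v (T w)))\<^sup>2 \<le> (1 + b) * (norm w)\<^sup>2"
      using y by simp
    then have "(norm (proj_compl N v (T w)))\<^sup>2 \<le> (1 + b) * (norm w)\<^sup>2 / X"
      using X by (simp add: field_simps)
    then have "norm (proj_compl N v (T w)) \<le> sqrt ((1 + b) * (norm w)\<^sup>2 / X)"
      by (rule real_le_rsqrt)
    also have "\<dots> = sqrt (1 + b) * X powr (- real (Suc 0) / 2) * norm w"
    proof -
      have "X powr (- real (Suc 0) / 2) = 1 / sqrt X"
        using X by (simp add: powr_minus powr_half_sqrt field_simps)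
      then show ?thesis by (simp add: real_sqrt_divide real_sqrt_mult)
    qed
    finally show "norm (proj_compl N v ((T ^^ Suc 0) w))
        \<le> sqrt (1 + b) * X powr (- real (Suc 0) / 2) * norm w" by simp
  qed
next
  case (ge2 m)
  then obtain K where K: "0 \<le> K"
    and IH: "\<And>N \<mu> v X w. eigen_upto N \<mu> v \<Longrightarrow> spectral_gap N v X \<Longrightarrow> 0 < X \<Longrightarrow>
       norm (proj_compl N v ((T ^^ m) w)) \<le> K * X powr (- real m / 2) * norm w" by blast
  obtain Bm \<beta>0 where Bm0: "\<And>z. B ((T ^^ m) z) = (T ^^ m) (Bm z)" "\<And>z. norm (Bm z) \<le> \<beta>0 * norm z"
    using B_conjugate[of m] by blast
  define \<beta> where "\<beta> = max \<beta>0 0"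
  have Bm: "\<And>z. B ((T ^^ m) z) = (T ^^ m) (Bm z)" "\<And>z. norm (Bm z) \<le> \<beta> * norm z" "0 \<le> \<beta>"
    using Bm0 by (auto simp: \<beta>_def intro: order_trans[OF _ mult_right_mono[of \<beta>0]])
  note lin = linear_T_power[of m]
  show ?case
  proof (rule exI[of _ "K * (1 + \<beta>)"], intro conjI allI impI)
    show "0 \<le> K * (1 + \<beta>)" using K Bm(3) by simp
    fix N \<mu> v X w
    assume ev: "eigen_upto N \<mu> v" and gap: "spectral_gap N v X" and X: "0 < X"
    have orth: "orthonormal_upto N v" using ev by (simp add: eigen_upto_def)
    define z where "z = (T ^^ m) w"
    obtain y where y: "T y = proj_compl N v (T (T z))" "X * (norm (T y))\<^sup>2 \<le> energy (T z) y"
      using proj_compl_energy[OF ev gap] by blast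
    define x where "x = w + Bm (T (T w))"
    have Tc: "T (T z) = (T ^^ m) (T (T w))" by (simp add: z_def funpow_swap1)
    have Az: "z + B (T (T z)) = (T ^^ m) x"
    proof -
      have "B (T (T z)) = (T ^^ m) (Bm (T (T w)))" by (simp only: Tc Bm(1))
      then show ?thesis by (simp add: x_def z_def linear_add[OF lin])
    qed
    have "norm (Bm (T (T w))) \<le> \<beta> * norm (T (T w))" by (rule Bm(2))
    also have "\<dots> \<le> \<beta> * norm w"
      using Bm(3) norm_T_le[of "T w"] norm_T_le[of w] by (intro mult_left_mono) auto
    finally have nx: "norm x \<le> (1 + \<beta>) * norm w"
      unfolding x_def using norm_triangle_ineq[of w "Bm (T (T w))"] by (simp add: algebra_simps)
    have "energy (T z) y = inner (proj_compl N v ((T ^^ m) x)) (T y)"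
      unfolding energy_T Az
      by (rule inner_proj_compl_eq) (simp add: y(1) inner_proj_compl[OF orth])
    also have "\<dots> \<le> norm (proj_compl N v ((T ^^ m) x)) * norm (T y)" by (rule norm_cauchy_schwarz)
    finally have "X * norm (T y) * norm (T y) \<le> norm (proj_compl N v ((T ^^ m) x)) * norm (T y)"
      using y(2) by (simp add: power2_eq_square mult_ac)
    then have "X * norm (T y) \<le> norm (proj_compl N v ((T ^^ m) x))"
      by (cases "norm (T y) = 0") (auto simp: mult_le_cancel_right)
    also have "\<dots> \<le> K * X powr (- real m / 2) * norm x" by (rule IH[OF ev gap X])
    also have "\<dots> \<le> K * X powr (- real m / 2) * ((1 + \<beta>) * norm w)"
      using K by (intro mult_left_mono nx) auto
    finally have "norm (T y) \<le> K * X powr (- real m / 2) * ((1 + \<beta>) * norm w) / X"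
      using X by (simp add: field_simps)
    also have "\<dots> = K * (1 + \<beta>) * (X powr (- real m / 2) / X) * norm w" by simp
    also have "X powr (- real m / 2) / X = X powr (- real (Suc (Suc m)) / 2)"
    proof -
      have "X powr (- real m / 2) / X = X powr (- real m / 2) * X powr (-1)"
        using X by (simp add: powr_minus field_simps)
      also have "\<dots> = X powr (- real m / 2 + -1)" by (rule powr_add[symmetric])
      also have "- real m / 2 + -1 = - real (Suc (Suc m)) / 2" by (simp add: field_simps)
      finally show ?thesis .
    qed
    finally show "norm (proj_compl N v ((T ^^ Suc (Suc m)) w))
        \<le> K * (1 + \<beta>) * X powr (- real (Suc (Suc m)) / 2) * norm w"
      unfolding y(1) by (simp add: z_def)
  qed
qed

text \<open>
  Bootstrapping \<open>v = T (T (\<mu> v - B v))\<close>: a vector in the range of \<open>T ^^ m\<close> that satisfies this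
  equation is in the range of \<open>T ^^ (m + 2)\<close>.
\<close>

lemma eigen_smooth:
  assumes B_conjugate: "\<And>m. \<exists>Bm \<beta>. \<forall>z. B ((T ^^ m) z) = (T ^^ m) (Bm z) \<and> norm (Bm z) \<le> \<beta> * norm z"
    and ev: "eigen \<mu> v"
  shows "\<exists>w. v = (T ^^ m) w"
proof (induction m rule: induct_nat_012)
  case 0 show ?case by simp
next
  case 1 show ?case using T_form_preimage[OF ev, symmetric] by auto
next
  case (ge2 m)
  then obtain w where w: "v = (T ^^ m) w" by blast
  obtain Bm where Bm: "\<And>z. B ((T ^^ m) z) = (T ^^ m) (Bm z)" using B_conjugate[of m] by blast
  note lin = linear_T_power[of m]
  have "v = T (T (\<mu> *\<^sub>R v - B v))" by (rule eigen_eq_T[OF ev])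
  also have "\<mu> *\<^sub>R v - B v = (T ^^ m) (\<mu> *\<^sub>R w - Bm w)"
    unfolding w Bm by (simp add: linear_diff[OF lin] linear_cmul[OF lin])
  finally show ?case by (intro exI[of _ "\<mu> *\<^sub>R w - Bm w"]) simp
qed

text \<open>
  A trace inequality in place of the min-max principle. The energies of the \<open>v i\<close> add up to at
  least \<open>lam J\<close> times the total mass that these vectors have in coordinates \<open>\<ge> J\<close>; by
  Bessel's inequality for the unit sequences, at most \<open>J\<close> of the total mass \<open>N + 1\<close> is in the
  first \<open>J\<close> coordinates.
\<close>

lemma eigenvalue_growth:
  assumes ev: "eigen_upto N \<mu> v" and mono: "\<And>i. i \<le> N \<Longrightarrow> \<mu> i \<le> \<mu> N"
    and lam: "\<And>i j. i \<le> j \<Longrightarrow> lam i \<le> lam j" and J: "J \<le> N"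
  shows "lam J * real (N + 1 - J) \<le> real (N + 1) * \<mu> N"
proof -
  have orth: "orthonormal_upto N v" and eig: "\<And>i. i \<le> N \<Longrightarrow> eigen (\<mu> i) (v i)"
    using ev by (auto simp: eigen_upto_def)
  have n1: "norm (v i) = 1" if "i \<le> N" for i
    using orth that unfolding orthonormal_upto_def by (simp add: norm_eq_1)
  have low: "lam J * (1 - (\<Sum>j<J. (coord (v i) j)\<^sup>2)) \<le> \<mu> i" if i: "i \<le> N" for i
  proof -
    define p where "p = form_preimage (\<mu> i) (v i)"
    have Tp: "T p = v i" using eig[OF i] by (simp add: T_form_preimage p_def)
    have su: "(\<lambda>k. lam J * ((coord (v i) k)\<^sup>2 - (if k \<in> {..<J} then (coord (v i) k)\<^sup>2 else 0)))
       sums (lam J * ((norm (v i))\<^sup>2 - (\<Sum>j<J. (coord (v i) j)\<^sup>2)))"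
      by (intro sums_mult sums_diff norm_ell2_sums sums_If_finite_set) simp
    have le: "lam J * ((coord (v i) k)\<^sup>2 - (if k \<in> {..<J} then (coord (v i) k)\<^sup>2 else 0)) \<le> (coord p k)\<^sup>2" for k
    proof -
      have "(coord p k)\<^sup>2 = lam k * (coord (v i) k)\<^sup>2"
        unfolding Tp[symmetric] using lam_pos[of k] by (simp add: power_divide)
      then show ?thesis using lam[of J k] by (auto simp: mult_right_mono)
    qed
    have "lam J * ((norm (v i))\<^sup>2 - (\<Sum>j<J. (coord (v i) j)\<^sup>2)) \<le> (norm p)\<^sup>2"
      by (rule sums_le[OF le su norm_ell2_sums])
    also have "\<dots> \<le> energy p p" by (rule norm_sq_le_energy)
    also have "energy p p = \<mu> i"
      unfolding p_def energy_form_preimage[OF eig[OF i]] T_form_preimage[OF eig[OF i]] using n1[OF i] by (simp add: norm_eq_1)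
    finally show ?thesis using n1[OF i] by simp
  qed
  have "(\<Sum>i\<le>N. \<Sum>j<J. (coord (v i) j)\<^sup>2) = (\<Sum>j<J. \<Sum>i\<le>N. (inner (unit_seq j) (v i))\<^sup>2)"
    by (subst sum.swap) (simp add: inner_commute[of "unit_seq _"])
  also have "\<dots> \<le> (\<Sum>j<J. (norm (unit_seq j))\<^sup>2)" by (intro sum_mono Bessel_upto orth)
  also have "\<dots> = real J" by (simp add: power2_norm_eq_inner)
  finally have b: "(\<Sum>i\<le>N. \<Sum>j<J. (coord (v i) j)\<^sup>2) \<le> real J" .
  have "lam J * real (N + 1 - J) = lam J * (real (N + 1) - real J)" using J by (simp add: of_nat_diff)
  also have "\<dots> \<le> lam J * (real (N + 1) - (\<Sum>i\<le>N. \<Sum>j<J. (coord (v i) j)\<^sup>2))"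
    using b by (intro mult_left_mono) auto
  also have "\<dots> = (\<Sum>i\<le>N. lam J * (1 - (\<Sum>j<J. (coord (v i) j)\<^sup>2)))"
    by (simp add: sum_distrib_left[symmetric] sum_subtractf)
  also have "\<dots> \<le> (\<Sum>i\<le>N. \<mu> N)" using order_trans[OF low mono] by (intro sum_mono) simp
  finally show ?thesis by simp
qed

end

section \<open>The weighted measure and integration by parts\<close>

lemma jacobi_weight_nonneg [simp]: "0 \<le> jacobi_weight \<beta> x"
  by (simp add: jacobi_weight_def)

lemma jacobi_weight_pos: "x \<in> {-1<..<1} \<Longrightarrow> 0 < jacobi_weight \<beta> x"
proof -
  assume "x \<in> {-1<..<1}"
  then have "x\<^sup>2 < 1" by (simp add: abs_square_less_1 abs_less_iff)
  then show ?thesis by (simp add: jacobi_weight_def)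
qed

lemma jacobi_weight_le_1:
  assumes "0 \<le> \<beta>" "x \<in> {-1..1}"
  shows "jacobi_weight \<beta> x \<le> 1"
proof -
  have "x\<^sup>2 \<le> 1" using assms(2) by (simp add: abs_square_le_1 abs_le_iff)
  then show ?thesis unfolding jacobi_weight_def using assms(1) by (intro powr_le1) auto
qed

lemma jacobi_weight_Suc:
  assumes "x \<in> {-1..1}"
  shows "jacobi_weight (\<beta> + 1) x = (1 - x\<^sup>2) * jacobi_weight \<beta> x"
proof -
  have "x\<^sup>2 \<le> 1" using assms by (simp add: abs_square_le_1 abs_le_iff)
  then have "0 \<le> 1 - x\<^sup>2" by simp
  then show ?thesis by (cases "1 - x\<^sup>2 = 0") (simp_all add: jacobi_weight_def powr_add)
qed

lemma jacobi_weight_measurable [measurable]: "jacobi_weight \<beta> \<in> borel_measurable borel"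
  unfolding jacobi_weight_def by measurable

lemma jacobi_weight_measurable_leb: "jacobi_weight \<beta> \<in> borel_measurable (lebesgue_on {-1..1})"
  by (intro measurable_restrict_space1 measurable_completion) (simp add: jacobi_weight_measurable)

lemma sets_weighted_measure [measurable_cong]:
  "sets (weighted_measure \<beta>) = sets (lebesgue_on {-1..1})"
  by (simp add: weighted_measure_def)

lemma space_weighted_measure [simp]: "space (weighted_measure \<beta>) = {-1..1}"
  by (simp add: weighted_measure_def)

lemma measurable_weighted_iff:
  "f \<in> borel_measurable (weighted_measure \<beta>) \<longleftrightarrow> f \<in> borel_measurable (lebesgue_on {-1..1})"
  using measurable_cong_sets[OF sets_weighted_measure refl] by blast

lemma integral_weighted:
  fixes f :: "real \<Rightarrow> 'b::{banach, second_countable_topology}"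
  assumes "f \<in> borel_measurable (lebesgue_on {-1..1})"
  shows "integral\<^sup>L (weighted_measure \<beta>) f = (\<integral>x. jacobi_weight \<beta> x *\<^sub>R f x \<partial>lebesgue_on {-1..1})"
    and "integrable (weighted_measure \<beta>) f \<longleftrightarrow> integrable (lebesgue_on {-1..1}) (\<lambda>x. jacobi_weight \<beta> x *\<^sub>R f x)"
  unfolding weighted_measure_def
  using integral_density[OF assms jacobi_weight_measurable_leb]
    integrable_density[OF assms jacobi_weight_measurable_leb] by auto

lemma weighted_shift:
  fixes f :: "real \<Rightarrow> 'b::{banach, second_countable_topology}"
  assumes "f \<in> borel_measurable (lebesgue_on {-1..1})"
  shows "integral\<^sup>L (weighted_measure (\<beta> + 1)) f = (\<integral>x. (1 - x\<^sup>2) *\<^sub>R f x \<partial>weighted_measure \<beta>)"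
    and "integrable (weighted_measure (\<beta> + 1)) f \<longleftrightarrow> integrable (weighted_measure \<beta>) (\<lambda>x. (1 - x\<^sup>2) *\<^sub>R f x)"
proof -
  have id: "(\<lambda>x. x) \<in> borel_measurable (lebesgue_on {-1..1::real})"
    by (intro measurable_restrict_space1 measurable_completion) simp
  have m: "(\<lambda>x. (1 - x\<^sup>2) *\<^sub>R f x) \<in> borel_measurable (lebesgue_on {-1..1})"
    using assms id by (intro borel_measurable_scaleR borel_measurable_diff borel_measurable_power) auto
  have eq: "jacobi_weight (\<beta> + 1) x *\<^sub>R f x = jacobi_weight \<beta> x *\<^sub>R ((1 - x\<^sup>2) *\<^sub>R f x)"
    if "x \<in> space (lebesgue_on {-1..1})" for x
    using jacobi_weight_Suc[of x \<beta>] that by (simp add: mult.commute)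
  show "integral\<^sup>L (weighted_measure (\<beta> + 1)) f = (\<integral>x. (1 - x\<^sup>2) *\<^sub>R f x \<partial>weighted_measure \<beta>)"
    unfolding integral_weighted(1)[OF assms] integral_weighted(1)[OF m]
    by (rule Bochner_Integration.integral_cong[OF refl eq])
  show "integrable (weighted_measure (\<beta> + 1)) f \<longleftrightarrow> integrable (weighted_measure \<beta>) (\<lambda>x. (1 - x\<^sup>2) *\<^sub>R f x)"
    unfolding integral_weighted(2)[OF assms] integral_weighted(2)[OF m]
    by (rule Bochner_Integration.integrable_cong[OF refl eq])
qed

lemma finite_measure_weighted:
  assumes "0 \<le> \<beta>"
  shows "finite_measure (weighted_measure \<beta>)"
proof
  have "emeasure (weighted_measure \<beta>) (space (weighted_measure \<beta>))
      = (\<integral>\<^sup>+x. ennreal (jacobi_weight \<beta> x) * indicator {-1..1} x \<partial>lebesgue_on {-1..1})"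
    unfolding space_weighted_measure unfolding weighted_measure_def
    by (subst emeasure_density)
       (auto simp: jacobi_weight_measurable_leb intro!: measurable_compose[OF jacobi_weight_measurable_leb])
  also have "\<dots> \<le> (\<integral>\<^sup>+x. indicator {-1..1} x \<partial>lebesgue_on {-1..1::real})"
  proof (rule nn_integral_mono)
    fix x :: real assume "x \<in> space (lebesgue_on {-1..1})"
    then show "ennreal (jacobi_weight \<beta> x) * indicator {-1..1} x \<le> indicator {-1..1} x"
      using jacobi_weight_le_1[OF assms, of x] by (auto simp: indicator_def)
  qed
  also have "\<dots> = emeasure (lebesgue_on {-1..1}) {-1..1::real}"
    by (rule nn_integral_indicator) (simp add: sets_restrict_space_iff)
  also have "\<dots> < \<infinity>" by (simp add: emeasure_restrict_space)
  finally show "emeasure (weighted_measure \<beta>) (space (weighted_measure \<beta>)) \<noteq> \<infinity>" by simp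
qed

text \<open>
  The two end points form a null set, so the values there are irrelevant for measurability.
\<close>

lemma measurable_of_continuous_interior:
  fixes h :: "real \<Rightarrow> 'b::{banach, second_countable_topology}"
  assumes "continuous_on {-1<..<1} h"
  shows "h \<in> borel_measurable (lebesgue_on {-1..1})"
proof -
  define h' where "h' = (\<lambda>x. if x \<in> {1} then h 1 else if x \<in> {-1} then h (-1) else (if x \<in> {-1<..<1} then h x else 0))"
  have "(\<lambda>x. if x \<in> {-1<..<1} then h x else 0) \<in> borel_measurable borel"
    by (rule borel_measurable_continuous_on_if[of "{-1<..<1}" h "\<lambda>_. 0"]) (use assms in auto)
  then have "(\<lambda>x. if x \<in> {1} then h 1 else if x \<in> {-1} then h (-1) else (if x \<in> {-1<..<1} then h x else 0)) \<in> borel_measurable borel"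
    by (intro measurable_If_set[where A = "{1}"] measurable_If_set[where A = "{-1}"]) auto
  then have "h' \<in> borel_measurable borel" unfolding h'_def .
  then have "h' \<in> borel_measurable (lebesgue_on {-1..1})"
    by (intro measurable_restrict_space1 measurable_completion) simp
  then show ?thesis
    by (rule measurable_cong[THEN iffD1, rotated]) (auto simp: h'_def)
qed

lemma bounded_integrable_weighted:
  fixes h :: "real \<Rightarrow> 'b::{banach, second_countable_topology}"
  assumes "0 \<le> \<beta>" "h \<in> borel_measurable (lebesgue_on {-1..1})" "\<And>x. x \<in> {-1..1} \<Longrightarrow> norm (h x) \<le> C"
  shows "integrable (weighted_measure \<beta>) h"
proof -
  interpret finite_measure "weighted_measure \<beta>" by (rule finite_measure_weighted[OF assms(1)])
  show ?thesis
    by (rule integrable_const_bound[where B = C])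
       (use assms measurable_weighted_iff in \<open>auto intro: AE_I2\<close>)
qed

lemma bounded_interior_imp_bounded:
  fixes h :: "real \<Rightarrow> 'b::real_normed_vector"
  assumes "\<And>x. x \<in> {-1<..<1} \<Longrightarrow> norm (h x) \<le> C"
  obtains C' where "\<And>x. x \<in> {-1..1} \<Longrightarrow> norm (h x) \<le> C'"
proof
  fix x :: real assume "x \<in> {-1..1}"
  then have "x \<in> {-1<..<1} \<or> x = 1 \<or> x = -1" by auto
  then show "norm (h x) \<le> \<bar>C\<bar> + norm (h 1) + norm (h (-1))"
  proof (elim disjE)
    assume "x \<in> {-1<..<1}"
    from assms[OF this] show ?thesis using norm_ge_zero[of "h 1"] norm_ge_zero[of "h (-1)"] by linarith
  qed auto
qed

lemma continuous_on_extend_zero: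
  fixes W :: "real \<Rightarrow> real"
  assumes "\<And>x. x \<in> {-1<..<1} \<Longrightarrow> isCont W x"
    and "(W \<longlongrightarrow> 0) (at_left 1)" "(W \<longlongrightarrow> 0) (at_right (-1))"
  shows "continuous_on {-1..1} (\<lambda>x. if x \<in> {-1<..<1} then W x else 0)"
proof -
  let ?V = "\<lambda>x. if x \<in> {-1<..<1} then W x else 0"
  have inner: "(?V \<longlongrightarrow> ?V x) (at x within {-1..1})" if x: "x \<in> {-1<..<1}" for x
  proof -
    have "eventually (\<lambda>y. y \<in> {-1<..<1}) (nhds x)"
      by (rule eventually_nhds_in_open) (use x in auto)
    then have ev: "eventually (\<lambda>y. W y = ?V y) (at x)"
      unfolding eventually_at_filter by (rule eventually_mono) simp
    have "(W \<longlongrightarrow> W x) (at x)" using assms(1)[OF x] by (simp add: isCont_def)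
    from Lim_transform_eventually[OF this ev] have "(?V \<longlongrightarrow> W x) (at x)" .
    then have "(?V \<longlongrightarrow> W x) (at x within {-1..1})" by (rule tendsto_within_subset) simp
    then show ?thesis using x by simp
  qed
  have "eventually (\<lambda>y. W y = ?V y) (at_left 1)"
    by (rule eventually_mono[OF eventually_at_left_real[of "-1" 1]]) simp_all
  from Lim_transform_eventually[OF assms(2) this] have right: "(?V \<longlongrightarrow> 0) (at_left 1)" .
  have "eventually (\<lambda>y. W y = ?V y) (at_right (-1))"
    by (rule eventually_mono[OF eventually_at_right_real[of "-1" 1]]) simp_all
  from Lim_transform_eventually[OF assms(3) this] have left: "(?V \<longlongrightarrow> 0) (at_right (-1))" .
  have "(?V \<longlongrightarrow> ?V x) (at x within {-1..1})" if x: "x \<in> {-1..1}" for x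
  proof (cases "x \<in> {-1<..<1}")
    case True
    then show ?thesis by (rule inner)
  next
    case False
    then have "x = 1 \<or> x = -1" using x by (simp add: not_less) linarith
    then show ?thesis
    proof
      assume "x = 1"
      then show ?thesis using right by (simp add: at_within_Icc_at_left)
    next
      assume "x = -1"
      then show ?thesis using left by (simp add: at_within_Icc_at_right)
    qed
  qed
  then show ?thesis by (simp add: continuous_on_def)
qed

text \<open>
  The divergence theorem for the weight: a function whose product with the weight is the
  derivative of a flux vanishing at both end points has integral zero.
\<close>

lemma integral_of_flux_derivative:
  fixes W h :: "real \<Rightarrow> real"
  assumes \<beta>: "0 \<le> \<beta>"
    and deriv: "\<And>x. x \<in> {-1<..<1} \<Longrightarrow> (W has_real_derivative jacobi_weight \<beta> x * h x) (at x)"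
    and lim: "(W \<longlongrightarrow> 0) (at_left 1)" "(W \<longlongrightarrow> 0) (at_right (-1))"
    and cont: "continuous_on {-1<..<1} h" and bd: "\<And>x. x \<in> {-1<..<1} \<Longrightarrow> \<bar>h x\<bar> \<le> C"
  shows "(\<integral>x. h x \<partial>weighted_measure \<beta>) = 0"
proof -
  let ?V = "\<lambda>x. if x \<in> {-1<..<1} then W x else 0"
  have hm: "h \<in> borel_measurable (lebesgue_on {-1..1})"
    by (rule measurable_of_continuous_interior[OF cont])
  obtain C' where "\<And>x. x \<in> {-1..1} \<Longrightarrow> norm (h x) \<le> C'"
    using bounded_interior_imp_bounded[of h C] bd by auto
  then have "integrable (weighted_measure \<beta>) h" by (rule bounded_integrable_weighted[OF \<beta> hm])
  then have int: "integrable (lebesgue_on {-1..1}) (\<lambda>x. jacobi_weight \<beta> x * h x)"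
    using integral_weighted(2)[OF hm] by simp
  have "((\<lambda>x. jacobi_weight \<beta> x * h x) has_integral (?V 1 - ?V (-1))) {-1..1}"
  proof (rule fundamental_theorem_of_calculus_interior)
    show "continuous_on {-1..1} ?V"
      using deriv lim by (intro continuous_on_extend_zero) (auto dest: DERIV_isCont)
    fix x :: real assume x: "x \<in> {-1<..<1}"
    have "(?V has_real_derivative jacobi_weight \<beta> x * h x) (at x)"
      using deriv[OF x] x
      by (subst has_field_derivative_cong_ev[OF refl _ refl refl, of _ _ W])
         (auto intro!: eventually_mono[OF eventually_nhds_in_open[of "{-1<..<1}"]])
    then show "(?V has_vector_derivative jacobi_weight \<beta> x * h x) (at x)"
      by (simp add: has_real_derivative_iff_has_vector_derivative)
  qed simp
  then have "integral {-1..1} (\<lambda>x. jacobi_weight \<beta> x * h x) = 0"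
    by (simp add: integral_unique)
  then show ?thesis
    using integral_weighted(1)[OF hm, of \<beta>] lebesgue_integral_eq_integral[OF int] by simp
qed

lemma jacobi_weight_has_derivative:
  assumes "x \<in> {-1<..<1}"
  shows "(jacobi_weight (\<beta> + 1) has_real_derivative - 2 * (\<beta> + 1) * x * jacobi_weight \<beta> x) (at x)"
proof -
  have "x\<^sup>2 < 1" using assms by (simp add: abs_square_less_1 abs_less_iff)
  then have pos: "0 < 1 - x\<^sup>2" by simp
  have "((\<lambda>x. 1 - x\<^sup>2) has_real_derivative - 2 * x) (at x)"
    by (auto intro!: derivative_eq_intros)
  from DERIV_chain2[OF has_real_derivative_powr[OF pos, of "\<beta> + 1"] this, folded jacobi_weight_def]
  show ?thesis
    by (rule DERIV_cong) (simp add: jacobi_weight_def[abs_def] algebra_simps)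
qed

lemma jacobi_weight_tendsto_0:
  assumes "0 \<le> \<beta>"
  shows "(jacobi_weight (\<beta> + 1) \<longlongrightarrow> 0) (at_left 1)" "(jacobi_weight (\<beta> + 1) \<longlongrightarrow> 0) (at_right (-1))"
proof -
  have c: "continuous_on {-1..1} (jacobi_weight (\<beta> + 1))"
    unfolding jacobi_weight_def using assms
    by (intro continuous_on_powr' continuous_intros) (auto simp: abs_square_le_1 abs_le_iff)
  have 1: "jacobi_weight (\<beta> + 1) 1 = 0" "jacobi_weight (\<beta> + 1) (-1) = 0" by (simp_all add: jacobi_weight_def)
  show "(jacobi_weight (\<beta> + 1) \<longlongrightarrow> 0) (at_left 1)"
    using continuous_on_Icc_at_leftD[OF c] 1 by simp
  show "(jacobi_weight (\<beta> + 1) \<longlongrightarrow> 0) (at_right (-1))"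
    using continuous_on_Icc_at_rightD[OF c] 1 by simp
qed

section \<open>Gegenbauer polynomials from their differential equation\<close>

text \<open>
  The Sturm--Liouville operator for \<open>c = 0\<close> and exponent \<open>\<beta>\<close>, multiplied out so that it acts on polynomials.
\<close>

definition gegen_op :: "real \<Rightarrow> real poly \<Rightarrow> real poly" where
  "gegen_op \<beta> p = [:-1, 0, 1:] * pderiv (pderiv p) + smult (2 * (\<beta> + 1)) ([:0, 1:] * pderiv p)"

definition gegen_eigenvalue :: "real \<Rightarrow> nat \<Rightarrow> real" where
  "gegen_eigenvalue \<beta> k = real k * (real k + 2 * \<beta> + 1)"

text \<open>
  Gegenbauer polynomials up to scaling, generated by the first-order raising operator. Compared
  with the three-term recurrence this needs only one predecessor, so that the differential
  equation follows by a plain induction.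
\<close>

fun gegen :: "real \<Rightarrow> nat \<Rightarrow> real poly" where
  "gegen \<beta> 0 = 1"
| "gegen \<beta> (Suc k) = smult (real k + 2 * \<beta> + 1) ([:0, 1:] * gegen \<beta> k) + [:-1, 0, 1:] * pderiv (gegen \<beta> k)"

lemma poly_gegen_op:
  "poly (gegen_op \<beta> p) x = (x\<^sup>2 - 1) * poly (pderiv (pderiv p)) x + 2 * (\<beta> + 1) * x * poly (pderiv p) x"
  by (simp add: gegen_op_def algebra_simps power2_eq_square)

text \<open>
  Let \<open>y\<close> solve the equation at level \<open>k\<close> and let \<open>z\<close> be its successor. Eliminating \<open>y''\<close> in
  \<open>z'\<close> leaves \<open>(k + 1) ((k + 2 \<beta> + 1) y + x y')\<close>, which is again of first order in \<open>y\<close>; hence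
  so are \<open>z''\<close> times \<open>x\<^sup>2 - 1\<close> and the equation for \<open>z\<close>.
\<close>

lemma gegen_op_gegen: "gegen_op \<beta> (gegen \<beta> k) = smult (gegen_eigenvalue \<beta> k) (gegen \<beta> k)"
proof (induction k)
  case 0
  show ?case by (simp add: gegen_op_def gegen_eigenvalue_def)
next
  case (Suc k)
  define y where "y = gegen \<beta> k"
  define z where "z = gegen \<beta> (Suc k)"
  have z: "z = smult (real k + 2 * \<beta> + 1) ([:0, 1:] * y) + [:-1, 0, 1:] * pderiv y"
    by (simp add: z_def y_def)
  have IH: "(x\<^sup>2 - 1) * poly (pderiv (pderiv y)) x
      = real k * (real k + 2 * \<beta> + 1) * poly y x - 2 * (\<beta> + 1) * x * poly (pderiv y) x" for x
    using arg_cong[OF Suc, of "\<lambda>p. poly p x"] unfolding poly_gegen_op y_def gegen_eigenvalue_def by simp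
  have z1: "pderiv z = smult (real k + 1) (smult (real k + 2 * \<beta> + 1) y + [:0, 1:] * pderiv y)"
  proof (rule poly_ext)
    fix x
    have "poly (pderiv z) x = (real k + 2 * \<beta> + 1) * (poly y x + x * poly (pderiv y) x)
        + 2 * x * poly (pderiv y) x + (x\<^sup>2 - 1) * poly (pderiv (pderiv y)) x"
      unfolding z pderiv_add pderiv_mult pderiv_smult
      by (simp add: pderiv_pCons algebra_simps power2_eq_square)
    also have "\<dots> = poly (smult (real k + 1) (smult (real k + 2 * \<beta> + 1) y + [:0, 1:] * pderiv y)) x"
      unfolding IH by (simp add: algebra_simps)
    finally show "poly (pderiv z) x = \<dots>" .
  qed
  have z2: "pderiv (pderiv z) = smult (real k + 1)
      (smult (real k + 2 * \<beta> + 2) (pderiv y) + [:0, 1:] * pderiv (pderiv y))"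
  proof (rule poly_ext)
    fix x show "poly (pderiv (pderiv z)) x = poly (smult (real k + 1)
      (smult (real k + 2 * \<beta> + 2) (pderiv y) + [:0, 1:] * pderiv (pderiv y))) x"
      unfolding z1 by (simp add: pderiv_add pderiv_mult pderiv_smult pderiv_pCons algebra_simps)
  qed
  show ?case unfolding z_def[symmetric]
  proof (rule poly_ext)
    fix x
    have "poly (gegen_op \<beta> z) x = (real k + 1) * ((real k + 2 * \<beta> + 2) * (x\<^sup>2 - 1) * poly (pderiv y) x
        + x * ((x\<^sup>2 - 1) * poly (pderiv (pderiv y)) x)
        + 2 * (\<beta> + 1) * x * ((real k + 2 * \<beta> + 1) * poly y x + x * poly (pderiv y) x))"
      unfolding poly_gegen_op z2 unfolding z1 by (simp add: algebra_simps)
    also have "\<dots> = poly (smult (gegen_eigenvalue \<beta> (Suc k)) z) x"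
      unfolding IH z gegen_eigenvalue_def by (simp add: algebra_simps power2_eq_square)
    finally show "poly (gegen_op \<beta> z) x = \<dots>" .
  qed
qed

text \<open>
  Differentiating the equation raises the exponent of the weight by one.
\<close>

lemma gegen_op_pderiv:
  assumes "gegen_op \<beta> p = smult \<mu> p"
  shows "gegen_op (\<beta> + 1) (pderiv p) = smult (\<mu> - 2 * (\<beta> + 1)) (pderiv p)"
proof (rule poly_ext)
  fix x
  have "poly (pderiv (gegen_op \<beta> p)) x = \<mu> * poly (pderiv p) x"
    by (simp add: assms pderiv_smult)
  moreover have "poly (pderiv (gegen_op \<beta> p)) x = poly (gegen_op (\<beta> + 1) (pderiv p)) x + 2 * (\<beta> + 1) * poly (pderiv p) x"
    unfolding poly_gegen_op unfolding gegen_op_def pderiv_add pderiv_mult pderiv_smult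
    by (simp add: pderiv_pCons algebra_simps power2_eq_square)
  ultimately show "poly (gegen_op (\<beta> + 1) (pderiv p)) x = poly (smult (\<mu> - 2 * (\<beta> + 1)) (pderiv p)) x"
    by (simp add: algebra_simps)
qed

lemma gegen_coeff:
  assumes "0 \<le> \<beta>"
  shows "(\<forall>n>k. coeff (gegen \<beta> k) n = 0) \<and> coeff (gegen \<beta> k) k \<noteq> 0"
proof (induction k)
  case 0 show ?case by simp
next
  case (Suc k)
  define y where "y = gegen \<beta> k"
  have y: "coeff y n = 0" if "k < n" for n using Suc that by (simp add: y_def)
  have yk: "coeff y k \<noteq> 0" using Suc by (simp add: y_def)
  have c: "coeff (gegen \<beta> (Suc k)) (Suc n) = (real k + 2 * \<beta> + 1 + real n) * coeff y n
      - real (n + 2) * coeff y (n + 2)" for n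
    by (cases n) (simp_all add: y_def[symmetric] coeff_pderiv algebra_simps numeral_2_eq_2)
  have "real k + 2 * \<beta> + 1 + real k > 0" using assms by linarith
  then have "coeff (gegen \<beta> (Suc k)) (Suc k) \<noteq> 0" unfolding c using y[of "k + 2"] yk by simp
  moreover have "coeff (gegen \<beta> (Suc k)) n = 0" if "n > Suc k" for n
  proof -
    define m where "m = n - 1"
    have m: "n = Suc m" "m > k" using that by (auto simp: m_def)
    show ?thesis unfolding m(1) c using y[of m] y[of "m + 2"] m(2) by simp
  qed
  ultimately show ?case by blast
qed

lemma degree_gegen:
  assumes "0 \<le> \<beta>"
  shows "degree (gegen \<beta> k) = k"
  using gegen_coeff[OF assms, of k] by (intro antisym degree_le le_degree) auto

lemma poly_measurable [simp]: "poly (p :: real poly) \<in> borel_measurable (lebesgue_on {-1..1})"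
  by (rule measurable_of_continuous_interior) (intro continuous_intros)

lemma poly_mult_fun: "poly (p * q) = (\<lambda>x. poly p x * poly q x)"
  by auto

lemma poly_bounded_on_interval: "\<exists>C. \<forall>x\<in>{-1..1}. \<bar>poly (p :: real poly) x\<bar> \<le> C"
proof -
  have "compact (poly p ` {-1..1})" by (intro compact_continuous_image continuous_intros) simp
  then show ?thesis by (auto dest!: compact_imp_bounded simp: bounded_iff)
qed

lemma poly_integrable [simp]:
  assumes "0 \<le> \<beta>"
  shows "integrable (weighted_measure \<beta>) (poly p)"
proof -
  obtain C where "\<forall>x\<in>{-1..1}. \<bar>poly p x\<bar> \<le> C" using poly_bounded_on_interval by blast
  then show ?thesis by (intro bounded_integrable_weighted[OF assms poly_measurable, of _ C]) simp
qed

lemma flux_has_derivative: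
  fixes p :: "real poly"
  assumes "x \<in> {-1<..<1}" "gegen_op \<beta> p = smult \<mu> p"
  shows "((\<lambda>x. jacobi_weight (\<beta> + 1) x * poly (pderiv p) x) has_real_derivative
            - \<mu> * jacobi_weight \<beta> x * poly p x) (at x)"
proof -
  have "((\<lambda>x. jacobi_weight (\<beta> + 1) x * poly (pderiv p) x) has_real_derivative
     - 2 * (\<beta> + 1) * x * jacobi_weight \<beta> x * poly (pderiv p) x + poly (pderiv (pderiv p)) x * jacobi_weight (\<beta> + 1) x) (at x)"
    by (intro DERIV_mult jacobi_weight_has_derivative[OF assms(1)] poly_DERIV)
  moreover have "- 2 * (\<beta> + 1) * x * jacobi_weight \<beta> x * poly (pderiv p) x + poly (pderiv (pderiv p)) x * jacobi_weight (\<beta> + 1) x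
     = - (jacobi_weight \<beta> x * poly (gegen_op \<beta> p) x)"
    using assms(1) unfolding poly_gegen_op by (subst jacobi_weight_Suc) (auto simp: algebra_simps)
  ultimately show ?thesis by (simp add: assms(2) mult_ac)
qed

text \<open>
  Green's identity, from the flux \<open>\<omega>\<^bsub>\<beta>+1\<^esub> p' q\<close>. It gives both the orthogonality of
  eigenpolynomials and, applied to them, the norms of their derivatives in the next weight.
\<close>

lemma integral_pderiv_product:
  fixes p q :: "real poly"
  assumes \<beta>: "0 \<le> \<beta>" and p: "gegen_op \<beta> p = smult \<mu> p"
  shows "(\<integral>x. poly (pderiv p * pderiv q) x \<partial>weighted_measure (\<beta> + 1)) = \<mu> * (\<integral>x. poly (p * q) x \<partial>weighted_measure \<beta>)"
proof -
  define h where "h = smult (- \<mu>) (p * q) + [:1, 0, -1:] * (pderiv p * pderiv q)"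
  obtain C where C: "\<forall>x\<in>{-1..1}. \<bar>poly h x\<bar> \<le> C" using poly_bounded_on_interval by blast
  have "(\<integral>x. poly h x \<partial>weighted_measure \<beta>) = 0"
  proof (rule integral_of_flux_derivative[OF \<beta>, where W = "\<lambda>x. jacobi_weight (\<beta> + 1) x * poly (pderiv p * q) x" and C = C])
    fix x :: real assume x: "x \<in> {-1<..<1}"
    have "((\<lambda>x. (jacobi_weight (\<beta> + 1) x * poly (pderiv p) x) * poly q x) has_real_derivative
       (- \<mu> * jacobi_weight \<beta> x * poly p x) * poly q x + poly (pderiv q) x * (jacobi_weight (\<beta> + 1) x * poly (pderiv p) x)) (at x)"
      by (intro DERIV_mult flux_has_derivative x p poly_DERIV)
    moreover have "(- \<mu> * jacobi_weight \<beta> x * poly p x) * poly q x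
        + poly (pderiv q) x * (jacobi_weight (\<beta> + 1) x * poly (pderiv p) x) = jacobi_weight \<beta> x * poly h x"
      using x by (subst jacobi_weight_Suc) (auto simp: h_def algebra_simps power2_eq_square)
    ultimately show "((\<lambda>x. jacobi_weight (\<beta> + 1) x * poly (pderiv p * q) x)
        has_real_derivative jacobi_weight \<beta> x * poly h x) (at x)"
      by (simp add: mult.assoc)
    show "\<bar>poly h x\<bar> \<le> C" using C x by simp
  next
    have "((\<lambda>x. jacobi_weight (\<beta> + 1) x * poly (pderiv p * q) x) \<longlongrightarrow> 0 * poly (pderiv p * q) 1) (at_left 1)"
      by (intro tendsto_mult jacobi_weight_tendsto_0 \<beta> tendsto_poly tendsto_ident_at)
    then show "((\<lambda>x. jacobi_weight (\<beta> + 1) x * poly (pderiv p * q) x) \<longlongrightarrow> 0) (at_left 1)" by simp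
    have "((\<lambda>x. jacobi_weight (\<beta> + 1) x * poly (pderiv p * q) x) \<longlongrightarrow> 0 * poly (pderiv p * q) (-1)) (at_right (-1))"
      by (intro tendsto_mult jacobi_weight_tendsto_0 \<beta> tendsto_poly tendsto_ident_at)
    then show "((\<lambda>x. jacobi_weight (\<beta> + 1) x * poly (pderiv p * q) x) \<longlongrightarrow> 0) (at_right (-1))" by simp
  qed (intro continuous_intros)
  moreover have "(\<integral>x. poly h x \<partial>weighted_measure \<beta>) = - \<mu> * (\<integral>x. poly (p * q) x \<partial>weighted_measure \<beta>)
      + (\<integral>x. poly ([:1, 0, -1:] * (pderiv p * pderiv q)) x \<partial>weighted_measure \<beta>)"
    unfolding h_def poly_add poly_smult using poly_integrable[OF \<beta>]
    by (subst Bochner_Integration.integral_add) (simp_all del: poly_mult mult_pCons_left)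
  moreover have "(\<integral>x. poly ([:1, 0, -1:] * (pderiv p * pderiv q)) x \<partial>weighted_measure \<beta>)
      = (\<integral>x. poly (pderiv p * pderiv q) x \<partial>weighted_measure (\<beta> + 1))"
    unfolding weighted_shift(1)[OF poly_measurable]
    by (rule arg_cong[of _ _ "integral\<^sup>L _"]) (auto simp: algebra_simps power2_eq_square)
  ultimately show ?thesis by simp
qed

lemma gegen_op_orthogonal:
  fixes p q :: "real poly"
  assumes \<beta>: "0 \<le> \<beta>" and p: "gegen_op \<beta> p = smult \<mu> p" and q: "gegen_op \<beta> q = smult \<nu> q" and ne: "\<mu> \<noteq> \<nu>"
  shows "(\<integral>x. poly (p * q) x \<partial>weighted_measure \<beta>) = 0"
  using integral_pderiv_product[OF \<beta> p, of q] integral_pderiv_product[OF \<beta> q, of p] ne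
  by (simp add: mult.commute)

lemma AE_weighted_zero_imp_zero:
  fixes g :: "real \<Rightarrow> real"
  assumes ae: "AE x in weighted_measure \<beta>. g x = 0" and cont: "continuous_on {-1<..<1} g" and x: "x \<in> {-1<..<1}"
  shows "g x = 0"
proof (rule ccontr)
  assume gx: "g x \<noteq> 0"
  have "open ({-1<..<1} \<inter> g -` (- {0}))"
    using cont by (intro continuous_open_preimage) auto
  then obtain e where e: "e > 0" "ball x e \<subseteq> {-1<..<1} \<inter> g -` (- {0})"
    using gx x open_contains_ball by (metis (no_types, lifting) ComplI IntI singletonD vimageI)
  have "AE y in lebesgue_on {-1..1}. 0 < ennreal (jacobi_weight \<beta> y) \<longrightarrow> g y = 0"
    using ae unfolding weighted_measure_def
    by (subst (asm) AE_density) (auto intro!: measurable_compose[OF jacobi_weight_measurable_leb])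
  then have "AE y in lebesgue. y \<in> {-1..1} \<longrightarrow> 0 < ennreal (jacobi_weight \<beta> y) \<longrightarrow> g y = 0"
    by (subst (asm) AE_restrict_space_iff) auto
  then have "AE y in lebesgue. y \<notin> ball x e"
  proof (rule AE_mp, intro AE_I2 impI notI)
    fix y assume h: "y \<in> {-1..1} \<longrightarrow> 0 < ennreal (jacobi_weight \<beta> y) \<longrightarrow> g y = 0" and y: "y \<in> ball x e"
    have "y \<in> {-1<..<1}" "g y \<noteq> 0" using e(2) y by auto
    then show False using h jacobi_weight_pos[of y \<beta>] by auto
  qed
  then have "ball x e \<in> null_sets lebesgue" by (subst AE_iff_null_sets) auto
  then have "emeasure lborel {x - e<..<x + e} = 0"
    by (simp add: null_sets_def ball_eq_greaterThanLessThan)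
  then show False using e(1) by simp
qed

lemma integral_square_zero_imp_zero:
  fixes g :: "real \<Rightarrow> real"
  assumes int: "integrable (weighted_measure \<beta>) (\<lambda>x. (g x)\<^sup>2)" and 0: "(\<integral>x. (g x)\<^sup>2 \<partial>weighted_measure \<beta>) = 0"
    and cont: "continuous_on {-1<..<1} g" and x: "x \<in> {-1<..<1}"
  shows "g x = 0"
proof -
  have "AE x in weighted_measure \<beta>. (g x)\<^sup>2 = 0"
    using integral_nonneg_eq_0_iff_AE[OF int] 0 by simp
  then have "AE x in weighted_measure \<beta>. g x = 0" by simp
  then show ?thesis using cont x by (rule AE_weighted_zero_imp_zero)
qed

lemma gegen_norm_pos:
  assumes "0 \<le> \<beta>"
  shows "0 < (\<integral>x. poly (gegen \<beta> k * gegen \<beta> k) x \<partial>weighted_measure \<beta>)"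
proof (rule ccontr)
  assume neg: "\<not> ?thesis"
  have "0 \<le> (\<integral>x. poly (gegen \<beta> k * gegen \<beta> k) x \<partial>weighted_measure \<beta>)"
    by (intro integral_nonneg_AE) simp
  moreover have "(\<integral>x. (poly (gegen \<beta> k) x)\<^sup>2 \<partial>weighted_measure \<beta>)
      = (\<integral>x. poly (gegen \<beta> k * gegen \<beta> k) x \<partial>weighted_measure \<beta>)" by (simp add: power2_eq_square)
  ultimately have 0: "(\<integral>x. (poly (gegen \<beta> k) x)\<^sup>2 \<partial>weighted_measure \<beta>) = 0"
    using neg by linarith
  have int: "integrable (weighted_measure \<beta>) (\<lambda>x. (poly (gegen \<beta> k) x)\<^sup>2)"
    using poly_integrable[OF assms, of "gegen \<beta> k * gegen \<beta> k"]
    unfolding poly_mult_fun power2_eq_square .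
  have "poly (gegen \<beta> k) x = 0" if "x \<in> {-1<..<1}" for x
    by (rule integral_square_zero_imp_zero[OF int 0 _ that]) (intro continuous_intros)
  then have "{-1<..<1} \<subseteq> {x. poly (gegen \<beta> k) x = 0}" by auto
  moreover have "infinite {-1<..<1::real}" by (simp add: infinite_Ioo)
  ultimately have "gegen \<beta> k = 0" using poly_roots_finite infinite_super by blast
  then show False using gegen_coeff[OF assms, of k] by simp
qed

definition gpoly :: "real \<Rightarrow> nat \<Rightarrow> real poly" where
  "gpoly \<beta> k = smult (1 / sqrt (\<integral>x. poly (gegen \<beta> k * gegen \<beta> k) x \<partial>weighted_measure \<beta>)) (gegen \<beta> k)"

lemma gegen_op_gpoly: "gegen_op \<beta> (gpoly \<beta> k) = smult (gegen_eigenvalue \<beta> k) (gpoly \<beta> k)"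
proof -
  have "gegen_op \<beta> (smult c p) = smult c (gegen_op \<beta> p)" for c p
    by (rule poly_ext) (simp add: poly_gegen_op pderiv_smult algebra_simps)
  then show ?thesis by (simp add: gpoly_def gegen_op_gegen mult.commute)
qed

lemma gegen_eigenvalue_strict_mono:
  assumes "0 \<le> \<beta>" "j < k"
  shows "gegen_eigenvalue \<beta> j < gegen_eigenvalue \<beta> k"
  unfolding gegen_eigenvalue_def using assms by (intro mult_strict_mono) auto

lemma gpoly_orthonormal:
  assumes "0 \<le> \<beta>"
  shows "(\<integral>x. poly (gpoly \<beta> j) x * poly (gpoly \<beta> k) x \<partial>weighted_measure \<beta>) = (if j = k then 1 else 0)"
proof (cases "j = k")
  case True
  define N where "N = (\<integral>x. poly (gegen \<beta> k * gegen \<beta> k) x \<partial>weighted_measure \<beta>)"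
  have N: "0 < N" unfolding N_def by (rule gegen_norm_pos[OF assms])
  have "poly (gpoly \<beta> k) x * poly (gpoly \<beta> k) x = (1 / N) * poly (gegen \<beta> k * gegen \<beta> k) x" for x
    unfolding gpoly_def N_def[symmetric] poly_smult using N by (simp add: field_simps)
  then have "(\<integral>x. poly (gpoly \<beta> j) x * poly (gpoly \<beta> k) x \<partial>weighted_measure \<beta>)
      = (\<integral>x. (1 / N) * poly (gegen \<beta> k * gegen \<beta> k) x \<partial>weighted_measure \<beta>)"
    unfolding True by (simp only:)
  also have "\<dots> = (1 / N) * N" unfolding N_def by (rule integral_mult_right_zero)
  finally show ?thesis using N True by simp
next
  case False
  then have "gegen_eigenvalue \<beta> j \<noteq> gegen_eigenvalue \<beta> k"
    using gegen_eigenvalue_strict_mono[OF assms] by (metis less_irrefl nat_neq_iff)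
  from gegen_op_orthogonal[OF assms gegen_op_gpoly gegen_op_gpoly this] False show ?thesis by simp
qed

lemma degree_gpoly:
  assumes "0 \<le> \<beta>"
  shows "degree (gpoly \<beta> k) = k"
  using gegen_norm_pos[OF assms, of k] by (simp add: gpoly_def degree_gegen[OF assms])

lemma poly_in_span_gpoly:
  assumes \<beta>: "0 \<le> \<beta>" and "degree q \<le> n"
  obtains a where "q = (\<Sum>j\<le>n. smult (a j) (gpoly \<beta> j))"
proof -
  have "\<exists>a. q = (\<Sum>j\<le>n. smult (a j) (gpoly \<beta> j))" using assms(2)
  proof (induction n arbitrary: q)
    case 0
    have g: "degree (gpoly \<beta> 0) = 0" "lead_coeff (gpoly \<beta> 0) \<noteq> 0"
      using degree_gpoly[OF \<beta>, of 0] gegen_norm_pos[OF \<beta>, of 0] by (auto simp: gpoly_def)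
    show ?case
    proof (intro exI poly_eqI)
      fix i
      show "coeff q i = coeff (\<Sum>j\<le>0. smult (coeff q 0 / coeff (gpoly \<beta> 0) 0) (gpoly \<beta> j)) i"
        using 0 g by (cases i) (auto simp: coeff_eq_0)
    qed
  next
    case (Suc n)
    have g: "coeff (gpoly \<beta> (Suc n)) (Suc n) \<noteq> 0"
      using degree_gpoly[OF \<beta>, of "Suc n"] by (metis degree_0 leading_coeff_0_iff nat.distinct(1))
    define c where "c = coeff q (Suc n) / coeff (gpoly \<beta> (Suc n)) (Suc n)"
    define r where "r = q - smult c (gpoly \<beta> (Suc n))"
    have "degree r \<le> n"
    proof (rule degree_le, intro allI impI)
      fix i assume "n < i"
      then consider "i = Suc n" | "i > Suc n" by linarith
      then show "coeff r i = 0"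
        using g Suc.prems degree_gpoly[OF \<beta>, of "Suc n"]
        by cases (auto simp: r_def c_def coeff_eq_0)
    qed
    then obtain a where "r = (\<Sum>j\<le>n. smult (a j) (gpoly \<beta> j))" using Suc.IH by blast
    then have "q = (\<Sum>j\<le>Suc n. smult ((a(Suc n := c)) j) (gpoly \<beta> j))"
      by (simp add: r_def algebra_simps)
    then show ?case by blast
  qed
  then show ?thesis using that by blast
qed

section \<open>Real weighted square-integrable functions and completeness of polynomials\<close>

text \<open>
  Real-valued square-integrable functions. The eigenfunctions are real, so a complex function
  is treated through its real and imaginary parts.
\<close>

definition rL2 :: "real \<Rightarrow> (real \<Rightarrow> real) set" where
  "rL2 \<beta> = {f. f \<in> borel_measurable (weighted_measure \<beta>) \<and> integrable (weighted_measure \<beta>) (\<lambda>x. (f x)\<^sup>2)}"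

definition rinner :: "real \<Rightarrow> (real \<Rightarrow> real) \<Rightarrow> (real \<Rightarrow> real) \<Rightarrow> real" where
  "rinner \<beta> f g = (\<integral>x. f x * g x \<partial>weighted_measure \<beta>)"

lemma rL2_measurable: "f \<in> rL2 \<beta> \<Longrightarrow> f \<in> borel_measurable (weighted_measure \<beta>)"
  by (simp add: rL2_def)

lemma rinner_commute: "rinner \<beta> f g = rinner \<beta> g f"
  by (simp add: rinner_def mult.commute)

lemma rL2_product_integrable:
  assumes "f \<in> rL2 \<beta>" "g \<in> rL2 \<beta>"
  shows "integrable (weighted_measure \<beta>) (\<lambda>x. f x * g x)"
proof (rule Bochner_Integration.integrable_bound)
  show "integrable (weighted_measure \<beta>) (\<lambda>x. (f x)\<^sup>2 + (g x)\<^sup>2)"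
    using assms by (intro Bochner_Integration.integrable_add) (auto simp: rL2_def)
  show "(\<lambda>x. f x * g x) \<in> borel_measurable (weighted_measure \<beta>)"
    using assms by (intro borel_measurable_times) (auto simp: rL2_def)
  have "\<bar>a * b\<bar> \<le> a\<^sup>2 + b\<^sup>2" for a b :: real
  proof -
    have "0 \<le> (\<bar>a\<bar> - \<bar>b\<bar>)\<^sup>2" by simp
    then have "2 * (\<bar>a\<bar> * \<bar>b\<bar>) \<le> a\<^sup>2 + b\<^sup>2" by (simp add: power2_diff)
    moreover have "0 \<le> \<bar>a\<bar> * \<bar>b\<bar>" by simp
    ultimately show ?thesis unfolding abs_mult by linarith
  qed
  then show "AE x in weighted_measure \<beta>. norm (f x * g x) \<le> norm ((f x)\<^sup>2 + (g x)\<^sup>2)"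
    by (intro AE_I2) (simp add: abs_of_nonneg)
qed

lemma rL2_add: "f \<in> rL2 \<beta> \<Longrightarrow> g \<in> rL2 \<beta> \<Longrightarrow> (\<lambda>x. f x + g x) \<in> rL2 \<beta>"
proof -
  assume fg: "f \<in> rL2 \<beta>" "g \<in> rL2 \<beta>"
  have "integrable (weighted_measure \<beta>) (\<lambda>x. (f x)\<^sup>2 + (g x)\<^sup>2 + 2 * (f x * g x))"
    using fg rL2_product_integrable[OF fg]
    by (intro Bochner_Integration.integrable_add integrable_mult_right) (auto simp: rL2_def)
  then show ?thesis using fg
    by (auto simp: rL2_def power2_sum mult.assoc intro: borel_measurable_add)
qed

lemma rL2_cmult: "f \<in> rL2 \<beta> \<Longrightarrow> (\<lambda>x. c * f x) \<in> rL2 \<beta>"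
  by (auto simp: rL2_def power_mult_distrib intro: borel_measurable_times)

lemma rL2_diff: "f \<in> rL2 \<beta> \<Longrightarrow> g \<in> rL2 \<beta> \<Longrightarrow> (\<lambda>x. f x - g x) \<in> rL2 \<beta>"
  using rL2_add[of f \<beta> "\<lambda>x. (-1) * g x"] rL2_cmult[of g \<beta> "-1"] by simp

lemma rL2_zero: "(\<lambda>x. 0) \<in> rL2 \<beta>" by (simp add: rL2_def)

lemma rL2_sum: "(\<And>i. i \<in> I \<Longrightarrow> e i \<in> rL2 \<beta>) \<Longrightarrow> (\<lambda>x. \<Sum>i\<in>I. e i x) \<in> rL2 \<beta>"
  by (induction I rule: infinite_finite_induct) (auto intro: rL2_zero rL2_add)

lemma rL2_bounded:
  assumes "0 \<le> \<beta>" "f \<in> borel_measurable (weighted_measure \<beta>)" "\<And>x. x \<in> {-1..1} \<Longrightarrow> \<bar>f x\<bar> \<le> C"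
  shows "f \<in> rL2 \<beta>"
proof -
  have m: "(\<lambda>x. (f x)\<^sup>2) \<in> borel_measurable (lebesgue_on {-1..1})"
    using borel_measurable_power[OF assms(2)] unfolding measurable_weighted_iff .
  have "integrable (weighted_measure \<beta>) (\<lambda>x. (f x)\<^sup>2)"
  proof (rule bounded_integrable_weighted[OF assms(1) m])
    fix x :: real assume "x \<in> {-1..1}"
    then show "norm ((f x)\<^sup>2) \<le> C\<^sup>2"
      using assms(3) power_mono[of "\<bar>f x\<bar>" C 2] by simp
  qed
  then show ?thesis using assms(2) by (simp only: rL2_def mem_Collect_eq simp_thms)
qed

lemma rL2_poly: "0 \<le> \<beta> \<Longrightarrow> poly p \<in> rL2 \<beta>"
proof -
  assume \<beta>: "0 \<le> \<beta>"
  obtain C where C: "\<forall>x\<in>{-1..1}. \<bar>poly p x\<bar> \<le> C" using poly_bounded_on_interval by blast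
  have m: "poly p \<in> borel_measurable (weighted_measure \<beta>)"
    by (simp only: measurable_weighted_iff poly_measurable)
  show "poly p \<in> rL2 \<beta>" by (rule rL2_bounded[OF \<beta> m]) (rule C[rule_format])
qed

lemma rinner_add_left: "f \<in> rL2 \<beta> \<Longrightarrow> g \<in> rL2 \<beta> \<Longrightarrow> h \<in> rL2 \<beta> \<Longrightarrow> rinner \<beta> (\<lambda>x. f x + g x) h = rinner \<beta> f h + rinner \<beta> g h"
  unfolding rinner_def distrib_right by (intro Bochner_Integration.integral_add rL2_product_integrable)

lemma rinner_diff_left: "f \<in> rL2 \<beta> \<Longrightarrow> g \<in> rL2 \<beta> \<Longrightarrow> h \<in> rL2 \<beta> \<Longrightarrow> rinner \<beta> (\<lambda>x. f x - g x) h = rinner \<beta> f h - rinner \<beta> g h"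
  unfolding rinner_def left_diff_distrib by (intro Bochner_Integration.integral_diff rL2_product_integrable)

lemma rinner_cmult_left: "rinner \<beta> (\<lambda>x. c * f x) h = c * rinner \<beta> f h"
  by (simp add: rinner_def mult.assoc)

lemma rinner_sum_left:
  assumes "\<And>i. i \<in> I \<Longrightarrow> e i \<in> rL2 \<beta>" "h \<in> rL2 \<beta>"
  shows "rinner \<beta> (\<lambda>x. \<Sum>i\<in>I. e i x) h = (\<Sum>i\<in>I. rinner \<beta> (e i) h)"
  using assms
proof (induction I rule: infinite_finite_induct)
  case (insert i I)
  then show ?case by (simp add: rinner_add_left rL2_sum)
qed (simp_all add: rinner_def)

lemma rinner_nonneg: "0 \<le> rinner \<beta> f f"
  unfolding rinner_def by (intro integral_nonneg_AE) simp

lemma rinner_diff_expand: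
  assumes "f \<in> rL2 \<beta>" "g \<in> rL2 \<beta>"
  shows "rinner \<beta> (\<lambda>x. f x - g x) (\<lambda>x. f x - g x) = rinner \<beta> f f - 2 * rinner \<beta> f g + rinner \<beta> g g"
proof -
  note d = rL2_diff[OF assms]
  have "rinner \<beta> (\<lambda>x. f x - g x) (\<lambda>x. f x - g x) = rinner \<beta> (\<lambda>x. f x - g x) f - rinner \<beta> (\<lambda>x. f x - g x) g"
    using rinner_diff_left[OF assms d] by (simp add: rinner_commute)
  then show ?thesis by (simp add: rinner_diff_left assms rinner_commute[of \<beta> g f])
qed

definition rL2_orthonormal :: "real \<Rightarrow> nat set \<Rightarrow> (nat \<Rightarrow> real \<Rightarrow> real) \<Rightarrow> bool" where
  "rL2_orthonormal \<beta> I e \<longleftrightarrow> finite I \<and> (\<forall>i\<in>I. e i \<in> rL2 \<beta>) \<and> (\<forall>i\<in>I. \<forall>j\<in>I. rinner \<beta> (e i) (e j) = (if i = j then 1 else 0))"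

text \<open>
  Completing the square: the expansion from which Bessel's inequality and the best approximation
  property of the partial sums are read off.
\<close>

lemma rinner_combination:
  assumes e: "rL2_orthonormal \<beta> I e" and f: "f \<in> rL2 \<beta>"
  shows "rinner \<beta> (\<lambda>x. f x - (\<Sum>i\<in>I. a i * e i x)) (\<lambda>x. f x - (\<Sum>i\<in>I. a i * e i x))
       = rinner \<beta> f f - 2 * (\<Sum>i\<in>I. a i * rinner \<beta> f (e i)) + (\<Sum>i\<in>I. (a i)\<^sup>2)"
proof -
  have fin: "finite I" and eL: "\<And>i. i \<in> I \<Longrightarrow> e i \<in> rL2 \<beta>"
    and on: "\<And>i j. i \<in> I \<Longrightarrow> j \<in> I \<Longrightarrow> rinner \<beta> (e i) (e j) = (if i = j then 1 else 0)"
    using e by (auto simp: rL2_orthonormal_def)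
  let ?g = "\<lambda>x. \<Sum>i\<in>I. a i * e i x"
  have gL: "?g \<in> rL2 \<beta>" by (intro rL2_sum rL2_cmult eL)
  have g: "rinner \<beta> ?g h = (\<Sum>i\<in>I. a i * rinner \<beta> (e i) h)" if "h \<in> rL2 \<beta>" for h
    using that by (simp add: rinner_sum_left rL2_cmult eL rinner_cmult_left)
  have ge: "rinner \<beta> ?g (e i) = a i" if "i \<in> I" for i
  proof -
    have "rinner \<beta> ?g (e i) = (\<Sum>j\<in>I. if j = i then a i else 0)"
      unfolding g[OF eL[OF that]] using that by (intro sum.cong) (auto simp: on)
    then show ?thesis using that fin by simp
  qed
  have "rinner \<beta> ?g ?g = (\<Sum>i\<in>I. (a i)\<^sup>2)"
    unfolding g[OF gL] by (intro sum.cong refl) (simp add: rinner_commute[of \<beta> "e _"] ge power2_eq_square)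
  moreover have "rinner \<beta> f ?g = (\<Sum>i\<in>I. a i * rinner \<beta> f (e i))"
    unfolding rinner_commute[of \<beta> f] by (rule g[OF f])
  ultimately show ?thesis using rinner_diff_expand[OF f gL] by simp
qed

lemma rL2_Bessel:
  assumes "rL2_orthonormal \<beta> I e" "f \<in> rL2 \<beta>"
  shows "(\<Sum>i\<in>I. (rinner \<beta> f (e i))\<^sup>2) \<le> rinner \<beta> f f"
proof -
  let ?c = "\<lambda>i. rinner \<beta> f (e i)"
  have "0 \<le> rinner \<beta> f f - 2 * (\<Sum>i\<in>I. ?c i * ?c i) + (\<Sum>i\<in>I. (?c i)\<^sup>2)"
    unfolding rinner_combination[OF assms, symmetric] by (rule rinner_nonneg)
  then show ?thesis by (simp add: power2_eq_square)
qed

lemma rL2_orthonormal_gpoly: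
  assumes "0 \<le> \<beta>" "finite I"
  shows "rL2_orthonormal \<beta> I (\<lambda>k. poly (gpoly \<beta> k))"
  using assms by (auto simp: rL2_orthonormal_def rL2_poly rinner_def gpoly_orthonormal)

definition clip :: "real \<Rightarrow> real \<Rightarrow> real" where "clip m y = max (- m) (min m y)"

lemma clip_simps: "0 \<le> m \<Longrightarrow> \<bar>clip m y\<bar> \<le> m" "\<bar>y\<bar> \<le> m \<Longrightarrow> clip m y = y" "0 \<le> m \<Longrightarrow> \<bar>y - clip m y\<bar> \<le> \<bar>y\<bar>"
  by (auto simp: clip_def)

lemma isCont_clip: "isCont (clip m) y"
  unfolding clip_def by (intro continuous_intros)

lemma clip_measurable: "f \<in> borel_measurable M \<Longrightarrow> (\<lambda>x. clip m (f x)) \<in> borel_measurable M"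
  unfolding clip_def by (intro borel_measurable_max borel_measurable_min) auto

lemma clip_approx:
  assumes f: "f \<in> rL2 \<beta>" and e: "0 < e"
  obtains n :: nat where "rinner \<beta> (\<lambda>x. f x - clip (real n) (f x)) (\<lambda>x. f x - clip (real n) (f x)) < e"
proof -
  have fm: "f \<in> borel_measurable (weighted_measure \<beta>)" using f by (rule rL2_measurable)
  have "(\<lambda>n. \<integral>x. (f x - clip (real n) (f x))\<^sup>2 \<partial>weighted_measure \<beta>) \<longlonglongrightarrow> (\<integral>x. 0 \<partial>weighted_measure \<beta>)"
  proof (rule integral_dominated_convergence[where w = "\<lambda>x. (f x)\<^sup>2"])
    show "AE x in weighted_measure \<beta>. (\<lambda>n. (f x - clip (real n) (f x))\<^sup>2) \<longlonglongrightarrow> 0"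
    proof (intro AE_I2 tendsto_eventually)
      fix x
      obtain N :: nat where "\<bar>f x\<bar> \<le> real N" using real_arch_simple by blast
      then show "\<forall>\<^sub>F n in sequentially. (f x - clip (real n) (f x))\<^sup>2 = 0"
        unfolding eventually_sequentially by (intro exI[of _ N]) (auto simp: clip_simps(2))
    qed
    show "AE x in weighted_measure \<beta>. norm ((f x - clip (real n) (f x))\<^sup>2) \<le> (f x)\<^sup>2" for n
      using clip_simps(3)[of "real n"] by (intro AE_I2) (simp add: abs_le_square_iff[symmetric])
    show "(\<lambda>x. (f x - clip (real n) (f x))\<^sup>2) \<in> borel_measurable (weighted_measure \<beta>)" for n
      by (intro borel_measurable_power borel_measurable_diff clip_measurable fm)
  qed (use f in \<open>auto simp: rL2_def\<close>)
  then have "\<forall>\<^sub>F n in sequentially. (\<integral>x. (f x - clip (real n) (f x))\<^sup>2 \<partial>weighted_measure \<beta>) < e"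
    using e by (intro order_tendstoD) simp_all
  then show ?thesis using that by (auto simp: eventually_sequentially rinner_def power2_eq_square)
qed

text \<open>
  A Lebesgue measurable function is almost everywhere a limit of continuous functions; clipping
  them at the bound of \<open>f\<close> permits dominated convergence.
\<close>

lemma continuous_approx:
  assumes \<beta>: "0 \<le> \<beta>" and f: "f \<in> borel_measurable (weighted_measure \<beta>)" and m: "0 \<le> m" "\<And>x. \<bar>f x\<bar> \<le> m" and e: "0 < e"
  obtains g where "continuous_on UNIV g" "\<And>x. \<bar>g x\<bar> \<le> m" "rinner \<beta> (\<lambda>x. f x - g x) (\<lambda>x. f x - g x) < e"
proof -
  have "(\<lambda>x. if x \<in> {-1..1} then f x else 0) \<in> borel_measurable lebesgue"
    using f unfolding measurable_weighted_iff by (subst borel_measurable_if) auto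
  then have "(\<lambda>x. if x \<in> {-1..1} then f x else 0) measurable_on {-1..1}"
    by (rule lebesgue_measurable_imp_measurable_on_real) simp
  then obtain N g where N: "negligible N" and g: "\<And>n. continuous_on UNIV (g n)"
    and lim: "\<And>x. x \<notin> N \<Longrightarrow> (\<lambda>n. g n x) \<longlonglongrightarrow> (if x \<in> {-1..1} then (if x \<in> {-1..1} then f x else 0) else 0)"
    unfolding measurable_on_def by blast
  define h where "h n x = clip m (g n x)" for n x
  have hc: "continuous_on UNIV (h n)" for n
    unfolding h_def clip_def by (intro continuous_intros g)
  have hb: "\<bar>h n x\<bar> \<le> m" for n x unfolding h_def using m(1) by (rule clip_simps(1))
  have hm: "h n \<in> borel_measurable (weighted_measure \<beta>)" for n
    unfolding measurable_weighted_iff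
    by (rule measurable_of_continuous_interior) (rule continuous_on_subset[OF hc], simp)
  have aeN: "AE x in weighted_measure \<beta>. x \<notin> N"
  proof -
    have "AE x in lebesgue. x \<notin> N" using N by (simp add: negligible_iff_null_sets AE_not_in)
    then have "AE x in lebesgue_on {-1..1}. x \<notin> N" by (subst AE_restrict_space_iff) auto
    then show ?thesis unfolding weighted_measure_def
      by (subst AE_density) (auto intro!: measurable_compose[OF jacobi_weight_measurable_leb])
  qed
  have "(\<lambda>n. \<integral>x. (f x - h n x)\<^sup>2 \<partial>weighted_measure \<beta>) \<longlonglongrightarrow> (\<integral>x. 0 \<partial>weighted_measure \<beta>)"
  proof (rule integral_dominated_convergence[where w = "\<lambda>x. (2 * m)\<^sup>2"])
    show "AE x in weighted_measure \<beta>. (\<lambda>n. (f x - h n x)\<^sup>2) \<longlonglongrightarrow> 0"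
      using aeN AE_space
    proof eventually_elim
      case (elim x)
      then have "(\<lambda>n. g n x) \<longlonglongrightarrow> f x" using lim[of x] by simp
      then have "(\<lambda>n. h n x) \<longlonglongrightarrow> clip m (f x)" unfolding h_def by (rule isCont_tendsto_compose[OF isCont_clip])
      then have "(\<lambda>n. (f x - h n x)\<^sup>2) \<longlonglongrightarrow> (f x - f x)\<^sup>2"
        using m(2)[of x] by (intro tendsto_intros) (simp add: clip_simps(2))
      then show ?case by simp
    qed
    show "AE x in weighted_measure \<beta>. norm ((f x - h n x)\<^sup>2) \<le> (2 * m)\<^sup>2" for n
    proof (rule AE_I2)
      fix x
      have "\<bar>f x - h n x\<bar> \<le> 2 * m" using m(2)[of x] hb[of n x] by linarith
      then show "norm ((f x - h n x)\<^sup>2) \<le> (2 * m)\<^sup>2" using power_mono[of "\<bar>f x - h n x\<bar>" "2 * m" 2] by simp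
    qed
    show "integrable (weighted_measure \<beta>) (\<lambda>x. (2 * m)\<^sup>2)"
      using finite_measure_weighted[OF \<beta>] by (simp add: finite_measure.integrable_const)
  qed (use f hm in \<open>auto intro!: borel_measurable_power borel_measurable_diff\<close>)
  then have "\<forall>\<^sub>F n in sequentially. (\<integral>x. (f x - h n x)\<^sup>2 \<partial>weighted_measure \<beta>) < e"
    using e by (intro order_tendstoD) simp_all
  then obtain n where "(\<integral>x. (f x - h n x)\<^sup>2 \<partial>weighted_measure \<beta>) < e" by (auto simp: eventually_sequentially)
  then show ?thesis using that[OF hc[of n] hb] by (simp add: rinner_def power2_eq_square)
qed

lemma Weierstrass_poly:
  fixes g :: "real \<Rightarrow> real"
  assumes "continuous_on {a..b} g" "0 < e"
  obtains q where "\<And>x. x \<in> {a..b} \<Longrightarrow> \<bar>g x - poly q x\<bar> < e"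
proof -
  obtain r where r: "real_polynomial_function r" "\<And>x. x \<in> {a..b} \<Longrightarrow> \<bar>g x - r x\<bar> < e"
    using Stone_Weierstrass_real_polynomial_function[OF compact_Icc assms] by blast
  obtain c n where "r = (\<lambda>x. \<Sum>i\<le>n. c i * x ^ i)" using r(1) real_polynomial_function_iff_sum by blast
  then have "r x = poly (\<Sum>i\<le>n. monom (c i) i) x" for x by (simp add: poly_sum poly_monom)
  then show ?thesis using r(2) by (intro that[of "\<Sum>i\<le>n. monom (c i) i"]) simp
qed

lemma rinner_triangle:
  assumes "f \<in> rL2 \<beta>" "g \<in> rL2 \<beta>"
  shows "rinner \<beta> (\<lambda>x. f x + g x) (\<lambda>x. f x + g x) \<le> 2 * rinner \<beta> f f + 2 * rinner \<beta> g g"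
proof -
  have "rinner \<beta> (\<lambda>x. f x + g x) (\<lambda>x. f x + g x) = rinner \<beta> f f + 2 * rinner \<beta> f g + rinner \<beta> g g"
    using rinner_diff_expand[OF assms(1) rL2_cmult[OF assms(2), of "-1"]]
    by (simp add: rinner_def)
  moreover have "0 \<le> rinner \<beta> f f - 2 * rinner \<beta> f g + rinner \<beta> g g"
    using rinner_diff_expand[OF assms] rinner_nonneg by metis
  ultimately show ?thesis by simp
qed

text \<open>
  In three steps: clip \<open>f\<close>, approximate the bounded function by a continuous one, and this one
  uniformly by a polynomial.
\<close>

lemma poly_dense_rL2:
  assumes \<beta>: "0 \<le> \<beta>" and f: "f \<in> rL2 \<beta>" and e: "0 < e"
  obtains q where "rinner \<beta> (\<lambda>x. f x - poly q x) (\<lambda>x. f x - poly q x) < e"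
proof -
  obtain n :: nat where n: "rinner \<beta> (\<lambda>x. f x - clip (real n) (f x)) (\<lambda>x. f x - clip (real n) (f x)) < e / 16"
    using clip_approx[OF f, of "e / 16"] e by auto
  define f1 where "f1 x = clip (real n) (f x)" for x
  have f1m: "f1 \<in> borel_measurable (weighted_measure \<beta>)"
    unfolding f1_def by (intro clip_measurable rL2_measurable f)
  have f1b: "\<bar>f1 x\<bar> \<le> real n" for x unfolding f1_def by (rule clip_simps(1)) simp
  obtain g where g: "continuous_on UNIV g" "\<And>x. \<bar>g x\<bar> \<le> real n" "rinner \<beta> (\<lambda>x. f1 x - g x) (\<lambda>x. f1 x - g x) < e / 16"
    using continuous_approx[OF \<beta> f1m _ f1b, of "e / 16"] e by auto
  define M where "M = measure (weighted_measure \<beta>) {-1..1}"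
  define d where "d = sqrt (e / (8 * (M + 1)))"
  have M: "0 \<le> M" by (simp add: M_def)
  then have d: "0 < d" "d\<^sup>2 * M < e / 4"
  proof -
    show "0 < d" using e M by (simp add: d_def)
    have "d\<^sup>2 * M = e / 8 * (M / (M + 1))" using e M by (simp add: d_def)
    also have "\<dots> \<le> e / 8 * 1" using e M by (intro mult_left_mono) auto
    finally show "d\<^sup>2 * M < e / 4" using e by simp
  qed
  obtain q where q: "\<And>x. x \<in> {-1..1} \<Longrightarrow> \<bar>g x - poly q x\<bar> < d"
    using Weierstrass_poly[OF continuous_on_subset[OF g(1)] d(1)] by blast
  have f1L: "f1 \<in> rL2 \<beta>" by (rule rL2_bounded[OF \<beta> f1m f1b])
  have gm: "g \<in> borel_measurable (weighted_measure \<beta>)" unfolding measurable_weighted_iff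
    by (rule measurable_of_continuous_interior) (rule continuous_on_subset[OF g(1)], simp)
  have gL: "g \<in> rL2 \<beta>" by (rule rL2_bounded[OF \<beta> gm g(2)])
  have qL: "poly q \<in> rL2 \<beta>" by (rule rL2_poly[OF \<beta>])
  have "rinner \<beta> (\<lambda>x. g x - poly q x) (\<lambda>x. g x - poly q x) \<le> (\<integral>x. d\<^sup>2 \<partial>weighted_measure \<beta>)"
    unfolding rinner_def
  proof (rule integral_mono)
    show "integrable (weighted_measure \<beta>) (\<lambda>x. (g x - poly q x) * (g x - poly q x))"
      by (intro rL2_product_integrable rL2_diff gL qL)
    show "integrable (weighted_measure \<beta>) (\<lambda>x. d\<^sup>2)"
      using finite_measure_weighted[OF \<beta>] by (simp add: finite_measure.integrable_const)
    fix x assume "x \<in> space (weighted_measure \<beta>)"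
    then have "\<bar>g x - poly q x\<bar> \<le> d" using q[of x] by simp
    then show "(g x - poly q x) * (g x - poly q x) \<le> d\<^sup>2"
      using power_mono[of "\<bar>g x - poly q x\<bar>" d 2] by (simp add: power2_eq_square)
  qed
  also have "\<dots> = d\<^sup>2 * M" by (simp add: M_def)
  finally have 3: "rinner \<beta> (\<lambda>x. g x - poly q x) (\<lambda>x. g x - poly q x) < e / 4" using d(2) by simp
  have "rinner \<beta> (\<lambda>x. f x - g x) (\<lambda>x. f x - g x) \<le> 2 * (e / 16) + 2 * (e / 16)"
    using rinner_triangle[OF rL2_diff[OF f f1L] rL2_diff[OF f1L gL]] n g(3) by (simp add: f1_def)
  moreover have "rinner \<beta> (\<lambda>x. f x - poly q x) (\<lambda>x. f x - poly q x)
      \<le> 2 * rinner \<beta> (\<lambda>x. f x - g x) (\<lambda>x. f x - g x) + 2 * rinner \<beta> (\<lambda>x. g x - poly q x) (\<lambda>x. g x - poly q x)"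
    using rinner_triangle[OF rL2_diff[OF f gL] rL2_diff[OF gL qL]] by simp
  ultimately have "rinner \<beta> (\<lambda>x. f x - poly q x) (\<lambda>x. f x - poly q x) < e" using 3 by linarith
  then show ?thesis by (rule that)
qed

lemma gpoly_Parseval:
  assumes \<beta>: "0 \<le> \<beta>" and f: "f \<in> rL2 \<beta>"
  shows "(\<lambda>k. (rinner \<beta> f (poly (gpoly \<beta> k)))\<^sup>2) sums rinner \<beta> f f"
proof -
  let ?c = "\<lambda>k. rinner \<beta> f (poly (gpoly \<beta> k))"
  have B: "(\<Sum>k<n. (?c k)\<^sup>2) \<le> rinner \<beta> f f" for n
    by (rule rL2_Bessel[OF rL2_orthonormal_gpoly[OF \<beta>] f]) simp
  have "\<exists>N. \<forall>n\<ge>N. norm ((\<Sum>k<n. (?c k)\<^sup>2) - rinner \<beta> f f) < e" if e: "0 < e" for e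
  proof -
    obtain q where q: "rinner \<beta> (\<lambda>x. f x - poly q x) (\<lambda>x. f x - poly q x) < e" using poly_dense_rL2[OF \<beta> f e] by blast
    obtain a where a: "q = (\<Sum>j\<le>degree q. smult (a j) (gpoly \<beta> j))"
      using poly_in_span_gpoly[OF \<beta> order_refl] by blast
    let ?I = "{..degree q}"
    have qx: "poly q = (\<lambda>x. \<Sum>j\<in>?I. a j * poly (gpoly \<beta> j) x)"
      by (subst a) (simp add: poly_sum fun_eq_iff)
    have "rinner \<beta> f f - (\<Sum>k\<in>?I. (?c k)\<^sup>2) \<le> rinner \<beta> (\<lambda>x. f x - poly q x) (\<lambda>x. f x - poly q x)"
    proof -
      have "0 \<le> (\<Sum>k\<in>?I. (a k - ?c k)\<^sup>2)" by (intro sum_nonneg) simp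
      also have "\<dots> = (\<Sum>k\<in>?I. (a k)\<^sup>2) - 2 * (\<Sum>k\<in>?I. a k * ?c k) + (\<Sum>k\<in>?I. (?c k)\<^sup>2)"
        by (simp add: power2_diff sum.distrib sum_subtractf sum_distrib_left mult.assoc)
      finally show ?thesis
        unfolding qx rinner_combination[OF rL2_orthonormal_gpoly[OF \<beta> finite_atMost] f] by linarith
    qed
    then have low: "rinner \<beta> f f - e < (\<Sum>k\<in>?I. (?c k)\<^sup>2)" using q by linarith
    show ?thesis
    proof (intro exI allI impI)
      fix n assume "n \<ge> degree q + 1"
      then have "(\<Sum>k\<in>?I. (?c k)\<^sup>2) \<le> (\<Sum>k<n. (?c k)\<^sup>2)" by (intro sum_mono2) auto
      then show "norm ((\<Sum>k<n. (?c k)\<^sup>2) - rinner \<beta> f f) < e" using low B[of n] by simp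
    qed
  qed
  then show ?thesis unfolding sums_def by (intro LIMSEQ_I)
qed

section \<open>Uniform bounds for Gegenbauer polynomials\<close>

text \<open>
  The function \<open>\<mu> p\<^sup>2 + (1 - x\<^sup>2) p'\<^sup>2\<close> has derivative \<open>(4 \<beta> + 2) x p'\<^sup>2\<close> along solutions of the
  differential equation, so it increases on \<open>[0, 1]\<close>, and at \<open>1\<close> it equals \<open>\<mu> p(1)\<^sup>2\<close>.
\<close>

lemma gegen_op_sup_right:
  assumes \<beta>: "0 \<le> \<beta>" and p: "gegen_op \<beta> p = smult \<mu> p" and \<mu>: "0 \<le> \<mu>" and x: "x \<in> {0..1}"
  shows "\<bar>poly p x\<bar> \<le> \<bar>poly p 1\<bar>"
proof -
  define E where "E x = \<mu> * (poly p x)\<^sup>2 + (1 - x\<^sup>2) * (poly (pderiv p) x)\<^sup>2" for x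
  have ode: "(x\<^sup>2 - 1) * poly (pderiv (pderiv p)) x + 2 * (\<beta> + 1) * x * poly (pderiv p) x = \<mu> * poly p x" for x
    using arg_cong[OF p, of "\<lambda>p. poly p x"] unfolding poly_gegen_op by simp
  have dE: "(E has_real_derivative (4 * \<beta> + 2) * x * (poly (pderiv p) x)\<^sup>2) (at x)" for x
  proof -
    have "(E has_real_derivative \<mu> * (2 * poly p x * poly (pderiv p) x)
        + ((- 2 * x) * (poly (pderiv p) x)\<^sup>2 + (1 - x\<^sup>2) * (2 * poly (pderiv p) x * poly (pderiv (pderiv p)) x))) (at x)"
      unfolding E_def[abs_def]
      by (auto intro!: derivative_eq_intros simp: algebra_simps)
    moreover have "\<mu> * (2 * poly p x * poly (pderiv p) x)
        + ((- 2 * x) * (poly (pderiv p) x)\<^sup>2 + (1 - x\<^sup>2) * (2 * poly (pderiv p) x * poly (pderiv (pderiv p)) x))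
        = 2 * poly (pderiv p) x * (\<mu> * poly p x - (x\<^sup>2 - 1) * poly (pderiv (pderiv p)) x - x * poly (pderiv p) x)"
      by (simp add: algebra_simps power2_eq_square)
    moreover have "\<dots> = (4 * \<beta> + 2) * x * (poly (pderiv p) x)\<^sup>2"
      unfolding ode[symmetric] by (simp add: algebra_simps power2_eq_square)
    ultimately show ?thesis by simp
  qed
  have mono: "E x \<le> E 1" if "x \<in> {0..1}" for x
  proof (rule DERIV_nonneg_imp_nondecreasing[of x 1 E])
    fix t assume "x \<le> t" "t \<le> 1"
    then have "0 \<le> (4 * \<beta> + 2) * t * (poly (pderiv p) t)\<^sup>2" using that \<beta> by simp
    then show "\<exists>y. (E has_real_derivative y) (at t) \<and> 0 \<le> y" using dE by blast
  qed (use that in simp)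
  have E1: "E 1 = \<mu> * (poly p 1)\<^sup>2" by (simp add: E_def)
  have E2: "\<mu> * (poly p x)\<^sup>2 + (1 - x\<^sup>2) * (poly (pderiv p) x)\<^sup>2 \<le> \<mu> * (poly p 1)\<^sup>2" if "x \<in> {0..1}" for x
    using mono[OF that] unfolding E1 by (simp add: E_def)
  show ?thesis
  proof (cases "\<mu> = 0")
    case True
    have "poly (pderiv p) x = 0" if "x \<in> {0<..<1}" for x
    proof -
      have "(1 - x\<^sup>2) * (poly (pderiv p) x)\<^sup>2 \<le> 0" using E2[of x] that True by simp
      moreover have "0 < 1 - x\<^sup>2" using that by (simp add: abs_square_less_1)
      ultimately have "(poly (pderiv p) x)\<^sup>2 \<le> 0" by (simp add: mult_le_0_iff)
      then show ?thesis by simp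
    qed
    then have "{0<..<1} \<subseteq> {x. poly (pderiv p) x = 0}" by auto
    moreover have "infinite {0<..<1::real}" by (simp add: infinite_Ioo)
    ultimately have "pderiv p = 0" using poly_roots_finite infinite_super by blast
    then obtain a where "p = [:a:]" using pderiv_iszero by blast
    then show ?thesis by simp
  next
    case False
    have "0 \<le> (1 - x\<^sup>2) * (poly (pderiv p) x)\<^sup>2" using x by (simp add: abs_square_le_1)
    then have "\<mu> * (poly p x)\<^sup>2 \<le> \<mu> * (poly p 1)\<^sup>2" using E2[OF x] by linarith
    then show ?thesis using False \<mu> by (simp add: abs_le_square_iff)
  qed
qed

lemma gegen_op_reflect:
  assumes "gegen_op \<beta> p = smult \<mu> p"
  shows "gegen_op \<beta> (pcompose p [:0, -1:]) = smult \<mu> (pcompose p [:0, -1:])"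
proof (rule poly_ext)
  fix x
  have "(x\<^sup>2 - 1) * poly (pderiv (pderiv p)) (- x) + 2 * (\<beta> + 1) * (- x) * poly (pderiv p) (- x) = \<mu> * poly p (- x)"
    using arg_cong[OF assms, of "\<lambda>p. poly p (- x)"] unfolding poly_gegen_op by simp
  then show "poly (gegen_op \<beta> (pcompose p [:0, -1:])) x = poly (smult \<mu> (pcompose p [:0, -1:])) x"
    unfolding poly_gegen_op
    by (simp add: pderiv_pcompose poly_pcompose pderiv_pCons pderiv_mult pderiv_minus algebra_simps)
qed

lemma gegen_op_sup:
  assumes \<beta>: "0 \<le> \<beta>" and p: "gegen_op \<beta> p = smult \<mu> p" and \<mu>: "0 \<le> \<mu>" and x: "x \<in> {-1..1}"
  shows "\<bar>poly p x\<bar> \<le> max \<bar>poly p 1\<bar> \<bar>poly p (-1)\<bar>"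
proof (cases "0 \<le> x")
  case True
  then show ?thesis using gegen_op_sup_right[OF \<beta> p \<mu>, of x] x by simp
next
  case False
  then show ?thesis using gegen_op_sup_right[OF \<beta> gegen_op_reflect[OF p] \<mu>, of "- x"] x
    by (simp add: poly_pcompose)
qed

lemma gegen_op_higher_pderiv:
  "gegen_op (\<beta> + real j) ((pderiv ^^ j) (gpoly \<beta> k))
     = smult ((real k - real j) * (real k + real j + 2 * \<beta> + 1)) ((pderiv ^^ j) (gpoly \<beta> k))"
proof (induction j)
  case 0
  show ?case by (simp add: gegen_op_gpoly gegen_eigenvalue_def)
next
  case (Suc j)
  show ?case using gegen_op_pderiv[OF Suc] by (simp add: algebra_simps)
qed

lemma higher_pderiv_gpoly_0:
  assumes "0 \<le> \<beta>" "k < j"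
  shows "(pderiv ^^ j) (gpoly \<beta> k) = 0"
proof -
  have "(pderiv ^^ j) p = 0" if "degree p < j" for p :: "real poly" using that
  proof (induction j arbitrary: p)
    case (Suc j)
    show ?case
    proof (cases "degree p = 0")
      case True
      then have "pderiv p = 0" by (simp add: pderiv_eq_0_iff)
      then show ?thesis by (simp add: funpow_swap1)
    next
      case False
      then have "degree (pderiv p) < j" using Suc.prems by (simp add: degree_pderiv)
      then show ?thesis using Suc.IH by (simp add: funpow_swap1)
    qed
  qed simp
  then show ?thesis using assms degree_gpoly by simp
qed

lemma endpoint_derivative_bound:
  assumes "0 \<le> \<beta>" "gegen_op \<beta> p = smult \<mu> p" "0 \<le> \<mu>" "s = 1 \<or> s = -1"
  shows "\<bar>poly (pderiv p) s\<bar> \<le> \<mu> / 2 * \<bar>poly p s\<bar>"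
proof -
  have "2 * (\<beta> + 1) * s * poly (pderiv p) s = \<mu> * poly p s"
    using arg_cong[OF assms(2), of "\<lambda>p. poly p s"] assms(4) unfolding poly_gegen_op by auto
  then have "\<bar>2 * (\<beta> + 1) * s * poly (pderiv p) s\<bar> = \<bar>\<mu> * poly p s\<bar>" by simp
  then have "2 * (\<beta> + 1) * \<bar>poly (pderiv p) s\<bar> = \<mu> * \<bar>poly p s\<bar>"
    using assms(1,3,4) by (auto simp: abs_mult)
  moreover have "2 * \<bar>poly (pderiv p) s\<bar> \<le> 2 * (\<beta> + 1) * \<bar>poly (pderiv p) s\<bar>"
    using assms(1) by (intro mult_right_mono) auto
  ultimately show ?thesis by simp
qed

lemma gegen_reflect: "pcompose (gegen \<beta> k) [:0, -1:] = smult ((-1) ^ k) (gegen \<beta> k)"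
proof (induction k)
  case (Suc k)
  have v: "poly (gegen \<beta> k) (- x) = (-1) ^ k * poly (gegen \<beta> k) x" for x
    using arg_cong[OF Suc, of "\<lambda>p. poly p x"] by (simp add: poly_pcompose)
  have d: "poly (pderiv (gegen \<beta> k)) (- x) = - ((-1) ^ k * poly (pderiv (gegen \<beta> k)) x)" for x
    using arg_cong[OF arg_cong[OF Suc, of pderiv], of "\<lambda>p. poly p x"]
    by (simp add: poly_pcompose pderiv_pcompose pderiv_pCons pderiv_smult)
  show ?case
    by (rule poly_ext) (simp add: poly_pcompose v d algebra_simps)
qed (simp add: pcompose_1)

text \<open>
  The diagonal \<open>\<Lambda>\<close>; adding \<open>1\<close> makes it invertible also at \<open>k = 0\<close>.
\<close>

definition gweight :: "real \<Rightarrow> nat \<Rightarrow> real" where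
  "gweight \<beta> k = gegen_eigenvalue \<beta> k + 1"

lemma gweight_ge: "0 \<le> \<beta> \<Longrightarrow> (real k)\<^sup>2 + 1 \<le> gweight \<beta> k"
  unfolding gweight_def gegen_eigenvalue_def power2_eq_square by (simp add: algebra_simps)

lemma gweight_ge_1: "0 \<le> \<beta> \<Longrightarrow> 1 \<le> gweight \<beta> k"
  using gweight_ge[of \<beta> k] zero_le_power2[of "real k"] by linarith

lemma higher_eigenvalue_bounds:
  assumes "0 \<le> \<beta>" "j \<le> k"
  shows "0 \<le> (real k - real j) * (real k + real j + 2 * \<beta> + 1)"
    "(real k - real j) * (real k + real j + 2 * \<beta> + 1) \<le> gweight \<beta> k"
proof -
  show "0 \<le> (real k - real j) * (real k + real j + 2 * \<beta> + 1)" using assms by simp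
  have "gweight \<beta> k - (real k - real j) * (real k + real j + 2 * \<beta> + 1) = 1 + real j * (real j + 2 * \<beta> + 1)"
    by (simp add: gweight_def gegen_eigenvalue_def algebra_simps)
  moreover have "0 \<le> real j * (real j + 2 * \<beta> + 1)" using assms by simp
  ultimately show "(real k - real j) * (real k + real j + 2 * \<beta> + 1) \<le> gweight \<beta> k" by linarith
qed

text \<open>
  Each derivative of \<open>gpoly \<beta> k\<close> solves an equation of the same kind. Its maximum is therefore
  attained at an end point, where the equation degenerates to a relation between the
  derivative and the value.
\<close>

lemma gpoly_higher_sup:
  assumes \<beta>: "0 \<le> \<beta>" and x: "x \<in> {-1..1}"
  shows "\<bar>poly ((pderiv ^^ j) (gpoly \<beta> k)) x\<bar>
    \<le> gweight \<beta> k ^ j * max \<bar>poly (gpoly \<beta> k) 1\<bar> \<bar>poly (gpoly \<beta> k) (-1)\<bar>"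
proof -
  let ?p = "\<lambda>j. (pderiv ^^ j) (gpoly \<beta> k)" and ?M = "max \<bar>poly (gpoly \<beta> k) 1\<bar> \<bar>poly (gpoly \<beta> k) (-1)\<bar>"
  have w: "1 \<le> gweight \<beta> k" by (rule gweight_ge_1[OF \<beta>])
  have M: "0 \<le> ?M" by simp
  have end_bound: "\<bar>poly (?p j) s\<bar> \<le> gweight \<beta> k ^ j * ?M" if s: "s = 1 \<or> s = -1" for s j
  proof (induction j)
    case 0 then show ?case using s by auto
  next
    case (Suc j)
    show ?case
    proof (cases "j \<le> k")
      case True
      let ?\<mu> = "(real k - real j) * (real k + real j + 2 * \<beta> + 1)"
      have "\<bar>poly (?p (Suc j)) s\<bar> \<le> ?\<mu> / 2 * \<bar>poly (?p j) s\<bar>"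
        using endpoint_derivative_bound[OF _ gegen_op_higher_pderiv higher_eigenvalue_bounds(1)[OF \<beta> True] s] \<beta> by simp
      also have "\<dots> \<le> gweight \<beta> k * (gweight \<beta> k ^ j * ?M)"
      proof (rule mult_mono)
        show "?\<mu> / 2 \<le> gweight \<beta> k" using higher_eigenvalue_bounds[OF \<beta> True] by linarith
      qed (use Suc w in auto)
      finally show ?thesis by (simp add: mult.assoc)
    next
      case False
      then have "?p (Suc j) = 0" by (intro higher_pderiv_gpoly_0[OF \<beta>]) simp
      then show ?thesis using w M by (simp only: poly_0 abs_zero) (intro mult_nonneg_nonneg, auto)
    qed
  qed
  show ?thesis
  proof (cases "j \<le> k")
    case True
    have "\<bar>poly (?p j) x\<bar> \<le> max \<bar>poly (?p j) 1\<bar> \<bar>poly (?p j) (-1)\<bar>"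
      using gegen_op_sup[OF _ gegen_op_higher_pderiv higher_eigenvalue_bounds(1)[OF \<beta> True] x] \<beta> by simp
    then show ?thesis using end_bound[of 1 j] end_bound[of "-1" j] by linarith
  next
    case False
    then have "?p j = 0" by (intro higher_pderiv_gpoly_0[OF \<beta>]) simp
    then show ?thesis using w M by (simp only: poly_0 abs_zero) (intro mult_nonneg_nonneg, auto)
  qed
qed

text \<open>
  On an interval of length about \<open>1 / \<mu>\<close> next to the end point, the polynomial keeps half of its
  value there. The norm \<open>1\<close> then limits this value by a power of \<open>\<mu>\<close>.
\<close>

lemma endpoint_value_bound:
  fixes p :: "real poly"
  assumes \<beta>: "0 \<le> \<beta>" and \<mu>: "0 \<le> \<mu>"
    and d: "\<And>x. x \<in> {0..1} \<Longrightarrow> \<bar>poly (pderiv p) x\<bar> \<le> \<mu> / 2 * \<bar>poly p 1\<bar>"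
    and n: "(\<integral>x. poly p x * poly p x \<partial>weighted_measure \<beta>) = 1"
  shows "(poly p 1)\<^sup>2 \<le> 4 * (2 * (\<mu> + 1)) powr (\<beta> + 1)"
proof -
  \<comment> \<open>on \<open>[1 - e, 1]\<close> the derivative bound lets \<open>p\<close> lose at most half of \<open>p(1)\<close>\<close>
  define e where "e = 1 / (\<mu> + 1)"
  have e: "0 < e" "e \<le> 1" "e * \<mu> \<le> 1" using \<mu> by (auto simp: e_def field_simps)
  \<comment> \<open>lower bound of the integrand on the left half \<open>[1 - e, 1 - e / 2]\<close>, where the weight is not small\<close>
  define c where "c = (poly p 1)\<^sup>2 / 4 * (e / 2) powr \<beta>"
  have low: "\<bar>poly p 1\<bar> / 2 \<le> \<bar>poly p x\<bar>" if x: "x \<in> {1 - e..1}" for x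
  proof (cases "x < 1")
    case True
    obtain z where z: "x < z" "z < 1" "poly p 1 - poly p x = (1 - x) * poly (pderiv p) z"
      using MVT2[OF True, of "poly p" "poly (pderiv p)"] poly_DERIV by blast
    have "\<bar>poly (pderiv p) z\<bar> \<le> \<mu> / 2 * \<bar>poly p 1\<bar>" using z x e by (intro d) auto
    then have "(1 - x) * \<bar>poly (pderiv p) z\<bar> \<le> e * (\<mu> / 2 * \<bar>poly p 1\<bar>)"
      using x True e \<mu> by (intro mult_mono) auto
    also have "\<dots> = (e * \<mu>) * (\<bar>poly p 1\<bar> / 2)" by simp
    also have "\<dots> \<le> 1 * (\<bar>poly p 1\<bar> / 2)" using e by (intro mult_right_mono) auto
    finally have "\<bar>poly p 1 - poly p x\<bar> \<le> \<bar>poly p 1\<bar> / 2" using z(3) True by (simp add: abs_mult)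
    then show ?thesis by linarith
  qed (use x in auto)
  have pp: "(\<lambda>x. poly p x * poly p x) = poly (p * p)" by auto
  have int: "integrable (lebesgue_on {-1..1}) (\<lambda>x. jacobi_weight \<beta> x *\<^sub>R poly (p * p) x)"
    using integral_weighted(2)[OF poly_measurable, of \<beta> "p * p"] poly_integrable[OF \<beta>, of "p * p"] by blast
  have "(\<integral>x. indicator {1 - e..1 - e / 2} x *\<^sub>R c \<partial>lebesgue_on {-1..1})
      \<le> (\<integral>x. jacobi_weight \<beta> x *\<^sub>R poly (p * p) x \<partial>lebesgue_on {-1..1})"
  proof (rule integral_mono[OF _ int])
    show "integrable (lebesgue_on {-1..1}) (\<lambda>x. indicator {1 - e..1 - e / 2} x *\<^sub>R c)"
      using e by (intro integrable_scaleR_left integrable_real_indicator)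
        (auto simp: sets_restrict_space_iff emeasure_restrict_space)
    fix x :: real assume xs: "x \<in> space (lebesgue_on {-1..1})"
    show "indicator {1 - e..1 - e / 2} x *\<^sub>R c \<le> jacobi_weight \<beta> x *\<^sub>R poly (p * p) x"
    proof (cases "x \<in> {1 - e..1 - e / 2}")
      case True
      have "(\<bar>poly p 1\<bar> / 2)\<^sup>2 \<le> \<bar>poly p x\<bar>\<^sup>2" using low[of x] True e by (intro power_mono) auto
      then have 1: "(poly p 1)\<^sup>2 / 4 \<le> poly (p * p) x" by (simp add: power_divide power2_eq_square)
      have "x * x \<le> x * 1" using True e by (intro mult_left_mono) auto
      then have "e / 2 \<le> 1 - x\<^sup>2" using True by (simp add: power2_eq_square)
      then have 2: "(e / 2) powr \<beta> \<le> jacobi_weight \<beta> x"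
        unfolding jacobi_weight_def using e \<beta> by (intro powr_mono2) auto
      have "(e / 2) powr \<beta> * ((poly p 1)\<^sup>2 / 4) \<le> jacobi_weight \<beta> x * poly (p * p) x"
        by (rule mult_mono[OF 2 1]) auto
      then show ?thesis using True by (simp add: c_def mult.commute)
    qed simp
  qed
  also have "\<dots> = 1"
    unfolding integral_weighted(1)[OF poly_measurable, symmetric] unfolding pp[symmetric] by (rule n)
  also have "(\<integral>x. indicator {1 - e..1 - e / 2} x *\<^sub>R c \<partial>lebesgue_on {-1..1}) = e / 2 * c"
  proof -
    have "measure (lebesgue_on {-1..1}) {1 - e..1 - e / 2} = e / 2"
      using e by (subst measure_restrict_space) auto
    then show ?thesis using e
      by (subst integral_scaleR_left) (auto simp: sets_restrict_space_iff emeasure_restrict_space intro!: integrable_real_indicator)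
  qed
  finally have "e / 2 * c \<le> 1" .
  then have "(poly p 1)\<^sup>2 * ((e / 2) powr \<beta> * (e / 2)) \<le> 4" by (simp add: c_def field_simps)
  also have "(e / 2) powr \<beta> * (e / 2) = (e / 2) powr (\<beta> + 1)" using e by (simp add: powr_add)
  also have "(e / 2) powr (\<beta> + 1) = 1 / (2 * (\<mu> + 1)) powr (\<beta> + 1)"
  proof -
    have e2: "e / 2 = 1 / (2 * (\<mu> + 1))" by (simp add: e_def)
    have "(e / 2) powr (\<beta> + 1) = 1 powr (\<beta> + 1) / (2 * (\<mu> + 1)) powr (\<beta> + 1)"
      unfolding e2 by (rule powr_divide)
    then show ?thesis by (simp only: powr_one_eq_one)
  qed
  finally have "(poly p 1)\<^sup>2 * (1 / (2 * (\<mu> + 1)) powr (\<beta> + 1)) \<le> 4" .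
  moreover have "0 < (2 * (\<mu> + 1)) powr (\<beta> + 1)" using \<mu> by simp
  ultimately show ?thesis by (simp only: divide_le_eq times_divide_eq_right mult_1_right if_True)
qed

text \<open>
  Polynomial growth in \<open>k\<close> of the polynomials and their derivatives; any power will do, since
  it is played against sequences that decay faster than all powers.
\<close>

lemma gpoly_sup_bound:
  assumes \<beta>: "0 \<le> \<beta>"
  shows "\<exists>C D. 0 \<le> C \<and> (\<forall>k j. \<forall>x\<in>{-1..1}. \<bar>poly ((pderiv ^^ j) (gpoly \<beta> k)) x\<bar> \<le> C * gweight \<beta> k ^ (D + j))"
proof -
  define D where "D = nat \<lceil>\<beta> + 1\<rceil>"
  define C where "C = 2 * 2 powr (\<beta> + 1)"
  have C1: "1 \<le> 2 powr (\<beta> + 1)" using \<beta> by (intro ge_one_powr_ge_zero) auto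
  have key: "\<bar>poly p 1\<bar> \<le> C * gweight \<beta> k ^ D"
    if p: "p = gpoly \<beta> k \<or> p = pcompose (gpoly \<beta> k) [:0, -1:]"
      and n: "(\<integral>x. poly p x * poly p x \<partial>weighted_measure \<beta>) = 1" for p k
  proof -
    let ?\<mu> = "gegen_eigenvalue \<beta> k"
    have \<mu>: "0 \<le> ?\<mu>" using \<beta> by (simp add: gegen_eigenvalue_def)
    have pe: "gegen_op \<beta> p = smult ?\<mu> p"
      using p gegen_op_gpoly gegen_op_reflect by metis
    have d: "\<bar>poly (pderiv p) x\<bar> \<le> ?\<mu> / 2 * \<bar>poly p 1\<bar>" if x: "x \<in> {0..1}" for x
    proof (cases "k = 0")
      case True
      have "degree p = 0" using p degree_gpoly[OF \<beta>, of k] True by (auto simp: degree_pcompose)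
      then have "pderiv p = 0" by (simp add: pderiv_eq_0_iff)
      then show ?thesis using \<mu> by simp
    next
      case False
      have "0 \<le> (real k - 1) * (real k + 1 + 2 * \<beta> + 1)" using False \<beta> by (intro mult_nonneg_nonneg) auto
      then have "0 \<le> ?\<mu> - 2 * (\<beta> + 1)" by (simp add: gegen_eigenvalue_def algebra_simps)
      then have "\<bar>poly (pderiv p) x\<bar> \<le> \<bar>poly (pderiv p) 1\<bar>"
        using gegen_op_sup_right[OF _ gegen_op_pderiv[OF pe] _ x] \<beta> by simp
      also have "\<dots> \<le> ?\<mu> / 2 * \<bar>poly p 1\<bar>" using endpoint_derivative_bound[OF \<beta> pe \<mu>, of 1] by simp
      finally show ?thesis .
    qed
    have g1: "1 \<le> gweight \<beta> k" by (rule gweight_ge_1[OF \<beta>])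
    have "(poly p 1)\<^sup>2 \<le> 4 * (2 * gweight \<beta> k) powr (\<beta> + 1)"
      using endpoint_value_bound[OF \<beta> \<mu> d n] by (simp add: gweight_def)
    also have "(2 * gweight \<beta> k) powr (\<beta> + 1) = 2 powr (\<beta> + 1) * gweight \<beta> k powr (\<beta> + 1)"
      using g1 by (simp add: powr_mult)
    also have "gweight \<beta> k powr (\<beta> + 1) \<le> gweight \<beta> k powr real D"
      using g1 \<beta> by (intro powr_mono) (auto simp: D_def)
    also have "\<dots> = gweight \<beta> k ^ D" using g1 by (simp add: powr_realpow)
    finally have 1: "(poly p 1)\<^sup>2 \<le> 4 * (2 powr (\<beta> + 1) * gweight \<beta> k ^ D)" using C1 by simp
    have "1 * 1 \<le> 2 powr (\<beta> + 1) * gweight \<beta> k ^ D" using C1 g1 by (intro mult_mono) auto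
    then have "(2 powr (\<beta> + 1) * gweight \<beta> k ^ D) * 1 \<le> (2 powr (\<beta> + 1) * gweight \<beta> k ^ D)\<^sup>2"
      unfolding power2_eq_square by (intro mult_left_mono) auto
    with 1 have "(poly p 1)\<^sup>2 \<le> (C * gweight \<beta> k ^ D)\<^sup>2" by (simp add: C_def power_mult_distrib)
    moreover have "0 \<le> C * gweight \<beta> k ^ D" using g1 by (simp add: C_def)
    ultimately show ?thesis using abs_le_square_iff[of "poly p 1" "C * gweight \<beta> k ^ D"] by simp
  qed
  have n: "(\<integral>x. poly (gpoly \<beta> k) x * poly (gpoly \<beta> k) x \<partial>weighted_measure \<beta>) = 1" for k
    using gpoly_orthonormal[OF \<beta>, of k k] by simp
  have parity: "pcompose (gpoly \<beta> k) [:0, -1:] = smult ((-1) ^ k) (gpoly \<beta> k)" for k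
    by (simp add: gpoly_def pcompose_smult gegen_reflect)
  have n': "(\<integral>x. poly (pcompose (gpoly \<beta> k) [:0, -1:]) x * poly (pcompose (gpoly \<beta> k) [:0, -1:]) x \<partial>weighted_measure \<beta>) = 1" for k
    unfolding parity using n[of k] by (simp add: mult.left_commute mult.assoc flip: power_mult_distrib)
  have m: "max \<bar>poly (gpoly \<beta> k) 1\<bar> \<bar>poly (gpoly \<beta> k) (-1)\<bar> \<le> C * gweight \<beta> k ^ D" for k
    using key[OF _ n[of k]] key[OF _ n'[of k]] by (simp add: poly_pcompose)
  have "\<bar>poly ((pderiv ^^ j) (gpoly \<beta> k)) x\<bar> \<le> C * gweight \<beta> k ^ (D + j)" if "x \<in> {-1..1}" for k j x
  proof -
    have "\<bar>poly ((pderiv ^^ j) (gpoly \<beta> k)) x\<bar> \<le> gweight \<beta> k ^ j * (C * gweight \<beta> k ^ D)"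
      using order_trans[OF gpoly_higher_sup[OF \<beta> that] mult_left_mono[OF m]] gweight_ge_1[OF \<beta>, of k] by simp
    then show ?thesis by (simp add: power_add mult_ac)
  qed
  moreover have "0 \<le> C" by (simp add: C_def)
  ultimately show ?thesis by blast
qed

section \<open>The operator in Gegenbauer coordinates\<close>

lemma rinner_sum_gpoly:
  assumes "0 \<le> \<beta>" "k \<le> n"
  shows "rinner \<beta> (\<lambda>x. \<Sum>j\<le>n. a j * poly (gpoly \<beta> j) x) (poly (gpoly \<beta> k)) = a k"
proof -
  have "rinner \<beta> (\<lambda>x. \<Sum>j\<le>n. a j * poly (gpoly \<beta> j) x) (poly (gpoly \<beta> k))
      = (\<Sum>j\<le>n. a j * rinner \<beta> (poly (gpoly \<beta> j)) (poly (gpoly \<beta> k)))"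
    by (simp add: rinner_sum_left rL2_cmult rL2_poly assms(1) rinner_cmult_left)
  also have "\<dots> = (\<Sum>j\<le>n. if j = k then a k else 0)"
    by (intro sum.cong) (auto simp: rinner_def gpoly_orthonormal[OF assms(1)])
  also have "\<dots> = a k" using assms(2) by simp
  finally show ?thesis .
qed

lemma poly_expand_gpoly:
  assumes \<beta>: "0 \<le> \<beta>" and d: "degree q \<le> n"
  shows "poly q x = (\<Sum>j\<le>n. rinner \<beta> (poly q) (poly (gpoly \<beta> j)) * poly (gpoly \<beta> j) x)"
proof -
  obtain a where a: "q = (\<Sum>j\<le>n. smult (a j) (gpoly \<beta> j))"
    using poly_in_span_gpoly[OF \<beta> d] by blast
  have qx: "poly q = (\<lambda>x. \<Sum>j\<le>n. a j * poly (gpoly \<beta> j) x)"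
    unfolding a by (simp add: poly_sum fun_eq_iff)
  have "rinner \<beta> (poly q) (poly (gpoly \<beta> j)) = a j" if "j \<le> n" for j
    unfolding qx by (rule rinner_sum_gpoly[OF \<beta> that])
  then show ?thesis by (simp add: qx)
qed

definition xsq_matrix :: "real \<Rightarrow> nat \<Rightarrow> nat \<Rightarrow> real" where
  "xsq_matrix \<beta> k j = rinner \<beta> (\<lambda>x. x\<^sup>2 * poly (gpoly \<beta> j) x) (poly (gpoly \<beta> k))"

lemma xsq_poly: "(\<lambda>x. x\<^sup>2 * poly (p :: real poly) x) = poly ([:0, 0, 1:] * p)"
  by (simp add: fun_eq_iff power2_eq_square mult.assoc)

lemma degree_xsq_gpoly: "0 \<le> \<beta> \<Longrightarrow> degree ([:0, 0, 1:] * gpoly \<beta> k) \<le> k + 2"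
  using degree_mult_le[of "[:0, 0, 1:]" "gpoly \<beta> k"] by (simp add: degree_gpoly)

lemma xsq_matrix_sym: "xsq_matrix \<beta> k j = xsq_matrix \<beta> j k"
  by (simp add: xsq_matrix_def rinner_def mult_ac)

lemma xsq_expand:
  assumes \<beta>: "0 \<le> \<beta>"
  shows "x\<^sup>2 * poly (gpoly \<beta> k) x = (\<Sum>j\<le>k + 2. xsq_matrix \<beta> j k * poly (gpoly \<beta> j) x)"
  using poly_expand_gpoly[OF \<beta> degree_xsq_gpoly[OF \<beta>, of k], of x]
  unfolding xsq_poly[symmetric] xsq_matrix_def
  by (simp only: xsq_poly[symmetric] fun_cong[OF xsq_poly[symmetric]])

lemma xsq_matrix_band:
  assumes \<beta>: "0 \<le> \<beta>"
  shows "band_matrix (xsq_matrix \<beta>) 1"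
proof -
  have far: "xsq_matrix \<beta> j k = 0" if "k + 2 < j" for j k
  proof -
    have "xsq_matrix \<beta> j k = rinner \<beta> (\<lambda>x. \<Sum>i\<le>k + 2. xsq_matrix \<beta> i k * poly (gpoly \<beta> i) x) (poly (gpoly \<beta> j))"
      unfolding xsq_expand[OF \<beta>, symmetric] by (rule xsq_matrix_def)
    also have "\<dots> = (\<Sum>i\<le>k + 2. xsq_matrix \<beta> i k * rinner \<beta> (poly (gpoly \<beta> i)) (poly (gpoly \<beta> j)))"
      by (subst rinner_sum_left) (auto simp: rL2_cmult rL2_poly \<beta> rinner_cmult_left)
    also have "\<dots> = 0"
      using that by (intro sum.neutral) (auto simp: rinner_def gpoly_orthonormal[OF \<beta>])
    finally show ?thesis .
  qed
  have bd: "\<bar>xsq_matrix \<beta> k j\<bar> \<le> 1" for k j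
  proof -
    let ?p = "poly (gpoly \<beta> j)" and ?q = "poly (gpoly \<beta> k)"
    have L: "?p \<in> rL2 \<beta>" "?q \<in> rL2 \<beta>" "(\<lambda>x. x\<^sup>2 * ?p x) \<in> rL2 \<beta>"
      unfolding xsq_poly by (auto intro: rL2_poly \<beta>)
    have "\<bar>xsq_matrix \<beta> k j\<bar> \<le> (\<integral>x. \<bar>(x\<^sup>2 * ?p x) * ?q x\<bar> \<partial>weighted_measure \<beta>)"
      unfolding xsq_matrix_def rinner_def by (rule integral_abs_bound)
    also have "\<dots> \<le> (\<integral>x. (?p x * ?p x + ?q x * ?q x) / 2 \<partial>weighted_measure \<beta>)"
    proof (rule integral_mono)
      show "integrable (weighted_measure \<beta>) (\<lambda>x. \<bar>(x\<^sup>2 * ?p x) * ?q x\<bar>)"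
        by (intro integrable_abs rL2_product_integrable L)
      show "integrable (weighted_measure \<beta>) (\<lambda>x. (?p x * ?p x + ?q x * ?q x) / 2)"
        by (intro integrable_divide Bochner_Integration.integrable_add rL2_product_integrable L)
      fix x :: real assume "x \<in> space (weighted_measure \<beta>)"
      then have "x\<^sup>2 \<le> 1" by (simp add: abs_square_le_1 abs_le_iff)
      then have "x\<^sup>2 * (\<bar>?p x\<bar> * \<bar>?q x\<bar>) \<le> \<bar>?p x\<bar> * \<bar>?q x\<bar>" by (simp add: mult_left_le_one_le)
      moreover have "0 \<le> (\<bar>?p x\<bar> - \<bar>?q x\<bar>)\<^sup>2" by simp
      then have "2 * (\<bar>?p x\<bar> * \<bar>?q x\<bar>) \<le> ?p x * ?p x + ?q x * ?q x"
        unfolding power2_diff power2_abs by (simp add: power2_eq_square)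
      ultimately show "\<bar>(x\<^sup>2 * ?p x) * ?q x\<bar> \<le> (?p x * ?p x + ?q x * ?q x) / 2"
        by (simp add: abs_mult mult.assoc)
    qed
    also have "\<dots> = (rinner \<beta> ?p ?p + rinner \<beta> ?q ?q) / 2"
      unfolding rinner_def by (simp add: Bochner_Integration.integral_add rL2_product_integrable L)
    also have "\<dots> = 1" by (simp add: rinner_def gpoly_orthonormal[OF \<beta>])
    finally show ?thesis .
  qed
  show ?thesis unfolding band_matrix_def using far bd xsq_matrix_sym by metis
qed

lemma xsq_matrix_nonneg:
  assumes \<beta>: "0 \<le> \<beta>"
  shows "0 \<le> (\<Sum>k<n. \<Sum>j<n. xsq_matrix \<beta> k j * y j * y k)"
proof -
  let ?p = "\<lambda>j. poly (gpoly \<beta> j)"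
  define f where "f = (\<lambda>x. \<Sum>j<n. y j * ?p j x)"
  have L: "?p j \<in> rL2 \<beta>" "(\<lambda>x. x\<^sup>2 * ?p j x) \<in> rL2 \<beta>" for j
    unfolding xsq_poly by (auto intro: rL2_poly \<beta>)
  have fL: "f \<in> rL2 \<beta>" unfolding f_def by (intro rL2_sum rL2_cmult L)
  have e: "(\<lambda>x. x\<^sup>2 * f x) = (\<lambda>x. \<Sum>j<n. y j * (x\<^sup>2 * ?p j x))"
    by (simp add: f_def sum_distrib_left mult_ac)
  have "rinner \<beta> (\<lambda>x. x\<^sup>2 * f x) f = (\<Sum>j<n. y j * rinner \<beta> (\<lambda>x. x\<^sup>2 * ?p j x) f)"
    unfolding e by (simp add: rinner_sum_left rL2_cmult L fL rinner_cmult_left)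
  also have "\<dots> = (\<Sum>j<n. y j * (\<Sum>k<n. y k * xsq_matrix \<beta> k j))"
  proof (intro sum.cong refl arg_cong2[of _ _ _ _ "(*)"])
    fix j
    have "rinner \<beta> (\<lambda>x. x\<^sup>2 * ?p j x) f = rinner \<beta> f (\<lambda>x. x\<^sup>2 * ?p j x)" by (rule rinner_commute)
    also have "\<dots> = (\<Sum>k<n. y k * rinner \<beta> (?p k) (\<lambda>x. x\<^sup>2 * ?p j x))"
      unfolding f_def by (simp add: rinner_sum_left rL2_cmult L rinner_cmult_left)
    finally show "rinner \<beta> (\<lambda>x. x\<^sup>2 * ?p j x) f = (\<Sum>k<n. y k * xsq_matrix \<beta> k j)"
      by (simp add: xsq_matrix_def rinner_commute)
  qed
  also have "\<dots> = (\<Sum>k<n. \<Sum>j<n. xsq_matrix \<beta> k j * y j * y k)"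
    by (subst sum.swap) (simp add: sum_distrib_left mult_ac)
  finally have "(\<Sum>k<n. \<Sum>j<n. xsq_matrix \<beta> k j * y j * y k) = rinner \<beta> (\<lambda>x. x\<^sup>2 * f x) f" ..
  moreover have "0 \<le> rinner \<beta> (\<lambda>x. x\<^sup>2 * f x) f"
    unfolding rinner_def by (intro integral_nonneg_AE AE_I2) (simp add: mult.assoc)
  ultimately show ?thesis by simp
qed

text \<open>
  The coordinates in which the Sturm--Liouville operator plus \<open>1\<close> becomes the operator of
  \<open>discrete_spectrum\<close>.
\<close>

locale gpswf =
  fixes \<alpha> c :: real
  assumes alpha_pos: "0 < \<alpha>"
begin

abbreviation "lam \<equiv> gweight \<alpha>"
abbreviation "p k \<equiv> poly (gpoly \<alpha> k)"
abbreviation "Bmat \<equiv> (\<lambda>k j. c\<^sup>2 * xsq_matrix \<alpha> k j)"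

lemma alpha_nonneg [simp]: "0 \<le> \<alpha>" using alpha_pos by simp

lemma Bmat_band: "band_matrix Bmat (c\<^sup>2)"
proof -
  have "\<bar>xsq_matrix \<alpha> k j\<bar> \<le> 1" for k j using xsq_matrix_band[OF alpha_nonneg] by (simp add: band_matrix_def)
  then have "c\<^sup>2 * \<bar>xsq_matrix \<alpha> k j\<bar> \<le> c\<^sup>2 * 1" for k j by (intro mult_left_mono) auto
  then show ?thesis using xsq_matrix_band[OF alpha_nonneg] by (simp add: band_matrix_def abs_mult)
qed

lemma lam_mono: "i \<le> j \<Longrightarrow> lam i \<le> lam j"
  using gegen_eigenvalue_strict_mono[OF alpha_nonneg, of i j] by (cases "i = j") (auto simp: gweight_def)

sublocale discrete_spectrum lam "band_op Bmat"
proof (rule discrete_spectrum.intro)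
  show "1 \<le> lam k" for k by (rule gweight_ge_1) simp
  show "filterlim lam at_top sequentially"
  proof (rule filterlim_at_top_mono[OF filterlim_real_sequentially])
    have "real k \<le> lam k" for k
    proof -
      have "0 \<le> (real k - 1)\<^sup>2 + (real k)\<^sup>2" by simp
      then have "real k \<le> (real k)\<^sup>2 + 1" by (simp add: power2_eq_square algebra_simps)
      then show ?thesis using gweight_ge[OF alpha_nonneg, of k] by linarith
    qed
    then show "\<forall>\<^sub>F k in sequentially. real k \<le> lam k" by simp
  qed
  show "bounded_linear (band_op Bmat)" by (rule bounded_linear_band_op[OF Bmat_band])
  show "inner (band_op Bmat u) v = inner u (band_op Bmat v)" for u v
    by (rule band_op_symmetric[OF Bmat_band]) (simp add: xsq_matrix_sym)
  show "0 \<le> inner (band_op Bmat u) u" for u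
  proof (rule band_op_nonneg[OF Bmat_band])
    fix n and y :: "nat \<Rightarrow> real"
    have "(\<Sum>k<n. \<Sum>j<n. Bmat k j * y j * y k) = c\<^sup>2 * (\<Sum>k<n. \<Sum>j<n. xsq_matrix \<alpha> k j * y j * y k)"
      by (simp add: sum_distrib_left mult.assoc)
    then show "0 \<le> (\<Sum>k<n. \<Sum>j<n. Bmat k j * y j * y k)"
      using xsq_matrix_nonneg[OF alpha_nonneg, of y n] by simp
  qed
qed

lemma coord_T_power: "coord ((T ^^ m) u) k = coord u k / sqrt (lam k) ^ m"
  by (induction m) (simp_all add: divide_divide_eq_left mult.commute)

text \<open>
  Consecutive diagonal entries are comparable, so conjugating a band matrix with powers of the
  diagonal changes its entries by bounded factors only.
\<close>

lemma lam_ratio: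
  assumes "k \<le> j + 2"
  shows "lam k \<le> (4 * \<alpha> + 15) * lam j"
proof -
  have "lam k \<le> lam (j + 2)" by (rule lam_mono[OF assms])
  also have "lam (j + 2) = gegen_eigenvalue \<alpha> j + 4 * real j + 4 * \<alpha> + 7"
    by (simp add: gweight_def gegen_eigenvalue_def algebra_simps)
  also have "\<dots> \<le> lam j + 8 * lam j + (4 * \<alpha> + 6) * lam j"
  proof -
    have a: "1 \<le> lam j" by (rule gweight_ge_1) simp
    have "0 \<le> (real j - 1)\<^sup>2 + (real j)\<^sup>2" by simp
    then have "real j \<le> (real j)\<^sup>2 + 1" by (simp add: power2_eq_square algebra_simps)
    then have b: "real j \<le> lam j" using gweight_ge[OF alpha_nonneg, of j] by linarith
    have "(4 * \<alpha> + 6) * 1 \<le> (4 * \<alpha> + 6) * lam j" using a by (intro mult_left_mono) auto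
    moreover have "gegen_eigenvalue \<alpha> j \<le> lam j" by (simp add: gweight_def)
    moreover have "4 * real j \<le> 4 * lam j" using b by simp
    ultimately have "gegen_eigenvalue \<alpha> j + 4 * real j + ((4 * \<alpha> + 6) * 1 + 1)
        \<le> lam j + 4 * lam j + ((4 * \<alpha> + 6) * lam j + lam j)"
      using a by (intro add_mono)
    then show ?thesis using a by (simp add: algebra_simps)
  qed
  also have "\<dots> = (4 * \<alpha> + 15) * lam j" by (simp add: algebra_simps)
  finally show ?thesis .
qed

lemma B_conjugate: "\<exists>Bm \<beta>. \<forall>z. band_op Bmat ((T ^^ m) z) = (T ^^ m) (Bm z) \<and> norm (Bm z) \<le> \<beta> * norm z"
proof -
  define R where "R = 4 * \<alpha> + 15"
  define b where "b k j = Bmat k j * (sqrt (lam k) / sqrt (lam j)) ^ m" for k j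
  have R: "0 \<le> R" by (simp add: R_def)
  have bb: "band_matrix b (c\<^sup>2 * sqrt R ^ m)"
    unfolding band_matrix_def
  proof (intro conjI allI impI)
    fix k j
    show z: "b k j = 0" if "k + 2 < j \<or> j + 2 < k"
      using xsq_matrix_band[OF alpha_nonneg] that unfolding band_matrix_def b_def
      by (metis mult_zero_left mult_zero_right)
    show "\<bar>b k j\<bar> \<le> c\<^sup>2 * sqrt R ^ m"
    proof (cases "k + 2 < j \<or> j + 2 < k")
      case True
      then show ?thesis using z R by simp
    next
      case False
      then have "lam k \<le> R * lam j" unfolding R_def by (intro lam_ratio) simp
      then have "lam k / lam j \<le> R" by (simp add: divide_le_eq)
      then have "sqrt (lam k) / sqrt (lam j) \<le> sqrt R" by (simp flip: real_sqrt_divide)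
      then have "(sqrt (lam k) / sqrt (lam j)) ^ m \<le> sqrt R ^ m" by (intro power_mono) auto
      moreover have "\<bar>Bmat k j\<bar> \<le> c\<^sup>2" using Bmat_band by (simp add: band_matrix_def)
      ultimately show ?thesis unfolding b_def abs_mult
        by (intro mult_mono) (auto simp: power_abs)
    qed
  qed
  have "band_op Bmat ((T ^^ m) z) = (T ^^ m) (band_op b z)" for z
  proof (rule ell2_eqI)
    fix k
    have "b k j * coord z j / sqrt (lam k) ^ m = Bmat k j * (coord z j / sqrt (lam j) ^ m)" for j
      by (simp add: b_def power_divide)
    then show "coord (band_op Bmat ((T ^^ m) z)) k = coord ((T ^^ m) (band_op b z)) k"
      unfolding coord_T_power band_op_bound(1)[OF bb] band_op_bound(1)[OF Bmat_band] sum_divide_distrib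
      by (simp only:)
  qed
  moreover have "norm (band_op b z) \<le> 5 * (c\<^sup>2 * sqrt R ^ m) * norm z" for z
    by (rule band_op_bound(2)[OF bb])
  ultimately show ?thesis by blast
qed

lemmas approx_rate = proj_compl_rate[OF B_conjugate]
lemmas eigen_regular = eigen_smooth[OF B_conjugate]

end

section \<open>Bounded eigenfunctions: vanishing flux and simplicity\<close>

text \<open>
  By the mean value theorem for \<open>f\<close>, between \<open>x\<close> and \<open>x + d / 2\<close> with \<open>d = 1 - x\<close> there is a
  point where \<open>f'\<close> is at most \<open>4 C / d\<close>; there the flux is at most a constant times
  \<open>d\<close> to the power \<open>a\<close>. As \<open>G\<close> is Lipschitz, its value at \<open>x\<close> differs by \<open>O(d)\<close>. So
  boundedness of \<open>f\<close> acts as the boundary condition, because \<open>a > 0\<close>.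
\<close>

lemma bounded_flux_vanishes_left:
  fixes f f' G G' :: "real \<Rightarrow> real"
  assumes a: "0 < a"
    and df: "\<And>x. x \<in> {-1<..<1} \<Longrightarrow> (f has_real_derivative f' x) (at x)"
    and G: "\<And>x. x \<in> {-1<..<1} \<Longrightarrow> G x = jacobi_weight (a + 1) x * f' x"
    and dG: "\<And>x. x \<in> {-1<..<1} \<Longrightarrow> (G has_real_derivative G' x) (at x)"
    and M: "\<And>x. x \<in> {-1<..<1} \<Longrightarrow> \<bar>G' x\<bar> \<le> M"
    and C: "\<And>x. x \<in> {-1<..<1} \<Longrightarrow> \<bar>f x\<bar> \<le> C"
  shows "(G \<longlongrightarrow> 0) (at_left 1)"
proof -
  have C0: "0 \<le> C" using C[of 0] by force
  have bound: "\<bar>G x\<bar> \<le> 8 * C * (2 * (1 - x)) powr a + M * (1 - x)" if x: "x \<in> {0<..<1}" for x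
  proof -
    define d where "d = 1 - x"
    have d: "0 < d" "x + d / 2 < 1" "x < x + d / 2" using x by (auto simp: d_def field_simps)
    have in_I: "t \<in> {-1<..<1}" if "x \<le> t" "t \<le> x + d / 2" for t using that x d by auto
    obtain z where z: "x < z" "z < x + d / 2" "f (x + d / 2) - f x = (x + d / 2 - x) * f' z"
      using MVT2[OF d(3), of f f'] df[OF in_I] by blast
    have zI: "z \<in> {-1<..<1}" using z by (intro in_I) auto
    have "d / 2 * \<bar>f' z\<bar> = \<bar>f (x + d / 2) - f x\<bar>" unfolding z(3) using d(1) by (simp add: abs_mult)
    also have "\<dots> \<le> 2 * C" using C[OF in_I[of x]] C[OF in_I[of "x + d / 2"]] d by (simp add: abs_le_iff)
    finally have f'z: "\<bar>f' z\<bar> \<le> 4 * C / d" using d(1) by (simp add: field_simps)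
    have "jacobi_weight (a + 1) z \<le> (2 * d) powr (a + 1)"
    proof -
      have "1 - z\<^sup>2 = (1 + z) * (1 - z)" by (simp add: power2_eq_square algebra_simps)
      also have "\<dots> \<le> 2 * d" using zI z by (intro mult_mono) (auto simp: d_def)
      finally have "1 - z\<^sup>2 \<le> 2 * d" .
      moreover have "0 \<le> 1 - z\<^sup>2" using zI by (simp add: abs_square_le_1 abs_le_iff)
      ultimately show ?thesis unfolding jacobi_weight_def using a by (intro powr_mono2) auto
    qed
    then have "\<bar>G z\<bar> \<le> (2 * d) powr (a + 1) * (4 * C / d)"
      unfolding G[OF zI] abs_mult using f'z C0 d(1) by (intro mult_mono) auto
    also have "\<dots> = 8 * C * (2 * d) powr a" using d(1) by (simp add: powr_add)
    finally have Gz: "\<bar>G z\<bar> \<le> 8 * C * (2 * d) powr a" .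
    obtain t where t: "x < t" "t < z" "G z - G x = (z - x) * G' t"
      using MVT2[OF z(1), of G G'] dG in_I z(2) by (metis less_eq_real_def order_trans)
    have "\<bar>G z - G x\<bar> = (z - x) * \<bar>G' t\<bar>" using t z(1) by (simp add: abs_mult)
    also have "\<dots> \<le> d * M"
    proof (rule mult_mono)
      show "z - x \<le> d" using z d by simp
      show "\<bar>G' t\<bar> \<le> M" using t z by (intro M in_I) auto
    qed (use d in auto)
    finally show ?thesis using Gz by (simp add: d_def mult.commute) 
  qed
  have "((\<lambda>x. 8 * C * (2 * (1 - x)) powr a + M * (1 - x)) \<longlongrightarrow> 8 * C * (2 * (1 - 1)) powr a + M * (1 - 1)) (at_left 1)"
    using a eventually_at_left_real[of 0 "1::real"]
    by (intro tendsto_intros tendsto_powr') (auto elim!: eventually_mono)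
  then have lim: "((\<lambda>x. 8 * C * (2 * (1 - x)) powr a + M * (1 - x)) \<longlongrightarrow> 0) (at_left 1)" by simp
  show ?thesis
  proof (rule Lim_null_comparison[OF _ lim])
    show "\<forall>\<^sub>F x in at_left 1. norm (G x) \<le> 8 * C * (2 * (1 - x)) powr a + M * (1 - x)"
      by (rule eventually_mono[OF eventually_at_left_real[of 0 "1::real"]]) (use bound in auto)
  qed
qed

lemma bounded_flux_vanishes_right:
  fixes f f' G G' :: "real \<Rightarrow> real"
  assumes a: "0 < a"
    and df: "\<And>x. x \<in> {-1<..<1} \<Longrightarrow> (f has_real_derivative f' x) (at x)"
    and G: "\<And>x. x \<in> {-1<..<1} \<Longrightarrow> G x = jacobi_weight (a + 1) x * f' x"
    and dG: "\<And>x. x \<in> {-1<..<1} \<Longrightarrow> (G has_real_derivative G' x) (at x)"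
    and M: "\<And>x. x \<in> {-1<..<1} \<Longrightarrow> \<bar>G' x\<bar> \<le> M"
    and C: "\<And>x. x \<in> {-1<..<1} \<Longrightarrow> \<bar>f x\<bar> \<le> C"
  shows "(G \<longlongrightarrow> 0) (at_right (-1))"
proof -
  have "((\<lambda>x. - G (- x)) \<longlongrightarrow> 0) (at_left 1)"
  proof (rule bounded_flux_vanishes_left[OF a, where f = "\<lambda>x. f (- x)" and f' = "\<lambda>x. - f' (- x)" and G' = "\<lambda>x. G' (- x)"])
    fix x :: real assume x: "x \<in> {-1<..<1}"
    then have m: "- x \<in> {-1<..<1}" by auto
    show "((\<lambda>x. f (- x)) has_real_derivative - f' (- x)) (at x)"
      using DERIV_chain2[OF df[OF m] DERIV_minus[OF DERIV_ident]] by simp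
    show "- G (- x) = jacobi_weight (a + 1) x * (- f' (- x))"
      using G[OF m] by (simp add: jacobi_weight_def)
    show "((\<lambda>x. - G (- x)) has_real_derivative G' (- x)) (at x)"
      using DERIV_minus[OF DERIV_chain2[OF dG[OF m] DERIV_minus[OF DERIV_ident]]] by simp
    show "\<bar>G' (- x)\<bar> \<le> M" "\<bar>f (- x)\<bar> \<le> C" using M[OF m] C[OF m] .
  qed
  then have "((\<lambda>x. G (- x)) \<longlongrightarrow> 0) (at_left 1)" using tendsto_minus_cancel_left[of "\<lambda>x. G (- x)" 0] by simp
  then show ?thesis unfolding at_right_minus[of "-1"] filterlim_filtermap by simp
qed

text \<open>
  Uniqueness for the initial value problem by Gronwall's argument for \<open>w\<^sup>2 + g\<^sup>2\<close>.
\<close>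

lemma linear_system_unique:
  fixes w g :: "real \<Rightarrow> real"
  assumes dw: "\<And>x. x \<in> {-r<..<r} \<Longrightarrow> (w has_real_derivative a x * g x) (at x)"
    and dg: "\<And>x. x \<in> {-r<..<r} \<Longrightarrow> (g has_real_derivative b x * w x) (at x)"
    and bd: "\<And>x. x \<in> {-r<..<r} \<Longrightarrow> \<bar>a x\<bar> \<le> K" "\<And>x. x \<in> {-r<..<r} \<Longrightarrow> \<bar>b x\<bar> \<le> K"
    and 0: "w 0 = 0" "g 0 = 0" and x: "x \<in> {-r<..<r}"
  shows "w x = 0"
proof -
  define E where "E t = (w t)\<^sup>2 + (g t)\<^sup>2" for t
  define E' where "E' t = 2 * (a t + b t) * (w t * g t)" for t
  have dE: "(E has_real_derivative E' t) (at t)" if "t \<in> {-r<..<r}" for t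
    unfolding E_def[abs_def] E'_def
    by (rule derivative_eq_intros dw[OF that] dg[OF that] refl)+ (simp add: algebra_simps)
  have bE: "\<bar>E' t\<bar> \<le> 2 * K * E t" if "t \<in> {-r<..<r}" for t
  proof -
    have "0 \<le> (\<bar>w t\<bar> - \<bar>g t\<bar>)\<^sup>2" by simp
    then have "2 * (\<bar>w t\<bar> * \<bar>g t\<bar>) \<le> E t" unfolding power2_diff power2_abs E_def by (simp add: mult.assoc)
    moreover have "\<bar>a t + b t\<bar> \<le> 2 * K" using bd[OF that] by linarith
    moreover have "\<bar>E' t\<bar> = \<bar>a t + b t\<bar> * (2 * (\<bar>w t\<bar> * \<bar>g t\<bar>))" unfolding E'_def abs_mult by simp
    ultimately show ?thesis by (simp only:) (rule mult_mono, simp_all)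
  qed
  have E0: "E 0 = 0" "0 \<le> E t" for t using 0 by (auto simp: E_def)
  have "E x \<le> 0"
  proof (cases "0 \<le> x")
    case True
    have "E x * exp (- (2 * K * x)) \<le> E 0 * exp (- (2 * K * 0))"
    proof (rule DERIV_nonpos_imp_nonincreasing[OF True])
      fix t assume t: "0 \<le> t" "t \<le> x"
      then have tI: "t \<in> {-r<..<r}" using x by auto
      have "((\<lambda>t. E t * exp (- (2 * K * t))) has_real_derivative (E' t - 2 * K * E t) * exp (- (2 * K * t))) (at t)"
        by (rule derivative_eq_intros dE[OF tI] refl)+ (simp add: algebra_simps)
      moreover have "(E' t - 2 * K * E t) * exp (- (2 * K * t)) \<le> 0"
        using bE[OF tI] by (intro mult_nonpos_nonneg) auto
      ultimately show "\<exists>y. ((\<lambda>t. E t * exp (- (2 * K * t))) has_real_derivative y) (at t) \<and> y \<le> 0" by blast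
    qed
    then show ?thesis using E0 by (simp add: mult_le_0_iff)
  next
    case False
    have "E x * exp (2 * K * x) \<le> E 0 * exp (2 * K * 0)"
    proof (rule DERIV_nonneg_imp_nondecreasing[of x 0 "\<lambda>t. E t * exp (2 * K * t)"])
      show "x \<le> 0" using False by simp
      fix t assume t: "x \<le> t" "t \<le> 0"
      then have tI: "t \<in> {-r<..<r}" using x by auto
      have "((\<lambda>t. E t * exp (2 * K * t)) has_real_derivative (E' t + 2 * K * E t) * exp (2 * K * t)) (at t)"
        by (rule derivative_eq_intros dE[OF tI] refl)+ (simp add: algebra_simps)
      moreover have "0 \<le> (E' t + 2 * K * E t) * exp (2 * K * t)"
        using bE[OF tI] by (intro mult_nonneg_nonneg) auto
      ultimately show "\<exists>y. ((\<lambda>t. E t * exp (2 * K * t)) has_real_derivative y) (at t) \<and> 0 \<le> y" by blast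
    qed
    then show ?thesis using E0 by (simp add: mult_le_0_iff)
  qed
  then have "E x = 0" using E0(2)[of x] by simp
  then show ?thesis by (simp add: E_def add_nonneg_eq_0_iff)
qed

definition flux :: "real \<Rightarrow> (real \<Rightarrow> real) \<Rightarrow> real \<Rightarrow> real" where
  "flux \<alpha> f t = jacobi_weight \<alpha> t * (1 - t\<^sup>2) * deriv f t"

lemma bounded_eigenfunction_facts:
  assumes \<alpha>: "0 < \<alpha>" and ef: "bounded_eigenfunction \<alpha> c m f"
  shows "\<And>x. x \<in> {-1<..<1} \<Longrightarrow> (f has_real_derivative deriv f x) (at x)"
    and "\<And>x. x \<in> {-1<..<1} \<Longrightarrow> flux \<alpha> f x = jacobi_weight (\<alpha> + 1) x * deriv f x"
    and "\<And>x. x \<in> {-1<..<1} \<Longrightarrow> (flux \<alpha> f has_real_derivative jacobi_weight \<alpha> x * (c\<^sup>2 * x\<^sup>2 - m) * f x) (at x)"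
    and "\<exists>C. \<forall>x\<in>{-1..1}. \<bar>f x\<bar> \<le> C"
    and "(flux \<alpha> f \<longlongrightarrow> 0) (at_left 1)" and "(flux \<alpha> f \<longlongrightarrow> 0) (at_right (-1))"
    and "continuous_on {-1<..<1} f"
proof -
  show df: "(f has_real_derivative deriv f x) (at x)" if "x \<in> {-1<..<1}" for x
    using ef that unfolding bounded_eigenfunction_def by (auto simp: DERIV_deriv_iff_real_differentiable)
  show fl: "flux \<alpha> f x = jacobi_weight (\<alpha> + 1) x * deriv f x" if "x \<in> {-1<..<1}" for x
    using that by (subst jacobi_weight_Suc) (auto simp: flux_def mult_ac)
  show dfl: "(flux \<alpha> f has_real_derivative jacobi_weight \<alpha> x * (c\<^sup>2 * x\<^sup>2 - m) * f x) (at x)" if x: "x \<in> {-1<..<1}" for x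
  proof -
    have "flux \<alpha> f differentiable (at x)" and sl: "sturm_liouville \<alpha> c f x = m * f x"
      using ef x unfolding bounded_eigenfunction_def flux_def[abs_def] by auto
    then have d: "(flux \<alpha> f has_real_derivative deriv (flux \<alpha> f) x) (at x)"
      by (simp add: DERIV_deriv_iff_real_differentiable)
    have "- (1 / jacobi_weight \<alpha> x) * deriv (flux \<alpha> f) x + c\<^sup>2 * x\<^sup>2 * f x = m * f x"
      using sl unfolding sturm_liouville_def flux_def[abs_def] .
    then have "deriv (flux \<alpha> f) x = jacobi_weight \<alpha> x * (c\<^sup>2 * x\<^sup>2 - m) * f x"
      using jacobi_weight_pos[OF x, of \<alpha>] by (simp add: field_simps)
    then show ?thesis using d by simp
  qed
  show ex: "\<exists>C. \<forall>x\<in>{-1..1}. \<bar>f x\<bar> \<le> C"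
    using ef unfolding bounded_eigenfunction_def bounded_iff by auto
  then obtain C where C: "\<And>x. x \<in> {-1..1} \<Longrightarrow> \<bar>f x\<bar> \<le> C" by blast
  have M: "\<bar>jacobi_weight \<alpha> x * (c\<^sup>2 * x\<^sup>2 - m) * f x\<bar> \<le> 1 * (c\<^sup>2 + \<bar>m\<bar>) * C" if "x \<in> {-1<..<1}" for x
    unfolding abs_mult
  proof (intro mult_mono)
    show "\<bar>jacobi_weight \<alpha> x\<bar> \<le> 1" using jacobi_weight_le_1[of \<alpha> x] \<alpha> that by simp
    have "x\<^sup>2 \<le> 1" using that by (simp add: abs_square_le_1 abs_le_iff)
    then have "c\<^sup>2 * x\<^sup>2 \<le> c\<^sup>2 * 1" by (intro mult_left_mono) auto
    moreover have "0 \<le> c\<^sup>2 * x\<^sup>2" by simp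
    ultimately show "\<bar>c\<^sup>2 * x\<^sup>2 - m\<bar> \<le> c\<^sup>2 + \<bar>m\<bar>" by linarith
    show "\<bar>f x\<bar> \<le> C" using that by (intro C) auto
  qed auto
  show "(flux \<alpha> f \<longlongrightarrow> 0) (at_left 1)"
    by (rule bounded_flux_vanishes_left[OF \<alpha> df fl dfl M, where C = C]) (auto intro: C)
  show "(flux \<alpha> f \<longlongrightarrow> 0) (at_right (-1))"
    by (rule bounded_flux_vanishes_right[OF \<alpha> df fl dfl M, where C = C]) (auto intro: C)
  show "continuous_on {-1<..<1} f"
    by (rule DERIV_continuous_on) (use df in \<open>auto intro: has_field_derivative_at_within\<close>)
qed

lemma tendsto_bounded_mult_zero:
  fixes G f :: "real \<Rightarrow> real"
  assumes "(G \<longlongrightarrow> 0) F" "\<forall>\<^sub>F x in F. \<bar>f x\<bar> \<le> C"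
  shows "((\<lambda>x. G x * f x) \<longlongrightarrow> 0) F"
proof (rule Lim_null_comparison)
  show "\<forall>\<^sub>F x in F. norm (G x * f x) \<le> \<bar>G x\<bar> * \<bar>C\<bar>"
    using assms(2) by eventually_elim (auto simp: abs_mult intro!: mult_left_mono)
  show "((\<lambda>x. \<bar>G x\<bar> * \<bar>C\<bar>) \<longlongrightarrow> 0) F"
    using tendsto_mult[OF tendsto_rabs[OF assms(1)] tendsto_const, of "\<bar>C\<bar>"] by simp
qed

text \<open>
  The Wronskian of two bounded eigenfunctions is constant and tends to zero at the end point
  \<open>1\<close>, since the fluxes vanish there. So some nontrivial combination has zero initial data at
  \<open>0\<close> and vanishes identically.
\<close>

lemma eigenvalue_simple:
  assumes \<alpha>: "0 < \<alpha>" and y: "bounded_eigenfunction \<alpha> c m y" and z: "bounded_eigenfunction \<alpha> c m z"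
  obtains a b where "a \<noteq> 0 \<or> b \<noteq> 0" "\<And>x. x \<in> {-1<..<1} \<Longrightarrow> a * y x + b * z x = 0"
proof -
  note Y = bounded_eigenfunction_facts[OF \<alpha> y] and Z = bounded_eigenfunction_facts[OF \<alpha> z]
  define W where "W x = flux \<alpha> y x * z x - flux \<alpha> z x * y x" for x
  obtain Cy Cz where C: "\<forall>x\<in>{-1..1}. \<bar>y x\<bar> \<le> Cy" "\<forall>x\<in>{-1..1}. \<bar>z x\<bar> \<le> Cz" using Y(4) Z(4) by blast
  have dW: "(W has_real_derivative 0) (at x)" if x: "x \<in> {-1<..<1}" for x
    unfolding W_def[abs_def]
    by (rule derivative_eq_intros Y(1)[OF x] Z(1)[OF x] Y(3)[OF x] Z(3)[OF x] refl)+
       (simp add: Y(2)[OF x] Z(2)[OF x] algebra_simps)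
  have "\<exists>k. \<forall>x\<in>{-1<..<1}. W x = k"
    by (rule has_field_derivative_zero_constant)
       (rule convex_real_interval, rule has_field_derivative_at_within, rule dW)
  then obtain k where k: "\<And>x. x \<in> {-1<..<1} \<Longrightarrow> W x = k" by blast
  have ev: "\<forall>\<^sub>F x in at_left (1::real). x \<in> {-1<..<1}" by (rule eventually_at_left_real) simp
  have "(W \<longlongrightarrow> 0 - 0) (at_left 1)"
    unfolding W_def[abs_def]
  proof (intro tendsto_diff tendsto_bounded_mult_zero Y(5) Z(5))
    show "\<forall>\<^sub>F x in at_left 1. \<bar>z x\<bar> \<le> Cz" "\<forall>\<^sub>F x in at_left 1. \<bar>y x\<bar> \<le> Cy"
      using ev C by (auto elim!: eventually_mono)
  qed
  moreover have "(W \<longlongrightarrow> k) (at_left 1)"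
    by (rule tendsto_eventually) (use ev k in \<open>auto elim!: eventually_mono\<close>)
  ultimately have "k = 0" using tendsto_unique trivial_limit_at_left_real by (metis diff_zero)
  then have W0: "flux \<alpha> y 0 * z 0 = flux \<alpha> z 0 * y 0" using k[of 0] by (simp add: W_def)
  obtain a b where ab: "a \<noteq> 0 \<or> b \<noteq> 0" "a * y 0 + b * z 0 = 0" "a * flux \<alpha> y 0 + b * flux \<alpha> z 0 = 0"
  proof -
    consider "z 0 = 0 \<and> flux \<alpha> z 0 = 0" | "z 0 \<noteq> 0" | "flux \<alpha> z 0 \<noteq> 0" by blast
    then show ?thesis
    proof cases
      case 1 then show ?thesis using that[of 0 1] by simp
    next
      case 2 then show ?thesis using that[of "z 0" "- y 0"] W0 by (simp add: mult.commute)
    next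
      case 3 then show ?thesis using that[of "flux \<alpha> z 0" "- flux \<alpha> y 0"] W0 by (simp add: mult.commute)
    qed
  qed
  have "a * y x + b * z x = 0" if x: "x \<in> {-1<..<1}" for x
  proof -
    \<comment> \<open>the coefficients of the first-order system are bounded only away from the end points\<close>
    define r where "r = (\<bar>x\<bar> + 1) / 2"
    have r: "0 < r" "r < 1" "\<bar>x\<bar> < r" using x by (auto simp: r_def abs_less_iff field_simps)
    have rI: "t \<in> {-1<..<1}" if "t \<in> {-r<..<r}" for t using that r by auto
    define K where "K = max (1 / ((1 - r\<^sup>2) powr (\<alpha> + 1))) (c\<^sup>2 + \<bar>m\<bar>)"
    show ?thesis
    proof (rule linear_system_unique[where w = "\<lambda>x. a * y x + b * z x" and g = "\<lambda>x. a * flux \<alpha> y x + b * flux \<alpha> z x"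
          and r = r and K = K and a = "\<lambda>x. 1 / jacobi_weight (\<alpha> + 1) x" and b = "\<lambda>x. jacobi_weight \<alpha> x * (c\<^sup>2 * x\<^sup>2 - m)"])
      fix t assume tr: "t \<in> {-r<..<r}"
      note t = rI[OF tr]
      have wp: "jacobi_weight (\<alpha> + 1) t \<noteq> 0" using jacobi_weight_pos[OF t, of "\<alpha> + 1"] by simp
      show "((\<lambda>x. a * y x + b * z x) has_real_derivative 1 / jacobi_weight (\<alpha> + 1) t * (a * flux \<alpha> y t + b * flux \<alpha> z t)) (at t)"
        by (rule derivative_eq_intros Y(1)[OF t] Z(1)[OF t] refl)+
           (use wp in \<open>simp add: Y(2)[OF t] Z(2)[OF t] field_simps\<close>)
      show "((\<lambda>x. a * flux \<alpha> y x + b * flux \<alpha> z x) has_real_derivative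
          jacobi_weight \<alpha> t * (c\<^sup>2 * t\<^sup>2 - m) * (a * y t + b * z t)) (at t)"
        by (rule derivative_eq_intros Y(3)[OF t] Z(3)[OF t] refl)+ (simp add: algebra_simps)
      have t2: "t\<^sup>2 \<le> r\<^sup>2" using tr r by (intro abs_le_square_iff[THEN iffD1]) auto
      have r2: "r\<^sup>2 < 1" using r by (simp add: abs_square_less_1)
      have "(1 - r\<^sup>2) powr (\<alpha> + 1) \<le> jacobi_weight (\<alpha> + 1) t"
        unfolding jacobi_weight_def using t2 r2 \<alpha> by (intro powr_mono2) auto
      then have "1 / jacobi_weight (\<alpha> + 1) t \<le> 1 / ((1 - r\<^sup>2) powr (\<alpha> + 1))"
        using r2 jacobi_weight_pos[OF t, of "\<alpha> + 1"] by (intro divide_left_mono) auto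
      then show "\<bar>1 / jacobi_weight (\<alpha> + 1) t\<bar> \<le> K" unfolding K_def by simp
      have "\<bar>jacobi_weight \<alpha> t * (c\<^sup>2 * t\<^sup>2 - m)\<bar> \<le> 1 * (c\<^sup>2 + \<bar>m\<bar>)"
        unfolding abs_mult
      proof (intro mult_mono)
        show "\<bar>jacobi_weight \<alpha> t\<bar> \<le> 1" using jacobi_weight_le_1[of \<alpha> t] \<alpha> t by simp
        have "c\<^sup>2 * t\<^sup>2 \<le> c\<^sup>2 * 1" using t2 r2 by (intro mult_left_mono) auto
        moreover have "0 \<le> c\<^sup>2 * t\<^sup>2" by simp
        ultimately show "\<bar>c\<^sup>2 * t\<^sup>2 - m\<bar> \<le> c\<^sup>2 + \<bar>m\<bar>" by linarith
      qed auto
      then show "\<bar>jacobi_weight \<alpha> t * (c\<^sup>2 * t\<^sup>2 - m)\<bar> \<le> K" unfolding K_def by simp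
    qed (use ab r in \<open>auto simp: abs_less_iff\<close>)
  qed
  then show ?thesis using that ab(1) by blast
qed

lemma integral_weighted_zero_interior:
  assumes f: "f \<in> borel_measurable (lebesgue_on {-1..1})" and a: "0 < \<beta>"
    and 0: "\<And>x. x \<in> {-1<..<1} \<Longrightarrow> f x = 0"
  shows "integral\<^sup>L (weighted_measure \<beta>) (f :: real \<Rightarrow> real) = 0"
proof -
  have z: "jacobi_weight \<beta> x *\<^sub>R f x = 0" if "x \<in> space (lebesgue_on {-1..1})" for x
  proof (cases "x \<in> {-1<..<1}")
    case False
    then have "x = 1 \<or> x = -1" using that by (simp add: not_less) linarith
    then show ?thesis by (auto simp: jacobi_weight_def)
  qed (simp add: 0)
  have "(\<integral>x. jacobi_weight \<beta> x *\<^sub>R f x \<partial>lebesgue_on {-1..1}) = (\<integral>x. 0 \<partial>lebesgue_on {-1..1::real})"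
    by (rule Bochner_Integration.integral_cong[OF refl z])
  then show ?thesis unfolding integral_weighted(1)[OF f] by simp
qed

section \<open>Coefficients and eigenfunctions\<close>

context gpswf
begin

definition gcoeffs :: "(real \<Rightarrow> real) \<Rightarrow> ell2" where
  "gcoeffs f = Ell2 (\<lambda>k. rinner \<alpha> f (p k))"

lemma gcoeffs_props:
  assumes "f \<in> rL2 \<alpha>"
  shows "coord (gcoeffs f) = (\<lambda>k. rinner \<alpha> f (p k))" "(norm (gcoeffs f))\<^sup>2 = rinner \<alpha> f f"
proof -
  have "(\<Sum>k<n. (rinner \<alpha> f (p k))\<^sup>2) \<le> rinner \<alpha> f f" for n
    by (rule rL2_Bessel[OF rL2_orthonormal_gpoly[OF alpha_nonneg] assms]) simp
  from ell2_of_bounded_sums(1)[OF this] show c: "coord (gcoeffs f) = (\<lambda>k. rinner \<alpha> f (p k))"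
    by (simp add: gcoeffs_def)
  show "(norm (gcoeffs f))\<^sup>2 = rinner \<alpha> f f"
    using norm_ell2_sums[of "gcoeffs f"] gpoly_Parseval[OF alpha_nonneg assms] unfolding c by (rule sums_unique2)
qed

lemma p_rL2: "p k \<in> rL2 \<alpha>" by (rule rL2_poly) simp

lemma gcoeffs_diff: "f \<in> rL2 \<alpha> \<Longrightarrow> g \<in> rL2 \<alpha> \<Longrightarrow> gcoeffs (\<lambda>x. f x - g x) = gcoeffs f - gcoeffs g"
  by (rule ell2_eqI) (simp add: gcoeffs_props rL2_diff rinner_diff_left p_rL2)

lemma gcoeffs_cmult: "f \<in> rL2 \<alpha> \<Longrightarrow> gcoeffs (\<lambda>x. a * f x) = a *\<^sub>R gcoeffs f"
  by (rule ell2_eqI) (simp add: gcoeffs_props rL2_cmult rinner_cmult_left)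

lemma gcoeffs_sum: "(\<And>i. i \<in> I \<Longrightarrow> f i \<in> rL2 \<alpha>) \<Longrightarrow> gcoeffs (\<lambda>x. \<Sum>i\<in>I. f i x) = (\<Sum>i\<in>I. gcoeffs (f i))"
  by (rule ell2_eqI) (simp add: gcoeffs_props rL2_sum rinner_sum_left p_rL2)

text \<open>
  Parseval's identity, polarised.
\<close>

lemma inner_gcoeffs:
  assumes "f \<in> rL2 \<alpha>" "g \<in> rL2 \<alpha>"
  shows "inner (gcoeffs f) (gcoeffs g) = rinner \<alpha> f g"
proof -
  have "(norm (gcoeffs f - gcoeffs g))\<^sup>2 = rinner \<alpha> f f - 2 * rinner \<alpha> f g + rinner \<alpha> g g"
    unfolding gcoeffs_diff[OF assms, symmetric] gcoeffs_props(2)[OF rL2_diff[OF assms]] by (rule rinner_diff_expand[OF assms])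
  moreover have "(norm (gcoeffs f - gcoeffs g))\<^sup>2 = (norm (gcoeffs f))\<^sup>2 - 2 * inner (gcoeffs f) (gcoeffs g) + (norm (gcoeffs g))\<^sup>2"
    by (simp add: power2_norm_eq_inner inner_diff_left inner_diff_right inner_commute)
  ultimately show ?thesis by (simp add: gcoeffs_props assms)
qed

lemma eigen_imp_rapid_decay:
  assumes "eigen \<mu> u"
  shows "\<exists>A\<ge>0. \<forall>k. \<bar>coord u k\<bar> * lam k ^ m \<le> A"
proof -
  obtain w where w: "u = (T ^^ (2 * m)) w" using eigen_regular[OF assms] by blast
  have "\<bar>coord u k\<bar> * lam k ^ m = \<bar>coord w k\<bar>" for k
    unfolding w coord_T_power power_mult by simp
  then show ?thesis using coord_le_norm[of w] by (intro exI[of _ "norm w"]) simp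
qed

lemma summable_inverse_lam: "summable (\<lambda>k. 1 / lam k)"
proof (rule summable_comparison_test'[where N = 1])
  show "summable (\<lambda>k. 1 / (real k)\<^sup>2)" using inverse_power_summable[of 2, where 'a = real] by (simp add: inverse_eq_divide)
  fix k :: nat assume "1 \<le> k"
  then show "norm (1 / lam k) \<le> 1 / (real k)\<^sup>2"
    using gweight_ge[OF alpha_nonneg, of k] by (simp add: frac_le)
qed

text \<open>
  Coefficients of a uniformly convergent Gegenbauer series, by dominated convergence.
\<close>

lemma rinner_uniform_series:
  assumes M: "\<And>j x. x \<in> {-1..1} \<Longrightarrow> \<bar>a j * p j x\<bar> \<le> M j" "summable M"
    and lim: "\<And>x. x \<in> {-1..1} \<Longrightarrow> (\<lambda>j. a j * p j x) sums F x" and F: "continuous_on {-1..1} F"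
  shows "F \<in> rL2 \<alpha>" "rinner \<alpha> F (p k) = a k"
proof -
  have bF: "\<bar>F x\<bar> \<le> suminf M" "\<bar>\<Sum>j<n. a j * p j x\<bar> \<le> suminf M" if x: "x \<in> {-1..1}" for x n
  proof -
    have M0: "0 \<le> M j" for j using M(1)[OF x, of j] by (meson abs_ge_zero order_trans)
    have "\<bar>\<Sum>j<n. a j * p j x\<bar> \<le> suminf M" for n
    proof -
      have "\<bar>\<Sum>j<n. a j * p j x\<bar> \<le> (\<Sum>j<n. \<bar>a j * p j x\<bar>)" by (rule sum_abs)
      also have "\<dots> \<le> (\<Sum>j<n. M j)" by (intro sum_mono M x)
      also have "\<dots> \<le> suminf M" by (rule sum_le_suminf[OF M(2)]) (auto simp: M0)
      finally show ?thesis .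
    qed
    moreover have "(\<lambda>n. \<bar>\<Sum>j<n. a j * p j x\<bar>) \<longlonglongrightarrow> \<bar>F x\<bar>"
      using lim[OF x] unfolding sums_def by (rule tendsto_rabs)
    ultimately show "\<bar>F x\<bar> \<le> suminf M" "\<bar>\<Sum>j<n. a j * p j x\<bar> \<le> suminf M" by (auto intro: LIMSEQ_le_const2)
  qed
  have Fm: "F \<in> borel_measurable (weighted_measure \<alpha>)" unfolding measurable_weighted_iff
    by (rule measurable_of_continuous_interior, rule continuous_on_subset[OF F]) auto
  show FL: "F \<in> rL2 \<alpha>" by (rule rL2_bounded[OF alpha_nonneg Fm bF(1)])
  have "(\<lambda>n. \<integral>x. (\<Sum>j<n. a j * p j x) * p k x \<partial>weighted_measure \<alpha>) \<longlonglongrightarrow> (\<integral>x. F x * p k x \<partial>weighted_measure \<alpha>)"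
  proof (rule integral_dominated_convergence[where w = "\<lambda>x. suminf M * \<bar>p k x\<bar>"])
    have pm: "p k \<in> borel_measurable (weighted_measure \<alpha>)" for k using p_rL2 by (rule rL2_measurable)
    show "(\<lambda>x. F x * p k x) \<in> borel_measurable (weighted_measure \<alpha>)"
      by (intro borel_measurable_times Fm pm)
    show "(\<lambda>x. (\<Sum>j<n. a j * p j x) * p k x) \<in> borel_measurable (weighted_measure \<alpha>)" for n
      by (intro borel_measurable_times borel_measurable_sum borel_measurable_const pm)
    show "integrable (weighted_measure \<alpha>) (\<lambda>x. suminf M * \<bar>p k x\<bar>)"
      by (intro integrable_mult_right integrable_abs poly_integrable alpha_nonneg)
    show "AE x in weighted_measure \<alpha>. (\<lambda>n. (\<Sum>j<n. a j * p j x) * p k x) \<longlonglongrightarrow> F x * p k x"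
      by (rule AE_I2, intro tendsto_mult tendsto_const) (use lim in \<open>simp add: sums_def\<close>)
    show "AE x in weighted_measure \<alpha>. norm ((\<Sum>j<n. a j * p j x) * p k x) \<le> suminf M * \<bar>p k x\<bar>" for n
      by (rule AE_I2) (use bF(2) in \<open>auto simp: abs_mult intro!: mult_right_mono\<close>)
  qed
  moreover have "(\<integral>x. (\<Sum>j<n. a j * p j x) * p k x \<partial>weighted_measure \<alpha>) = a k" if "n \<ge> Suc k" for n
  proof -
    define n' where "n' = n - 1"
    have n': "n = Suc n'" "k \<le> n'" using that by (auto simp: n'_def)
    show ?thesis using rinner_sum_gpoly[OF alpha_nonneg n'(2), of a]
      unfolding n'(1) lessThan_Suc_atMost rinner_def .
  qed
  then have "(\<lambda>n. \<integral>x. (\<Sum>j<n. a j * p j x) * p k x \<partial>weighted_measure \<alpha>) \<longlonglongrightarrow> a k"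
    by (intro tendsto_eventually) (auto simp: eventually_sequentially intro!: exI[of _ "Suc k"])
  ultimately show "rinner \<alpha> F (p k) = a k" unfolding rinner_def using LIMSEQ_unique by blast
qed

text \<open>
  The coefficients decay so fast that the series may be differentiated twice. Its sum satisfies
  the differential equation because the defect is a continuous function all of whose Gegenbauer
  coefficients vanish, by the eigenvector equation.
\<close>

lemma eigenfunction_of_eigenvector:
  assumes ev: "eigen \<mu> u" and u: "u \<noteq> 0"
  obtains y where "bounded_eigenfunction \<alpha> c (\<mu> - 1) y" "y \<in> rL2 \<alpha>" "gcoeffs y = u"
proof -
  obtain C D where C: "0 \<le> C" and sup: "\<And>k j x. x \<in> {-1..1} \<Longrightarrow>
      \<bar>poly ((pderiv ^^ j) (gpoly \<alpha> k)) x\<bar> \<le> C * lam k ^ (D + j)"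
    using gpoly_sup_bound[OF alpha_nonneg] by blast
  \<comment> \<open>two powers of \<open>lam\<close> for two derivatives, one more for summability\<close>
  obtain A where A: "0 \<le> A" "\<And>k. \<bar>coord u k\<bar> * lam k ^ (D + 3) \<le> A" using eigen_imp_rapid_decay[OF ev, of "D + 3"] by blast
  define M where "M k = C * A * (1 / lam k)" for k
  have sM: "summable M" unfolding M_def by (intro summable_mult summable_inverse_lam)
  define q where "q j k = poly ((pderiv ^^ j) (gpoly \<alpha> k))" for j k
  have bd: "\<bar>b k * q j k x\<bar> \<le> M k"
    if b: "\<And>k. \<bar>b k\<bar> \<le> \<bar>coord u k\<bar> * lam k ^ i" and j: "i + j \<le> 2" and x: "x \<in> {-1..1}" for b i j k x
  proof -
    have l1: "1 \<le> lam k" by (rule gweight_ge_1) simp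
    have "\<bar>b k * q j k x\<bar> \<le> (\<bar>coord u k\<bar> * lam k ^ i) * (C * lam k ^ (D + j))"
      unfolding abs_mult q_def by (intro mult_mono b sup x) auto
    also have "\<dots> = C * (\<bar>coord u k\<bar> * lam k ^ (D + i + j))" by (simp add: power_add mult_ac)
    also have "\<dots> \<le> C * (\<bar>coord u k\<bar> * lam k ^ (D + 2))"
      using C j l1 by (intro mult_left_mono power_increasing) auto
    also have "\<dots> = C * ((\<bar>coord u k\<bar> * lam k ^ (D + 3)) * (1 / lam k))"
      by (simp add: power_add numeral_3_eq_3 numeral_2_eq_2)
    also have "\<dots> \<le> C * (A * (1 / lam k))" using C by (intro mult_left_mono mult_right_mono A) auto
    finally show ?thesis by (simp add: M_def)
  qed
  define S where "S b j x = (\<Sum>k. b k * q j k x)" for b j x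
  have S: "(\<lambda>k. b k * q j k x) sums S b j x"
    "uniform_limit {-1..1} (\<lambda>n x. \<Sum>k<n. b k * q j k x) (S b j) sequentially"
    "continuous_on {-1..1} (S b j)"
    if b: "\<And>k. \<bar>b k\<bar> \<le> \<bar>coord u k\<bar> * lam k ^ i" and j: "i + j \<le> 2" and x: "x \<in> {-1..1}" for b i j x
  proof -
    show "(\<lambda>k. b k * q j k x) sums S b j x"
      unfolding S_def
      by (intro summable_sums summable_comparison_test'[OF sM, of 0]) (use bd[OF b j x] in simp)
    show ul: "uniform_limit {-1..1} (\<lambda>n x. \<Sum>k<n. b k * q j k x) (S b j) sequentially"
      unfolding S_def[abs_def] by (rule Weierstrass_m_test[OF _ sM]) (use bd[OF b j] in simp)
    show "continuous_on {-1..1} (S b j)"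
      by (rule uniform_limit_theorem[OF _ ul]) (auto simp: q_def intro!: always_eventually continuous_intros)
  qed
  let ?u = "coord u"
  have u0: "\<bar>?u k\<bar> \<le> \<bar>?u k\<bar> * lam k ^ 0" for k by simp
  have dq: "(q j k has_real_derivative q (Suc j) k x) (at x)" for j k x
    unfolding q_def by (simp add: poly_DERIV)
  have dS: "(S ?u j has_real_derivative S ?u (Suc j) x) (at x)" if x: "x \<in> {-1<..<1}" and j: "j \<le> 1" for j x
  proof -
    have x': "x \<in> {-1..1}" using x by auto
    have der: "((\<lambda>x. ?u k * q j k x) has_real_derivative ?u k * q (Suc j) k y) (at y within {-1..1})" for k y
      by (rule has_field_derivative_at_within[OF DERIV_cmult[OF dq]])
    have j0: "0 + j \<le> 2" and j1: "0 + Suc j \<le> 2" using j by simp_all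
    note ul = S(2)[OF u0 j1 x']
    have sm: "summable (\<lambda>k. ?u k * q j k x)" by (rule sums_summable[OF S(1)[OF u0 j0 x']])
    obtain g where g': "\<forall>x\<in>{-1..1}. (\<lambda>k. ?u k * q j k x) sums g x \<and>
        (g has_field_derivative S ?u (Suc j) x) (at x within {-1..1})"
      using has_field_derivative_series[OF convex_real_interval(5) der ul x' sm] by blast
    have g: "\<And>x. x \<in> {-1..1} \<Longrightarrow> (\<lambda>k. ?u k * q j k x) sums g x"
      "(g has_field_derivative S ?u (Suc j) x) (at x within {-1..1})"
      using g' x' by blast+
    have gS: "g t = S ?u j t" if "t \<in> {-1..1}" for t
      using g(1)[OF that] S(1)[OF u0 j0 that] by (rule sums_unique2)
    have "at x within {-1..1} = at x" using x by (intro at_within_interior) (simp add: interior_atLeastAtMost_real)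
    then have "(g has_real_derivative S ?u (Suc j) x) (at x)" using g(2) by simp
    then show ?thesis
      by (rule has_field_derivative_transform_within_open[of _ _ _ "{-1<..<1}"]) (use x gS in auto)
  qed
  let ?y = "S ?u 0"
  let ?z = "S (\<lambda>k. ?u k * gegen_eigenvalue \<alpha> k) 0"
  have ge0: "0 \<le> gegen_eigenvalue \<alpha> k" for k by (simp add: gegen_eigenvalue_def)
  have zb: "\<bar>?u k * gegen_eigenvalue \<alpha> k\<bar> \<le> \<bar>?u k\<bar> * lam k ^ 1" for k
    using ge0[of k] by (simp add: abs_mult gweight_def mult_left_mono)
  have q0: "q 0 k = p k" for k by (simp add: q_def)
  have yL: "?y \<in> rL2 \<alpha>" and yc: "rinner \<alpha> ?y (p k) = ?u k" for k
    using rinner_uniform_series[OF bd[OF u0, where j = 0, unfolded q0] sM S(1)[OF u0, where j = 0, unfolded q0] S(3)[OF u0, where j = 0 and x = 0]]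
    by simp_all
  have zL: "?z \<in> rL2 \<alpha>" and zc: "rinner \<alpha> ?z (p k) = ?u k * gegen_eigenvalue \<alpha> k" for k
    using rinner_uniform_series[OF bd[OF zb, where j = 0, unfolded q0] sM S(1)[OF zb, where j = 0, unfolded q0] S(3)[OF zb, where j = 0 and x = 0]]
    by simp_all
  have ode0: "(x\<^sup>2 - 1) * S ?u 2 x + 2 * (\<alpha> + 1) * x * S ?u 1 x = ?z x" if x: "x \<in> {-1..1}" for x
  proof -
    have "(\<lambda>k. (x\<^sup>2 - 1) * (?u k * q 2 k x) + 2 * (\<alpha> + 1) * x * (?u k * q 1 k x))
      sums ((x\<^sup>2 - 1) * S ?u 2 x + 2 * (\<alpha> + 1) * x * S ?u 1 x)"
      by (intro sums_add sums_mult S(1)[OF u0 _ x]) simp_all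
    moreover have "(x\<^sup>2 - 1) * (?u k * q 2 k x) + 2 * (\<alpha> + 1) * x * (?u k * q 1 k x)
        = ?u k * gegen_eigenvalue \<alpha> k * q 0 k x" for k
    proof -
      have "(x\<^sup>2 - 1) * q 2 k x + 2 * (\<alpha> + 1) * x * q 1 k x = gegen_eigenvalue \<alpha> k * q 0 k x"
        using arg_cong[OF gegen_op_gpoly[of \<alpha> k], of "\<lambda>p. poly p x"]
        unfolding poly_gegen_op by (simp add: q_def numeral_2_eq_2)
      from arg_cong[OF this, of "\<lambda>t. ?u k * t"] show ?thesis by (simp add: algebra_simps)
    qed
    ultimately show ?thesis using S(1)[OF zb _ x, of 0] sums_unique2 by auto
  qed
  \<comment> \<open>the defect in the differential equation\<close>
  define g where "g x = ?z x + (c\<^sup>2 * (x\<^sup>2 * ?y x) - (\<mu> - 1) * ?y x)" for x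
  have yC: "continuous_on {-1..1} ?y" and zC: "continuous_on {-1..1} ?z"
    using S(3)[OF u0, of 0 0] S(3)[OF zb, of 0 0] by auto
  obtain Cy where "\<forall>t\<in>?y ` {-1..1}. norm t \<le> Cy"
    using compact_imp_bounded[OF compact_continuous_image[OF yC compact_Icc]] unfolding bounded_iff by blast
  then have Cy: "\<And>x. x \<in> {-1..1} \<Longrightarrow> \<bar>?y x\<bar> \<le> Cy" by simp
  have x2L: "(\<lambda>x. x\<^sup>2 * ?y x) \<in> rL2 \<alpha>"
  proof (rule rL2_bounded[OF alpha_nonneg])
    show "(\<lambda>x. x\<^sup>2 * ?y x) \<in> borel_measurable (weighted_measure \<alpha>)" unfolding measurable_weighted_iff
      by (rule measurable_of_continuous_interior) (intro continuous_intros continuous_on_subset[OF yC], auto)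
    fix x :: real assume x: "x \<in> {-1..1}"
    then have "x\<^sup>2 \<le> 1" by (simp add: abs_square_le_1 abs_le_iff)
    then have "x\<^sup>2 * \<bar>?y x\<bar> \<le> 1 * Cy" using Cy[OF x] by (intro mult_mono) auto
    then show "\<bar>x\<^sup>2 * ?y x\<bar> \<le> Cy" by (simp add: abs_mult)
  qed
  have x2c: "rinner \<alpha> (\<lambda>x. x\<^sup>2 * ?y x) (p k) = (\<Sum>j\<le>k + 2. xsq_matrix \<alpha> k j * ?u j)" for k
  proof -
    have "rinner \<alpha> (\<lambda>x. x\<^sup>2 * ?y x) (p k) = rinner \<alpha> (\<lambda>x. x\<^sup>2 * p k x) ?y" by (simp add: rinner_def mult_ac)
    also have "\<dots> = rinner \<alpha> (\<lambda>x. \<Sum>j\<le>k + 2. xsq_matrix \<alpha> j k * p j x) ?y"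
      by (subst xsq_expand[OF alpha_nonneg]) simp
    also have "\<dots> = (\<Sum>j\<le>k + 2. xsq_matrix \<alpha> j k * rinner \<alpha> (p j) ?y)"
      by (subst rinner_sum_left) (auto simp: rL2_cmult p_rL2 yL rinner_cmult_left)
    finally show ?thesis by (simp only: rinner_commute[of \<alpha> _ ?y] yc xsq_matrix_sym[of \<alpha> _ k])
  qed
  have d1: "(\<lambda>x. c\<^sup>2 * (x\<^sup>2 * ?y x)) \<in> rL2 \<alpha>" "(\<lambda>x. (\<mu> - 1) * ?y x) \<in> rL2 \<alpha>" by (intro rL2_cmult x2L yL)+
  have gL: "g \<in> rL2 \<alpha>" unfolding g_def[abs_def] by (intro rL2_add rL2_diff d1 zL)
  have gc: "rinner \<alpha> g (p k) = 0" for k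
  proof -
    have "rinner \<alpha> g (p k) = ?u k * gegen_eigenvalue \<alpha> k
        + (c\<^sup>2 * (\<Sum>j\<le>k + 2. xsq_matrix \<alpha> k j * ?u j) - (\<mu> - 1) * ?u k)"
      unfolding g_def[abs_def]
      by (simp only: rinner_add_left[OF zL rL2_diff[OF d1] p_rL2] rinner_diff_left[OF d1 p_rL2] rinner_cmult_left zc x2c yc)
    moreover have "lam k * ?u k + (\<Sum>j\<le>k + 2. Bmat k j * ?u j) = \<mu> * ?u k"
      using ev unfolding eigen_def band_op_bound(1)[OF Bmat_band] by blast
    ultimately show ?thesis by (simp only: gweight_def sum_distrib_left mult.assoc) (simp add: algebra_simps)
  qed
  have "(\<lambda>k. (rinner \<alpha> g (p k))\<^sup>2) sums rinner \<alpha> g g" by (rule gpoly_Parseval[OF alpha_nonneg gL])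
  then have "rinner \<alpha> g g = 0" unfolding gc by (simp add: sums_iff)
  then have g2: "(\<integral>x. (g x)\<^sup>2 \<partial>weighted_measure \<alpha>) = 0" by (simp add: rinner_def power2_eq_square)
  have gi: "integrable (weighted_measure \<alpha>) (\<lambda>x. (g x)\<^sup>2)" using gL by (simp add: rL2_def)
  have gC: "continuous_on {-1<..<1} g" unfolding g_def[abs_def]
    by (intro continuous_intros continuous_on_subset[OF yC] continuous_on_subset[OF zC]) auto
  have ode: "(x\<^sup>2 - 1) * S ?u 2 x + 2 * (\<alpha> + 1) * x * S ?u 1 x + c\<^sup>2 * x\<^sup>2 * ?y x = (\<mu> - 1) * ?y x"
    if x: "x \<in> {-1<..<1}" for x
    using integral_square_zero_imp_zero[OF gi g2 gC x] ode0[of x] x by (simp add: g_def algebra_simps)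
  have dy: "deriv ?y x = S ?u 1 x" if "x \<in> {-1<..<1}" for x
    using dS[OF that, of 0] by (simp add: DERIV_imp_deriv)
  have fl: "((\<lambda>t. jacobi_weight \<alpha> t * (1 - t\<^sup>2) * deriv ?y t) has_real_derivative
      jacobi_weight \<alpha> x * ((1 - x\<^sup>2) * S ?u 2 x - 2 * (\<alpha> + 1) * x * S ?u 1 x)) (at x)" if x: "x \<in> {-1<..<1}" for x
  proof -
    have "((\<lambda>t. jacobi_weight (\<alpha> + 1) t * S ?u 1 t) has_real_derivative
       (- 2 * (\<alpha> + 1) * x * jacobi_weight \<alpha> x) * S ?u 1 x + S ?u (Suc 1) x * jacobi_weight (\<alpha> + 1) x) (at x)"
      by (intro DERIV_mult jacobi_weight_has_derivative x dS) simp
    moreover have "(- 2 * (\<alpha> + 1) * x * jacobi_weight \<alpha> x) * S ?u 1 x + S ?u (Suc 1) x * jacobi_weight (\<alpha> + 1) x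
        = jacobi_weight \<alpha> x * ((1 - x\<^sup>2) * S ?u 2 x - 2 * (\<alpha> + 1) * x * S ?u 1 x)"
      using x by (subst jacobi_weight_Suc) (auto simp: algebra_simps numeral_2_eq_2)
    ultimately have "((\<lambda>t. jacobi_weight (\<alpha> + 1) t * S ?u 1 t) has_real_derivative
      jacobi_weight \<alpha> x * ((1 - x\<^sup>2) * S ?u 2 x - 2 * (\<alpha> + 1) * x * S ?u 1 x)) (at x)" by simp
    then show ?thesis
    proof (rule has_field_derivative_transform_within_open[of _ _ _ "{-1<..<1}"])
      show "jacobi_weight (\<alpha> + 1) t * S ?u 1 t = jacobi_weight \<alpha> t * (1 - t\<^sup>2) * deriv ?y t" if "t \<in> {-1<..<1}" for t
        using that by (subst jacobi_weight_Suc) (auto simp: dy)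
    qed (use x in auto)
  qed
  have ynz: "\<exists>x\<in>{-1<..<1}. ?y x \<noteq> 0"
  proof (rule ccontr)
    assume "\<not> ?thesis"
    then have z: "?y x = 0" if "x \<in> {-1<..<1}" for x using that by blast
    have "?u k = 0" for k
    proof -
      have "rinner \<alpha> ?y (p k) = 0" unfolding rinner_def
        by (rule integral_weighted_zero_interior[OF _ alpha_pos])
          (use z borel_measurable_times[OF rL2_measurable[OF yL] rL2_measurable[OF p_rL2]] measurable_weighted_iff in auto)
      then show ?thesis by (simp add: yc)
    qed
    then have "u = 0" by (intro ell2_eqI) simp
    then show False using u by simp
  qed
  have "bounded_eigenfunction \<alpha> c (\<mu> - 1) ?y"
    unfolding bounded_eigenfunction_def
  proof (intro conjI ballI ynz)
    show "bounded (?y ` {-1..1})" unfolding bounded_iff using Cy by (intro exI[of _ Cy]) simp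
    fix x :: real assume x: "x \<in> {-1<..<1}"
    show "?y differentiable (at x)" unfolding real_differentiable_def using dS[OF x, of 0] by blast
    show "(\<lambda>t. jacobi_weight \<alpha> t * (1 - t\<^sup>2) * deriv ?y t) differentiable (at x)"
      unfolding real_differentiable_def using fl[OF x] by blast
    show "sturm_liouville \<alpha> c ?y x = (\<mu> - 1) * ?y x"
      unfolding sturm_liouville_def DERIV_imp_deriv[OF fl[OF x]] ode[OF x, symmetric]
      using jacobi_weight_pos[OF x, of \<alpha>] by (simp add: algebra_simps)
  qed
  moreover have "gcoeffs ?y = u" by (rule ell2_eqI) (simp add: gcoeffs_props[OF yL] yc)
  ultimately show ?thesis using that yL by blast
qed

text \<open>
  Green's identity between the eigenfunction and \<open>gpoly \<alpha> k\<close>; the boundary terms vanish since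
  the flux of a bounded eigenfunction does.
\<close>

lemma eigenvector_of_eigenfunction:
  assumes ef: "bounded_eigenfunction \<alpha> c m f"
  shows "f \<in> rL2 \<alpha>" "eigen (m + 1) (gcoeffs f)"
proof -
  note F = bounded_eigenfunction_facts[OF alpha_pos ef]
  obtain C where C: "\<And>x. x \<in> {-1..1} \<Longrightarrow> \<bar>f x\<bar> \<le> C" using F(4) by blast
  have fm: "f \<in> borel_measurable (weighted_measure \<alpha>)" unfolding measurable_weighted_iff
    by (rule measurable_of_continuous_interior[OF F(7)])
  show fL: "f \<in> rL2 \<alpha>" by (rule rL2_bounded[OF alpha_nonneg fm C])
  have x2m: "(\<lambda>x. x\<^sup>2 * f x) \<in> borel_measurable (weighted_measure \<alpha>)" unfolding measurable_weighted_iff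
    by (rule measurable_of_continuous_interior) (intro continuous_intros F(7))
  have sq: "x\<^sup>2 \<le> 1" if "x \<in> {-1..1}" for x :: real using that by (simp add: abs_square_le_1 abs_le_iff)
  have x2L: "(\<lambda>x. x\<^sup>2 * f x) \<in> rL2 \<alpha>"
  proof (rule rL2_bounded[OF alpha_nonneg x2m])
    fix x :: real assume x: "x \<in> {-1..1}"
    have "x\<^sup>2 * \<bar>f x\<bar> \<le> 1 * C" using C[OF x] sq[OF x] by (intro mult_mono) auto
    then show "\<bar>x\<^sup>2 * f x\<bar> \<le> C" by (simp add: abs_mult)
  qed
  have key: "c\<^sup>2 * rinner \<alpha> (\<lambda>x. x\<^sup>2 * f x) (p k) - m * rinner \<alpha> f (p k) + gegen_eigenvalue \<alpha> k * rinner \<alpha> f (p k) = 0" for k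
  proof -
    let ?\<mu> = "gegen_eigenvalue \<alpha> k"
    define h where "h x = (c\<^sup>2 * (x\<^sup>2 * f x) - m * f x + ?\<mu> * f x) * p k x" for x
    obtain P where P: "\<forall>x\<in>{-1..1}. \<bar>p k x\<bar> \<le> P" using poly_bounded_on_interval by blast
    obtain Q where Q: "\<forall>x\<in>{-1..1}. \<bar>poly (pderiv (gpoly \<alpha> k)) x\<bar> \<le> Q" using poly_bounded_on_interval by blast
    have "\<bar>poly (pderiv (gpoly \<alpha> k)) 0\<bar> \<le> Q" using Q by simp
    then have Q0: "0 \<le> Q" using abs_ge_zero order_trans by blast
    define W where "W x = flux \<alpha> f x * p k x - (jacobi_weight (\<alpha> + 1) x * poly (pderiv (gpoly \<alpha> k)) x) * f x" for x
    have "(\<integral>x. h x \<partial>weighted_measure \<alpha>) = 0"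
    proof (rule integral_of_flux_derivative[OF alpha_nonneg, where W = W and C = "(c\<^sup>2 * C + \<bar>m\<bar> * C + \<bar>?\<mu>\<bar> * C) * P"])
      fix x :: real assume x: "x \<in> {-1<..<1}"
      then have x': "x \<in> {-1..1}" by auto
      have "(W has_real_derivative
          (jacobi_weight \<alpha> x * (c\<^sup>2 * x\<^sup>2 - m) * f x * p k x + poly (pderiv (gpoly \<alpha> k)) x * flux \<alpha> f x)
          - ((- ?\<mu> * jacobi_weight \<alpha> x * p k x) * f x
            + deriv f x * (jacobi_weight (\<alpha> + 1) x * poly (pderiv (gpoly \<alpha> k)) x))) (at x)"
        unfolding W_def[abs_def]
        by (intro DERIV_diff DERIV_mult F(3) F(1) x poly_DERIV flux_has_derivative gegen_op_gpoly)
      then show "(W has_real_derivative jacobi_weight \<alpha> x * h x) (at x)"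
        by (rule DERIV_cong) (simp add: h_def F(2)[OF x] algebra_simps)
      have "\<bar>c\<^sup>2 * (x\<^sup>2 * f x) - m * f x + ?\<mu> * f x\<bar> \<le> c\<^sup>2 * C + \<bar>m\<bar> * C + \<bar>?\<mu>\<bar> * C"
      proof -
        have "x\<^sup>2 * \<bar>f x\<bar> \<le> 1 * C" using C[OF x'] sq[OF x'] by (intro mult_mono) auto
        then have "\<bar>c\<^sup>2 * (x\<^sup>2 * f x)\<bar> \<le> c\<^sup>2 * C" by (simp add: abs_mult mult_left_mono)
        moreover have "\<bar>m * f x\<bar> \<le> \<bar>m\<bar> * C" "\<bar>?\<mu> * f x\<bar> \<le> \<bar>?\<mu>\<bar> * C"
          unfolding abs_mult using C[OF x'] by (simp_all add: mult_left_mono)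
        ultimately show ?thesis by linarith
      qed
      then show "\<bar>h x\<bar> \<le> (c\<^sup>2 * C + \<bar>m\<bar> * C + \<bar>?\<mu>\<bar> * C) * P"
        unfolding h_def abs_mult using P x' by (intro mult_mono) auto
    next
      have evl: "\<forall>\<^sub>F x in at_left (1::real). x \<in> {-1<..<1}" by (rule eventually_at_left_real) simp
      have evr: "\<forall>\<^sub>F x in at_right (-1::real). x \<in> {-1<..<1}" by (rule eventually_at_right_real) simp
      have "(W \<longlongrightarrow> 0 - 0) (at_left 1)" unfolding W_def[abs_def] mult.assoc
      proof (intro tendsto_diff tendsto_bounded_mult_zero F(5) jacobi_weight_tendsto_0 alpha_nonneg)
        show "\<forall>\<^sub>F x in at_left 1. \<bar>p k x\<bar> \<le> P"
          by (rule eventually_mono[OF evl]) (use P in auto)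
        show "\<forall>\<^sub>F x in at_left 1. \<bar>poly (pderiv (gpoly \<alpha> k)) x * f x\<bar> \<le> Q * C"
          by (rule eventually_mono[OF evl]) (use Q C Q0 in \<open>auto simp: abs_mult intro!: mult_mono\<close>)
      qed
      then show "(W \<longlongrightarrow> 0) (at_left 1)" by simp
      have "(W \<longlongrightarrow> 0 - 0) (at_right (-1))" unfolding W_def[abs_def] mult.assoc
      proof (intro tendsto_diff tendsto_bounded_mult_zero F(6) jacobi_weight_tendsto_0 alpha_nonneg)
        show "\<forall>\<^sub>F x in at_right (-1). \<bar>p k x\<bar> \<le> P"
          by (rule eventually_mono[OF evr]) (use P in auto)
        show "\<forall>\<^sub>F x in at_right (-1). \<bar>poly (pderiv (gpoly \<alpha> k)) x * f x\<bar> \<le> Q * C"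
          by (rule eventually_mono[OF evr]) (use Q C Q0 in \<open>auto simp: abs_mult intro!: mult_mono\<close>)
      qed
      then show "(W \<longlongrightarrow> 0) (at_right (-1))" by simp
      show "continuous_on {-1<..<1} h" unfolding h_def[abs_def] by (intro continuous_intros F(7))
    qed
    then have "rinner \<alpha> (\<lambda>x. c\<^sup>2 * (x\<^sup>2 * f x) - m * f x + ?\<mu> * f x) (p k) = 0"
      by (simp only: rinner_def h_def)
    then show ?thesis
      by (simp only: rinner_add_left[OF rL2_diff[OF rL2_cmult[OF x2L] rL2_cmult[OF fL]] rL2_cmult[OF fL] p_rL2]
          rinner_diff_left[OF rL2_cmult[OF x2L] rL2_cmult[OF fL] p_rL2] rinner_cmult_left)
  qed
  have x2c: "rinner \<alpha> (\<lambda>x. x\<^sup>2 * f x) (p k) = (\<Sum>j\<le>k + 2. xsq_matrix \<alpha> k j * rinner \<alpha> f (p j))" for k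
  proof -
    have "rinner \<alpha> (\<lambda>x. x\<^sup>2 * f x) (p k) = rinner \<alpha> (\<lambda>x. x\<^sup>2 * p k x) f" by (simp add: rinner_def mult_ac)
    also have "\<dots> = rinner \<alpha> (\<lambda>x. \<Sum>j\<le>k + 2. xsq_matrix \<alpha> j k * p j x) f"
      by (subst xsq_expand[OF alpha_nonneg]) simp
    also have "\<dots> = (\<Sum>j\<le>k + 2. xsq_matrix \<alpha> j k * rinner \<alpha> (p j) f)"
      by (subst rinner_sum_left) (auto simp: rL2_cmult p_rL2 fL rinner_cmult_left)
    finally show ?thesis by (simp only: rinner_commute[of \<alpha> _ f] xsq_matrix_sym[of \<alpha> _ k])
  qed
  show "eigen (m + 1) (gcoeffs f)"
    unfolding eigen_def band_op_bound(1)[OF Bmat_band] gcoeffs_props(1)[OF fL]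
  proof
    fix k
    have "(\<Sum>j\<le>k + 2. Bmat k j * rinner \<alpha> f (p j)) = c\<^sup>2 * rinner \<alpha> (\<lambda>x. x\<^sup>2 * f x) (p k)"
      unfolding x2c sum_distrib_left mult.assoc ..
    then show "lam k * rinner \<alpha> f (p k) + (\<Sum>j\<le>k + 2. Bmat k j * rinner \<alpha> f (p j)) = (m + 1) * rinner \<alpha> f (p k)"
      using key[of k] by (simp add: gweight_def algebra_simps)
  qed
qed

text \<open>
  The family lists all eigenvalues. So an eigenvector orthogonal to the first \<open>N + 1\<close> members
  belongs to some \<open>chi j\<close>, and \<open>j \<le> N\<close> would make it a multiple of the member \<open>j\<close>.
\<close>

lemma family_spectral:
  assumes fam: "gpswf_family \<alpha> c chi \<psi>"
  shows "\<psi> n \<in> rL2 \<alpha>" "eigen_upto N (\<lambda>i. chi i + 1) (\<lambda>i. gcoeffs (\<psi> i))"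
    "spectral_gap N (\<lambda>i. gcoeffs (\<psi> i)) (chi (Suc N) + 1)"
proof -
  have mono: "strict_mono chi" and ran: "range chi = eigenvalues \<alpha> c"
    and ef: "\<And>n. bounded_eigenfunction \<alpha> c (chi n) (\<psi> n)"
    and nrm: "\<And>n. weighted_norm \<alpha> (\<lambda>x. complex_of_real (\<psi> n x)) = 1"
    using fam by (auto simp: gpswf_family_def)
  show L: "\<psi> n \<in> rL2 \<alpha>" for n by (rule eigenvector_of_eigenfunction(1)[OF ef])
  have ev: "eigen (chi n + 1) (gcoeffs (\<psi> n))" for n by (rule eigenvector_of_eigenfunction(2)[OF ef])
  have one: "inner (gcoeffs (\<psi> n)) (gcoeffs (\<psi> n)) = 1" for n
    using nrm[of n] unfolding weighted_norm_def inner_gcoeffs[OF L L] rinner_def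
    by (simp add: real_sqrt_eq_1_iff power2_eq_square)
  have orth: "inner (gcoeffs (\<psi> i)) (gcoeffs (\<psi> j)) = 0" if "i \<noteq> j" for i j
  proof (rule eigen_orthogonal[OF ev ev])
    show "chi i + 1 \<noteq> chi j + 1" using that strict_mono_eq[OF mono] by simp
  qed
  show "eigen_upto N (\<lambda>i. chi i + 1) (\<lambda>i. gcoeffs (\<psi> i))"
    unfolding eigen_upto_def orthonormal_upto_def using ev one orth by auto
  show "spectral_gap N (\<lambda>i. gcoeffs (\<psi> i)) (chi (Suc N) + 1)"
    unfolding spectral_gap_def
  proof (intro allI impI)
    fix m u assume u: "eigen m u" "u \<noteq> 0" and o: "\<forall>i\<le>N. inner u (gcoeffs (\<psi> i)) = 0"
    obtain y where y: "bounded_eigenfunction \<alpha> c (m - 1) y" "y \<in> rL2 \<alpha>" "gcoeffs y = u"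
      by (rule eigenfunction_of_eigenvector[OF u])
    have "m - 1 \<in> range chi" unfolding ran eigenvalues_def using y(1) by blast
    then obtain j where j: "m - 1 = chi j" by blast
    have "\<not> j \<le> N"
    proof
      assume jN: "j \<le> N"
      obtain a b where ab: "a \<noteq> 0 \<or> b \<noteq> 0" "\<And>x. x \<in> {-1<..<1} \<Longrightarrow> a * y x + b * \<psi> j x = 0"
        by (rule eigenvalue_simple[OF alpha_pos y(1)[unfolded j] ef[of j]]) blast
      have "a *\<^sub>R u + b *\<^sub>R gcoeffs (\<psi> j) = 0"
      proof (rule ell2_eqI)
        fix k
        have zL: "(\<lambda>x. a * y x + b * \<psi> j x) \<in> rL2 \<alpha>" by (intro rL2_add rL2_cmult y L)
        have "rinner \<alpha> (\<lambda>x. a * y x + b * \<psi> j x) (p k) = 0" unfolding rinner_def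
        proof (rule integral_weighted_zero_interior[OF _ alpha_pos])
          show "(\<lambda>x. (a * y x + b * \<psi> j x) * p k x) \<in> borel_measurable (lebesgue_on {-1..1})"
            using borel_measurable_times[OF rL2_measurable[OF zL] rL2_measurable[OF p_rL2[of k]]]
            unfolding measurable_weighted_iff .
        qed (simp add: ab)
        then show "coord (a *\<^sub>R u + b *\<^sub>R gcoeffs (\<psi> j)) k = coord 0 k"
          unfolding rinner_add_left[OF rL2_cmult[OF y(2)] rL2_cmult[OF L] p_rL2] rinner_cmult_left
          by (simp add: y(3)[symmetric] gcoeffs_props(1) y(2) L)
      qed
      moreover from this have "inner (a *\<^sub>R u + b *\<^sub>R gcoeffs (\<psi> j)) (gcoeffs (\<psi> j)) = 0" by simp
      then have "b = 0" using o jN one[of j] by (simp add: inner_add_left)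
      ultimately show False using ab(1) u(2) by simp
    qed
    then have "chi (Suc N) \<le> chi j" using mono by (simp add: strict_mono_less_eq)
    then show "chi (Suc N) + 1 \<le> m" using j by simp
  qed
qed

text \<open>
  The choice \<open>J = (N + 1) div 2\<close> in the trace inequality leaves half of the mass above \<open>J\<close>.
\<close>

lemma family_growth:
  assumes fam: "gpswf_family \<alpha> c chi \<psi>" and N: "1 \<le> N"
  shows "(1 + (real N / 2)\<^sup>2) / 2 \<le> chi N + 1"
proof -
  have mono: "strict_mono chi" using fam by (simp add: gpswf_family_def)
  define J where "J = (N + 1) div 2"
  have J: "J \<le> N" "real N / 2 \<le> real J" "real (N + 1) / 2 \<le> real (N + 1 - J)" using N by (auto simp: J_def)
  have le: "lam J * real (N + 1 - J) \<le> real (N + 1) * (chi N + 1)"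
    by (rule eigenvalue_growth[OF family_spectral(2)[OF fam]])
       (use mono J(1) lam_mono in \<open>auto simp: strict_mono_less_eq\<close>)
  have l: "1 + (real N / 2)\<^sup>2 \<le> lam J"
    using gweight_ge[OF alpha_nonneg, of J] power_mono[OF J(2), of 2] by linarith
  have "(1 + (real N / 2)\<^sup>2) * (real (N + 1) / 2) \<le> lam J * real (N + 1 - J)"
    using l J(3) by (intro mult_mono) auto
  also note le
  finally have "real (N + 1) * ((1 + (real N / 2)\<^sup>2) / 2) \<le> real (N + 1) * (chi N + 1)" by (simp add: mult_ac)
  then show ?thesis by (rule mult_left_le_imp_le) simp
qed

lemma family_rate:
  "\<exists>K\<ge>0. \<forall>chi \<psi> N w. gpswf_family \<alpha> c chi \<psi> \<longrightarrow> 1 \<le> N \<longrightarrow>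
     norm (proj_compl N (\<lambda>i. gcoeffs (\<psi> i)) ((T ^^ m) w)) \<le> K * (1 + (real N / 2)\<^sup>2) powr (- real m / 2) * norm w"
proof -
  obtain K where K: "0 \<le> K" "\<And>N \<mu> v X w. eigen_upto N \<mu> v \<Longrightarrow> spectral_gap N v X \<Longrightarrow> 0 < X \<Longrightarrow>
     norm (proj_compl N v ((T ^^ m) w)) \<le> K * X powr (- real m / 2) * norm w"
    using approx_rate[of m] by blast
  show ?thesis
  proof (rule exI[of _ "K * 2 powr (real m / 2)"], intro conjI allI impI)
    show "0 \<le> K * 2 powr (real m / 2)" using K(1) by simp
    fix chi \<psi> N w assume fam: "gpswf_family \<alpha> c chi \<psi>" and N: "(1::nat) \<le> N"
    define Y where "Y = 1 + (real N / 2)\<^sup>2"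
    define X where "X = chi (Suc N) + 1"
    have Y: "0 < Y" unfolding Y_def by (rule add_pos_nonneg) auto
    have "strict_mono chi" using fam by (simp add: gpswf_family_def)
    then have "chi N \<le> chi (Suc N)" by (simp add: strict_mono_less_eq)
    then have X: "Y / 2 \<le> X" using family_growth[OF fam N] by (simp add: Y_def X_def)
    have "X powr (- real m / 2) \<le> (Y / 2) powr (- real m / 2)"
      using X Y by (intro powr_mono2') auto
    also have "\<dots> = 2 powr (real m / 2) * Y powr (- real m / 2)"
      by (simp add: powr_divide powr_minus field_simps)
    finally have XY: "X powr (- real m / 2) \<le> 2 powr (real m / 2) * Y powr (- real m / 2)" .
    have "norm (proj_compl N (\<lambda>i. gcoeffs (\<psi> i)) ((T ^^ m) w)) \<le> K * X powr (- real m / 2) * norm w"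
      unfolding X_def
      by (rule K(2)[OF family_spectral(2)[OF fam] family_spectral(3)[OF fam]]) (use X Y in \<open>simp add: X_def\<close>)
    also have "\<dots> \<le> K * (2 powr (real m / 2) * Y powr (- real m / 2)) * norm w"
      using K(1) XY by (intro mult_right_mono mult_left_mono) auto
    finally show "norm (proj_compl N (\<lambda>i. gcoeffs (\<psi> i)) ((T ^^ m) w))
        \<le> K * 2 powr (real m / 2) * (1 + (real N / 2)\<^sup>2) powr (- real m / 2) * norm w"
      by (simp add: Y_def mult.assoc)
  qed
qed

end

section \<open>Smooth cutoffs and weak derivatives\<close>

text \<open>
  The functions \<open>q(1/z) exp(-1/z)\<close>, extended by zero: a class of functions closed under differentiation
  that contains the standard example of a smooth function with support in a half-line.
\<close>

definition flat :: "real poly \<Rightarrow> real \<Rightarrow> real" where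
  "flat q z = (if 0 < z then poly q (1 / z) * exp (- (1 / z)) else 0)"

lemma poly_times_exp_tendsto_0: "((\<lambda>t. poly q t * exp (- t)) \<longlongrightarrow> (0::real)) at_top"
proof -
  have "((\<lambda>t. \<Sum>i\<le>degree q. coeff q i * (t ^ i / exp t)) \<longlongrightarrow> (\<Sum>i\<le>degree q. coeff q i * 0)) at_top"
    by (intro tendsto_sum tendsto_mult tendsto_const tendsto_power_div_exp_0)
  moreover have "poly q t * exp (- t) = (\<Sum>i\<le>degree q. coeff q i * (t ^ i / exp t))" for t
    by (simp add: poly_altdef sum_distrib_right exp_minus divide_inverse mult.assoc)
  ultimately show ?thesis by simp
qed

lemma flat_has_derivative:
  "(flat q has_real_derivative flat ([:0, 0, 1:] * (q - pderiv q)) z) (at z)"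
proof -
  consider "z > 0" | "z < 0" | "z = 0" by linarith
  then show ?thesis
  proof cases
    case 1
    have "((\<lambda>z. poly q (1 / z) * exp (- (1 / z))) has_real_derivative
       poly (pderiv q) (1 / z) * (- (1 / z\<^sup>2)) * exp (- (1 / z)) + exp (- (1 / z)) * (1 / z\<^sup>2) * poly q (1 / z)) (at z)"
    proof (rule DERIV_mult)
      have i: "((\<lambda>z. 1 / z) has_real_derivative - (1 / z\<^sup>2)) (at z)"
        using 1 by (auto intro!: derivative_eq_intros simp: power2_eq_square)
      show "((\<lambda>z. poly q (1 / z)) has_real_derivative poly (pderiv q) (1 / z) * (- (1 / z\<^sup>2))) (at z)"
        by (rule DERIV_chain2[OF poly_DERIV i])
      show "((\<lambda>z. exp (- (1 / z))) has_real_derivative exp (- (1 / z)) * (1 / z\<^sup>2)) (at z)"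
        using DERIV_chain2[OF DERIV_exp DERIV_minus[OF i]] by simp
    qed
    moreover have "poly (pderiv q) (1 / z) * (- (1 / z\<^sup>2)) * exp (- (1 / z)) + exp (- (1 / z)) * (1 / z\<^sup>2) * poly q (1 / z)
        = flat ([:0, 0, 1:] * (q - pderiv q)) z"
      using 1 by (simp add: flat_def power2_eq_square field_simps)
    ultimately have "((\<lambda>z. poly q (1 / z) * exp (- (1 / z))) has_real_derivative flat ([:0, 0, 1:] * (q - pderiv q)) z) (at z)"
      by simp
    then show ?thesis
      by (rule has_field_derivative_transform_within_open[of _ _ _ "{0<..}"]) (use 1 in \<open>auto simp: flat_def\<close>)
  next
    case 2
    have "((\<lambda>z. 0) has_real_derivative flat ([:0, 0, 1:] * (q - pderiv q)) z) (at z)"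
      using 2 by (simp add: flat_def)
    then show ?thesis
      by (rule has_field_derivative_transform_within_open[of _ _ _ "{..<0}"]) (use 2 in \<open>auto simp: flat_def\<close>)
  next
    case 3
    have "((\<lambda>h. flat q h / h) \<longlongrightarrow> 0) (at 0)"
    proof (rule filterlim_split_at)
      show "((\<lambda>h. flat q h / h) \<longlongrightarrow> 0) (at_left 0)"
        by (rule tendsto_eventually, rule eventually_mono[OF eventually_at_left_real[of "-1" 0]]) (auto simp: flat_def)
      have "((\<lambda>h. poly ([:0, 1:] * q) (inverse h) * exp (- inverse h)) \<longlongrightarrow> 0) (at_right 0)"
        by (rule filterlim_compose[OF poly_times_exp_tendsto_0 filterlim_inverse_at_top_right])
      moreover have "\<forall>\<^sub>F h in at_right 0. poly ([:0, 1:] * q) (inverse h) * exp (- inverse h) = flat q h / h"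
        by (rule eventually_mono[OF eventually_at_right_real[of 0 1]]) (auto simp: flat_def field_simps)
      ultimately show "((\<lambda>h. flat q h / h) \<longlongrightarrow> 0) (at_right 0)" by (rule Lim_transform_eventually)
    qed
    then show ?thesis unfolding 3 DERIV_def by (simp add: flat_def)
  qed
qed

text \<open>
  The third bound controls the derivative of the cutoff: in \<open>z = n (1 - x\<^sup>2) - 1\<close> that derivative
  contains a factor \<open>n\<close>, which the weight turns into \<open>z + 1\<close>.
\<close>

lemma flat_bounds:
  shows "0 \<le> flat 1 z" "flat 1 z \<le> 1" "\<bar>(z + 1) * flat [:0, 0, 1:] z\<bar> \<le> 3"
proof -
  show "0 \<le> flat 1 z" "flat 1 z \<le> 1" by (auto simp: flat_def)
  show "\<bar>(z + 1) * flat [:0, 0, 1:] z\<bar> \<le> 3"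
  proof (cases "0 < z")
    case True
    define t where "t = 1 / z"
    have t: "0 < t" using True by (simp add: t_def)
    have "(z + 1) * flat [:0, 0, 1:] z = (t + t\<^sup>2) * exp (- t)"
      using True by (simp add: flat_def t_def power2_eq_square field_simps)
    also have "\<dots> = (t + t\<^sup>2) / exp t" by (simp add: exp_minus divide_inverse)
    also have "\<dots> \<le> 3"
    proof -
      have "1 + t + t\<^sup>2 / 2 \<le> exp t" using exp_lower_Taylor_quadratic[of t] t by simp
      then have "t + t\<^sup>2 \<le> 3 * exp t" using t zero_le_power2[of t] by linarith
      then show ?thesis by (simp add: divide_le_eq)
    qed
    finally have "(z + 1) * flat [:0, 0, 1:] z \<le> 3" .
    moreover have "0 \<le> (z + 1) * flat [:0, 0, 1:] z" using True by (simp add: flat_def)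
    ultimately show ?thesis by simp
  qed (simp add: flat_def)
qed

lemma flat_tendsto:
  assumes "filterlim z at_top sequentially"
  shows "(\<lambda>n. flat 1 (z n)) \<longlonglongrightarrow> 1"
proof -
  have "(\<lambda>n. exp (- inverse (z n))) \<longlonglongrightarrow> exp (- 0)"
    by (intro tendsto_intros tendsto_inverse_0_at_top assms)
  moreover have "\<forall>\<^sub>F n in sequentially. 0 < z n" using assms by (rule eventually_compose_filterlim[OF eventually_gt_at_top])
  then have "\<forall>\<^sub>F n in sequentially. exp (- inverse (z n)) = flat 1 (z n)"
    by eventually_elim (simp add: flat_def inverse_eq_divide)
  ultimately show ?thesis using Lim_transform_eventually by fastforce
qed

text \<open>
  For \<open>q = 1\<close> this is the weighted polynomial \<open>\<omega>\<^sub>\<beta> p\<close> times a smooth cutoff that vanishes for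
  \<open>1 - x\<^sup>2 \<le> 1 / n\<close> and tends to \<open>1\<close> inside the interval as \<open>n\<close> grows. General \<open>q\<close> arise in its
  derivatives.
\<close>

definition cutoff_weight :: "real \<Rightarrow> real poly \<Rightarrow> real \<Rightarrow> real poly \<Rightarrow> real \<Rightarrow> real" where
  "cutoff_weight n q \<beta> p x = flat q (n * (1 - x\<^sup>2) - 1) * jacobi_weight \<beta> x * poly p x"

lemma cutoff_weight_zero: "0 < n \<Longrightarrow> n * (1 - x\<^sup>2) \<le> 1 \<Longrightarrow> cutoff_weight n q \<beta> p x = 0"
  by (simp add: cutoff_weight_def flat_def)

text \<open>
  Closed under differentiation, so that its members are smooth without any bookkeeping of
  higher derivatives.
\<close>

inductive_set cutoff_class :: "real \<Rightarrow> (real \<Rightarrow> real) set" for n where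
  base: "cutoff_weight n q \<beta> p \<in> cutoff_class n"
| add: "f \<in> cutoff_class n \<Longrightarrow> g \<in> cutoff_class n \<Longrightarrow> (\<lambda>x. f x + g x) \<in> cutoff_class n"

definition cutoff_weight_deriv :: "real \<Rightarrow> real poly \<Rightarrow> real \<Rightarrow> real poly \<Rightarrow> real \<Rightarrow> real" where
  "cutoff_weight_deriv n q \<beta> p x =
     cutoff_weight n ([:0, 0, 1:] * (q - pderiv q)) \<beta> ([:0, - 2 * n:] * p) x
     + (cutoff_weight n q (\<beta> - 1) ([:0, - 2 * \<beta>:] * p) x + cutoff_weight n q \<beta> (pderiv p) x)"

lemma cutoff_weight_has_derivative:
  assumes n: "0 < n"
  shows "(cutoff_weight n q \<beta> p has_real_derivative cutoff_weight_deriv n q \<beta> p x) (at x)"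
proof -
  let ?z = "\<lambda>x. n * (1 - x\<^sup>2) - 1"
  show ?thesis
  proof (cases "1 - x\<^sup>2 > 0")
    case True
    then have x: "x \<in> {-1<..<1}" by (simp add: abs_square_less_1 abs_less_iff)
    have dz: "(?z has_real_derivative - 2 * n * x) (at x)"
      by (auto intro!: derivative_eq_intros)
    have dw: "(jacobi_weight \<beta> has_real_derivative - 2 * \<beta> * x * jacobi_weight (\<beta> - 1) x) (at x)"
      using jacobi_weight_has_derivative[OF x, of "\<beta> - 1"] by simp
    have "((\<lambda>x. flat q (?z x) * jacobi_weight \<beta> x * poly p x) has_real_derivative
       (flat ([:0, 0, 1:] * (q - pderiv q)) (?z x) * (- 2 * n * x) * jacobi_weight \<beta> x
         + (- 2 * \<beta> * x * jacobi_weight (\<beta> - 1) x) * flat q (?z x)) * poly p x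
       + poly (pderiv p) x * (flat q (?z x) * jacobi_weight \<beta> x)) (at x)"
      by (intro DERIV_mult DERIV_chain2[OF flat_has_derivative dz] dw poly_DERIV)
    then show ?thesis
      unfolding cutoff_weight_def[abs_def]
      by (rule DERIV_cong) (simp add: cutoff_weight_deriv_def cutoff_weight_def algebra_simps)
  next
    case False
    then have z: "n * (1 - x\<^sup>2) \<le> 0" using n by (simp add: mult_le_0_iff)
    have op: "open {x. ?z x < 0}" by (intro open_Collect_less continuous_intros)
    have "((\<lambda>x. 0) has_real_derivative cutoff_weight_deriv n q \<beta> p x) (at x)"
      unfolding cutoff_weight_deriv_def using z n by (simp add: cutoff_weight_zero)
    then show ?thesis
      by (rule has_field_derivative_transform_within_open[OF _ op]) (use z n in \<open>auto simp: cutoff_weight_zero\<close>)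
  qed
qed

lemma cutoff_class_deriv:
  assumes "0 < n" "f \<in> cutoff_class n"
  shows "\<exists>g\<in>cutoff_class n. \<forall>x. (f has_real_derivative g x) (at x)"
  using assms(2)
proof induction
  case (base q \<beta> p)
  have "cutoff_weight_deriv n q \<beta> p \<in> cutoff_class n"
    unfolding cutoff_weight_deriv_def[abs_def] by (intro cutoff_class.intros)
  then show ?case using cutoff_weight_has_derivative[OF assms(1)] by blast
next
  case (add f g)
  then obtain f' g' where d: "f' \<in> cutoff_class n" "g' \<in> cutoff_class n"
    "\<forall>x. (f has_real_derivative f' x) (at x)" "\<forall>x. (g has_real_derivative g' x) (at x)" by blast
  show ?case
    by (rule bexI[of _ "\<lambda>x. f' x + g' x"]) (use d in \<open>auto intro: cutoff_class.add DERIV_add\<close>)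
qed

lemma cutoff_class_test_function:
  assumes n: "1 \<le> n" and f: "f \<in> cutoff_class n"
  shows "test_function f"
proof -
  have n0: "0 < n" using n by simp
  have "(deriv ^^ k) f \<in> cutoff_class n" for k
  proof (induction k)
    case (Suc k)
    obtain g where g: "g \<in> cutoff_class n" "\<forall>x. ((deriv ^^ k) f has_real_derivative g x) (at x)"
      using cutoff_class_deriv[OF n0 Suc] by blast
    have "(deriv ^^ Suc k) f = g" using g(2) by (auto simp: fun_eq_iff intro: DERIV_imp_deriv)
    then show ?case using g(1) by simp
  qed (use f in simp)
  then have d: "(deriv ^^ k) f differentiable (at x)" for k x
    unfolding real_differentiable_def using cutoff_class_deriv[OF n0] by blast
  have supp: "f x = 0" if "n * (1 - x\<^sup>2) \<le> 1" for x
    using f that by induction (auto simp: cutoff_weight_zero n0)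
  define r where "r = sqrt (1 - 1 / n)"
  have r: "0 \<le> r" "r < 1" using n by (auto simp: r_def)
  have "f x = 0" if "x \<notin> {-r..r}" for x
  proof (rule supp)
    have "r < \<bar>x\<bar>" using that by auto
    then have "r\<^sup>2 \<le> \<bar>x\<bar>\<^sup>2" using r by (intro power_mono) auto
    then have "1 - x\<^sup>2 \<le> 1 / n" using n by (simp add: r_def)
    then show "n * (1 - x\<^sup>2) \<le> 1" using n by (simp add: field_simps)
  qed
  then show ?thesis unfolding test_function_def using d r by (intro conjI allI exI[of _ "-r"] exI[of _ r]) auto
qed

lemma cutoff_weight_test: "1 \<le> n \<Longrightarrow> test_function (cutoff_weight n q \<beta> p)"
  by (rule cutoff_class_test_function[OF _ cutoff_class.base])

lemma deriv_cutoff_weight: "0 < n \<Longrightarrow> deriv (cutoff_weight n q \<beta> p) = cutoff_weight_deriv n q \<beta> p"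
  using cutoff_weight_has_derivative by (auto simp: fun_eq_iff intro: DERIV_imp_deriv)

lemma test_function_deriv: "test_function \<phi> \<Longrightarrow> test_function (deriv \<phi>)"
proof -
  assume t: "test_function \<phi>"
  have "(deriv ^^ k) (deriv \<phi>) differentiable (at x)" for k x
    using t unfolding test_function_def by (metis comp_apply funpow_Suc_right)
  moreover obtain a b where ab: "-1 < a" "b < 1" "\<forall>x. x \<notin> {a..b} \<longrightarrow> \<phi> x = 0"
    using t unfolding test_function_def by blast
  have "deriv \<phi> x = 0" if "x \<notin> {a..b}" for x
  proof (rule DERIV_imp_deriv)
    have "((\<lambda>x. 0) has_real_derivative 0) (at x)" by simp
    then show "(\<phi> has_real_derivative 0) (at x)"
      by (rule has_field_derivative_transform_within_open[of _ _ _ "- {a..b}"]) (use ab(3) that in \<open>auto simp del: atLeastAtMost_iff\<close>)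
  qed
  ultimately show "test_function (deriv \<phi>)" unfolding test_function_def using ab by blast
qed

text \<open>
  The derivative of a test function is a test function. So the weak derivatives of successive
  orders are weak first derivatives of each other.
\<close>

lemma weak_deriv_step:
  assumes "has_weak_deriv j f g" "has_weak_deriv (Suc j) f h" "test_function \<phi>"
  shows "(LINT x:{-1<..<1}|lebesgue. deriv \<phi> x *\<^sub>R g x) = - (LINT x:{-1<..<1}|lebesgue. \<phi> x *\<^sub>R h x)"
proof -
  have "(-1) ^ j * (LINT x:{-1<..<1}|lebesgue. deriv \<phi> x *\<^sub>R g x)
      = (LINT x:{-1<..<1}|lebesgue. (deriv ^^ j) (deriv \<phi>) x *\<^sub>R f x)"
    using assms(1) test_function_deriv[OF assms(3)] unfolding has_weak_deriv_def by simp
  also have "(deriv ^^ j) (deriv \<phi>) = (deriv ^^ Suc j) \<phi>" by (simp add: funpow_swap1)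
  also have "(LINT x:{-1<..<1}|lebesgue. (deriv ^^ Suc j) \<phi> x *\<^sub>R f x)
      = (-1) ^ Suc j * (LINT x:{-1<..<1}|lebesgue. \<phi> x *\<^sub>R h x)"
    using assms(2,3) unfolding has_weak_deriv_def by blast
  finally have "(-1) ^ j * (LINT x:{-1<..<1}|lebesgue. deriv \<phi> x *\<^sub>R g x)
      = (-1) ^ j * (- (LINT x:{-1<..<1}|lebesgue. \<phi> x *\<^sub>R h x))" by simp
  then show ?thesis by (simp only: mult_cancel_left) simp
qed

lemma set_integral_interior:
  fixes f :: "real \<Rightarrow> complex"
  assumes "\<phi> 1 = 0" "\<phi> (-1) = 0"
  shows "(LINT x:{-1<..<1}|lebesgue. \<phi> x *\<^sub>R f x) = (\<integral>x. \<phi> x *\<^sub>R f x \<partial>lebesgue_on {-1..1})"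
proof -
  have eq: "indicator {-1<..<1} x *\<^sub>R (\<phi> x *\<^sub>R f x) = indicator {-1..1} x *\<^sub>R (\<phi> x *\<^sub>R f x)" for x :: real
  proof (cases "x = 1 \<or> x = -1")
    case False
    then have "x \<in> {-1<..<1} \<longleftrightarrow> x \<in> {-1..1}" by auto
    then show ?thesis by (simp add: indicator_def)
  qed (use assms in auto)
  show ?thesis unfolding set_lebesgue_integral_def eq
    by (rule integral_restrict_space[symmetric]) simp
qed

lemma weighted_L2_facts:
  assumes \<alpha>: "0 \<le> \<alpha>" and f: "f \<in> weighted_L2 \<alpha>"
  shows "f \<in> borel_measurable (lebesgue_on {-1..1})" "integrable (lebesgue_on {-1..1}) (\<lambda>x. jacobi_weight \<alpha> x *\<^sub>R norm (f x))"
proof -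
  show m: "f \<in> borel_measurable (lebesgue_on {-1..1})"
    using f unfolding weighted_L2_def by (simp add: measurable_cong_sets[OF sets_weighted_measure refl])
  have nm: "(\<lambda>x. norm (f x)) \<in> borel_measurable (lebesgue_on {-1..1})"
    by (rule measurable_compose[OF m borel_measurable_norm])
  have "integrable (weighted_measure \<alpha>) (\<lambda>x. norm (f x))"
  proof (rule Bochner_Integration.integrable_bound)
    show "integrable (weighted_measure \<alpha>) (\<lambda>x. 1 + (norm (f x))\<^sup>2)"
      using f finite_measure_weighted[OF \<alpha>]
      by (intro Bochner_Integration.integrable_add) (auto simp: weighted_L2_def finite_measure.integrable_const)
    show "(\<lambda>x. norm (f x)) \<in> borel_measurable (weighted_measure \<alpha>)" unfolding measurable_weighted_iff by (rule nm)
    have "t \<le> 1 + t\<^sup>2" for t :: real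
    proof -
      have "0 \<le> (2 * t - 1)\<^sup>2" by simp
      then have "4 * t \<le> 4 * t\<^sup>2 + 1" by (simp add: power2_eq_square algebra_simps)
      then show ?thesis using zero_le_power2[of t] by linarith
    qed
    then show "AE x in weighted_measure \<alpha>. norm (norm (f x)) \<le> norm (1 + (norm (f x))\<^sup>2)" by simp
  qed
  then show "integrable (lebesgue_on {-1..1}) (\<lambda>x. jacobi_weight \<alpha> x *\<^sub>R norm (f x))"
    unfolding integral_weighted(2)[OF nm] .
qed

lemma jacobi_weight_antimono:
  assumes "\<alpha> \<le> \<gamma>" "x \<in> {-1..1}"
  shows "jacobi_weight \<gamma> x \<le> jacobi_weight \<alpha> x"
proof -
  have "x\<^sup>2 \<le> 1" using assms(2) by (simp add: abs_square_le_1 abs_le_iff)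
  then show ?thesis unfolding jacobi_weight_def using assms(1) by (intro powr_mono') auto
qed

lemma cutoff_argument_at_top:
  assumes "x \<in> {-1<..<1}"
  shows "filterlim (\<lambda>n. real (Suc n) * (1 - x\<^sup>2) - 1) at_top sequentially"
proof -
  have "x\<^sup>2 < 1" using assms by (simp add: abs_square_less_1 abs_less_iff)
  then have "0 < 1 - x\<^sup>2" by simp
  then show ?thesis by real_asymp
qed

lemma jacobi_weight_endpoint: "x \<in> {-1..1} \<Longrightarrow> x \<notin> {-1<..<1} \<Longrightarrow> jacobi_weight \<beta> x = 0"
proof -
  assume "x \<in> {-1..1}" "x \<notin> {-1<..<1}"
  then have "x = 1 \<or> x = -1" by (simp add: not_less) linarith
  then show ?thesis by (auto simp: jacobi_weight_def)
qed

text \<open>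
  Functions in the weighted space are integrable against the weight of exponent \<open>\<alpha>\<close>, which
  dominates all integrands.
\<close>

lemma cutoff_limit:
  fixes F :: "nat \<Rightarrow> real \<Rightarrow> real" and h :: "real \<Rightarrow> complex"
  assumes \<alpha>: "0 < \<alpha>" and h: "h \<in> weighted_L2 \<alpha>"
    and m: "\<And>n. F n \<in> borel_measurable borel" "G \<in> borel_measurable borel"
    and bd: "\<And>n x. x \<in> {-1..1} \<Longrightarrow> \<bar>F n x\<bar> \<le> P * jacobi_weight \<alpha> x"
    and lim: "\<And>x. x \<in> {-1<..<1} \<Longrightarrow> (\<lambda>n. F n x) \<longlonglongrightarrow> G x"
    and G: "\<And>x. x \<in> {-1..1} \<Longrightarrow> x \<notin> {-1<..<1} \<Longrightarrow> G x = 0"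
  shows "(\<lambda>n. LINT x:{-1<..<1}|lebesgue. F n x *\<^sub>R h x) \<longlonglongrightarrow> (\<integral>x. G x *\<^sub>R h x \<partial>lebesgue_on {-1..1})"
proof -
  have hf: "h \<in> borel_measurable (lebesgue_on {-1..1})"
    "integrable (lebesgue_on {-1..1}) (\<lambda>x. jacobi_weight \<alpha> x *\<^sub>R norm (h x))"
    using weighted_L2_facts[OF less_imp_le[OF \<alpha>] h] .
  have F0: "F n x = 0" if "x \<in> {-1..1}" "x \<notin> {-1<..<1}" for n x
    using bd[OF that(1), of n] jacobi_weight_endpoint[OF that, of \<alpha>] by simp
  have ml: "f \<in> borel_measurable borel \<Longrightarrow> f \<in> borel_measurable (lebesgue_on {-1..1})" for f :: "real \<Rightarrow> real"
    by (intro measurable_restrict_space1 measurable_completion) simp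
  have "(\<lambda>n. \<integral>x. F n x *\<^sub>R h x \<partial>lebesgue_on {-1..1}) \<longlonglongrightarrow> (\<integral>x. G x *\<^sub>R h x \<partial>lebesgue_on {-1..1})"
  proof (rule integral_dominated_convergence[where w = "\<lambda>x. P * (jacobi_weight \<alpha> x *\<^sub>R norm (h x))"])
    show "integrable (lebesgue_on {-1..1}) (\<lambda>x. P * (jacobi_weight \<alpha> x *\<^sub>R norm (h x)))"
      by (rule integrable_mult_right) (rule hf(2))
    show "(\<lambda>x. G x *\<^sub>R h x) \<in> borel_measurable (lebesgue_on {-1..1})"
      by (intro borel_measurable_scaleR ml m hf)
    show "(\<lambda>x. F n x *\<^sub>R h x) \<in> borel_measurable (lebesgue_on {-1..1})" for n
      by (intro borel_measurable_scaleR ml m hf)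
    show "AE x in lebesgue_on {-1..1}. (\<lambda>n. F n x *\<^sub>R h x) \<longlonglongrightarrow> G x *\<^sub>R h x"
    proof (rule AE_I2)
      fix x :: real assume "x \<in> space (lebesgue_on {-1..1})"
      then have x: "x \<in> {-1..1}" by simp
      show "(\<lambda>n. F n x *\<^sub>R h x) \<longlonglongrightarrow> G x *\<^sub>R h x"
      proof (cases "x \<in> {-1<..<1}")
        case True
        then show ?thesis by (intro tendsto_intros lim)
      next
        case False
        then show ?thesis using F0[OF x False] G[OF x False] by simp
      qed
    qed
    show "AE x in lebesgue_on {-1..1}. norm (F n x *\<^sub>R h x) \<le> P * (jacobi_weight \<alpha> x *\<^sub>R norm (h x))" for n
    proof (rule AE_I2)
      fix x :: real assume "x \<in> space (lebesgue_on {-1..1})"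
      then have "\<bar>F n x\<bar> * norm (h x) \<le> (P * jacobi_weight \<alpha> x) * norm (h x)"
        by (intro mult_right_mono bd) auto
      then show "norm (F n x *\<^sub>R h x) \<le> P * (jacobi_weight \<alpha> x *\<^sub>R norm (h x))" by (simp add: mult.assoc)
    qed
  qed
  moreover have "(LINT x:{-1<..<1}|lebesgue. F n x *\<^sub>R h x) = (\<integral>x. F n x *\<^sub>R h x \<partial>lebesgue_on {-1..1})" for n
    by (rule set_integral_interior) (simp_all add: F0)
  ultimately show ?thesis by simp
qed

lemma cutoff_weight_measurable: "cutoff_weight n q \<beta> p \<in> borel_measurable borel" if "0 < n"
proof -
  have "continuous_on UNIV (cutoff_weight n q \<beta> p)"
    by (rule DERIV_continuous_on) (rule has_field_derivative_at_within[OF cutoff_weight_has_derivative[OF that]])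
  then show ?thesis by (rule borel_measurable_continuous_onI)
qed

lemma cutoff_limit_value:
  assumes \<alpha>: "0 < \<alpha>" "\<alpha> \<le> \<gamma>" and h: "h \<in> weighted_L2 \<alpha>"
  shows "(\<lambda>n. LINT x:{-1<..<1}|lebesgue. cutoff_weight (real (Suc n)) 1 \<gamma> p x *\<^sub>R h x)
    \<longlonglongrightarrow> (\<integral>x. poly p x *\<^sub>R h x \<partial>weighted_measure \<gamma>)"
proof -
  obtain P where P: "\<forall>x\<in>{-1..1}. \<bar>poly p x\<bar> \<le> P" using poly_bounded_on_interval by blast
  have "(\<lambda>n. LINT x:{-1<..<1}|lebesgue. cutoff_weight (real (Suc n)) 1 \<gamma> p x *\<^sub>R h x)
    \<longlonglongrightarrow> (\<integral>x. (jacobi_weight \<gamma> x * poly p x) *\<^sub>R h x \<partial>lebesgue_on {-1..1})"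
  proof (rule cutoff_limit[OF \<alpha>(1) h])
    show "cutoff_weight (real (Suc n)) 1 \<gamma> p \<in> borel_measurable borel" for n
      by (rule cutoff_weight_measurable) simp
    show "(\<lambda>x. jacobi_weight \<gamma> x * poly p x) \<in> borel_measurable borel"
      by (intro borel_measurable_times jacobi_weight_measurable borel_measurable_continuous_onI continuous_intros)
    show "\<bar>cutoff_weight (real (Suc n)) 1 \<gamma> p x\<bar> \<le> P * jacobi_weight \<alpha> x" if x: "x \<in> {-1..1}" for n x
    proof -
      have "\<bar>cutoff_weight (real (Suc n)) 1 \<gamma> p x\<bar> \<le> 1 * jacobi_weight \<alpha> x * P"
        unfolding cutoff_weight_def abs_mult
        using P x flat_bounds jacobi_weight_antimono[OF \<alpha>(2) x] by (intro mult_mono) auto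
      then show ?thesis by (simp add: mult.commute)
    qed
    show "(\<lambda>n. cutoff_weight (real (Suc n)) 1 \<gamma> p x) \<longlonglongrightarrow> jacobi_weight \<gamma> x * poly p x" if x: "x \<in> {-1<..<1}" for x
    proof -
      have "(\<lambda>n. flat 1 (real (Suc n) * (1 - x\<^sup>2) - 1) * jacobi_weight \<gamma> x * poly p x) \<longlonglongrightarrow> 1 * jacobi_weight \<gamma> x * poly p x"
        by (intro tendsto_mult tendsto_const flat_tendsto cutoff_argument_at_top x)
      then show ?thesis by (simp add: cutoff_weight_def)
    qed
  qed (simp add: jacobi_weight_endpoint)
  moreover have "h \<in> borel_measurable (lebesgue_on {-1..1})"
    using weighted_L2_facts(1)[OF less_imp_le[OF \<alpha>(1)] h] .
  then have "(\<lambda>x. poly p x *\<^sub>R h x) \<in> borel_measurable (lebesgue_on {-1..1})"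
    by (intro borel_measurable_scaleR poly_measurable)
  from integral_weighted(1)[OF this, of \<gamma>]
  have "(\<integral>x. (jacobi_weight \<gamma> x * poly p x) *\<^sub>R h x \<partial>lebesgue_on {-1..1}) = (\<integral>x. poly p x *\<^sub>R h x \<partial>weighted_measure \<gamma>)"
    by simp
  ultimately show ?thesis by simp
qed

text \<open>
  Differentiating the cutoff produces a term that is at most a constant times \<open>\<omega>\<^sub>\<gamma>\<close>, uniformly
  in the cutoff, and that tends to zero pointwise.
\<close>

lemma cutoff_limit_deriv:
  assumes \<alpha>: "0 < \<alpha>" "\<alpha> \<le> \<gamma>" and h: "h \<in> weighted_L2 \<alpha>"
  shows "(\<lambda>n. LINT x:{-1<..<1}|lebesgue. deriv (cutoff_weight (real (Suc n)) 1 (\<gamma> + 1) p) x *\<^sub>R h x)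
    \<longlonglongrightarrow> (\<integral>x. poly ([:0, - 2 * (\<gamma> + 1):] * p + [:1, 0, -1:] * pderiv p) x *\<^sub>R h x \<partial>weighted_measure \<gamma>)"
proof -
  let ?r = "[:0, - 2 * (\<gamma> + 1):] * p + [:1, 0, -1:] * pderiv p"
  obtain P where P: "\<forall>x\<in>{-1..1}. \<bar>poly p x\<bar> \<le> P" using poly_bounded_on_interval by blast
  obtain R where R: "\<forall>x\<in>{-1..1}. \<bar>poly ?r x\<bar> \<le> R" using poly_bounded_on_interval by blast
  let ?A = "\<lambda>n x. flat [:0, 0, 1:] (real (Suc n) * (1 - x\<^sup>2) - 1) * (- 2 * real (Suc n) * x) * jacobi_weight (\<gamma> + 1) x * poly p x"
  let ?B = "\<lambda>n x. flat 1 (real (Suc n) * (1 - x\<^sup>2) - 1) * (jacobi_weight \<gamma> x * poly ?r x)"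
  have split: "cutoff_weight_deriv (real (Suc n)) 1 (\<gamma> + 1) p x = ?A n x + ?B n x" if "x \<in> {-1..1}" for n x
    unfolding cutoff_weight_deriv_def cutoff_weight_def jacobi_weight_Suc[OF that]
    by (simp add: pderiv_1 algebra_simps power2_eq_square)
  have A: "?A n x = ((real (Suc n) * (1 - x\<^sup>2) - 1 + 1) * flat [:0, 0, 1:] (real (Suc n) * (1 - x\<^sup>2) - 1)) * (- 2 * x) * jacobi_weight \<gamma> x * poly p x"
    if "x \<in> {-1..1}" for n x
  proof -
    have "F * (- 2 * N * x) * ((1 - x\<^sup>2) * w) * r = ((N * (1 - x\<^sup>2) - 1 + 1) * F) * (- 2 * x) * w * r" for F N w r :: real
      by (simp add: algebra_simps)
    then show ?thesis unfolding jacobi_weight_Suc[OF that] .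
  qed
  have "(\<lambda>n. LINT x:{-1<..<1}|lebesgue. cutoff_weight_deriv (real (Suc n)) 1 (\<gamma> + 1) p x *\<^sub>R h x)
    \<longlonglongrightarrow> (\<integral>x. (jacobi_weight \<gamma> x * poly ?r x) *\<^sub>R h x \<partial>lebesgue_on {-1..1})"
  proof (rule cutoff_limit[OF \<alpha>(1) h])
    show "cutoff_weight_deriv (real (Suc n)) 1 (\<gamma> + 1) p \<in> borel_measurable borel" for n
      unfolding cutoff_weight_deriv_def[abs_def]
      by (intro borel_measurable_add cutoff_weight_measurable) simp_all
    show "(\<lambda>x. jacobi_weight \<gamma> x * poly ?r x) \<in> borel_measurable borel"
      by (intro borel_measurable_times jacobi_weight_measurable borel_measurable_continuous_onI continuous_intros)
    show "\<bar>cutoff_weight_deriv (real (Suc n)) 1 (\<gamma> + 1) p x\<bar> \<le> (6 * P + R) * jacobi_weight \<alpha> x" if x: "x \<in> {-1..1}" for n x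
    proof -
      have w: "\<bar>jacobi_weight \<gamma> x\<bar> \<le> jacobi_weight \<alpha> x" using jacobi_weight_antimono[OF \<alpha>(2) x] by simp
      have P0: "\<bar>poly p x\<bar> \<le> P" "\<bar>poly ?r x\<bar> \<le> R" using P R x by blast+
      have "\<bar>?A n x\<bar> \<le> 3 * 2 * jacobi_weight \<alpha> x * P"
        unfolding A[OF x] unfolding abs_mult[of _ "poly p x"] abs_mult[of _ "jacobi_weight \<gamma> x"] abs_mult[of _ "-2 * x"]
        using x by (intro mult_mono flat_bounds(3) w P0) (auto simp: abs_mult)
      moreover have "\<bar>?B n x\<bar> \<le> 1 * (jacobi_weight \<alpha> x * R)"
        unfolding abs_mult using flat_bounds by (intro mult_mono w P0) auto
      ultimately show ?thesis unfolding split[OF x] by (simp add: algebra_simps)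
    qed
    show "(\<lambda>n. cutoff_weight_deriv (real (Suc n)) 1 (\<gamma> + 1) p x) \<longlonglongrightarrow> jacobi_weight \<gamma> x * poly ?r x" if x: "x \<in> {-1<..<1}" for x
    proof -
      have x': "x \<in> {-1..1}" using x by auto
      have "x\<^sup>2 < 1" using x by (simp add: abs_square_less_1 abs_less_iff)
      then have d: "0 < 1 - x\<^sup>2" by simp
      have "(\<lambda>n. (real (Suc n) * (1 - x\<^sup>2) - 1 + 1) * ((1 / (real (Suc n) * (1 - x\<^sup>2) - 1))\<^sup>2 * exp (- (1 / (real (Suc n) * (1 - x\<^sup>2) - 1))))) \<longlonglongrightarrow> 0"
        using d by real_asymp
      moreover have "\<forall>\<^sub>F n in sequentially. (real (Suc n) * (1 - x\<^sup>2) - 1 + 1) * ((1 / (real (Suc n) * (1 - x\<^sup>2) - 1))\<^sup>2 * exp (- (1 / (real (Suc n) * (1 - x\<^sup>2) - 1))))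
          = (real (Suc n) * (1 - x\<^sup>2) - 1 + 1) * flat [:0, 0, 1:] (real (Suc n) * (1 - x\<^sup>2) - 1)"
      proof -
        have "\<forall>\<^sub>F n in sequentially. 0 < real (Suc n) * (1 - x\<^sup>2) - 1"
          by (rule eventually_compose_filterlim[OF eventually_gt_at_top cutoff_argument_at_top[OF x]])
        then show ?thesis by eventually_elim (simp add: flat_def power2_eq_square)
      qed
      ultimately have "(\<lambda>n. (real (Suc n) * (1 - x\<^sup>2) - 1 + 1) * flat [:0, 0, 1:] (real (Suc n) * (1 - x\<^sup>2) - 1)) \<longlonglongrightarrow> 0"
        by (rule Lim_transform_eventually)
      then have "(\<lambda>n. ?A n x) \<longlonglongrightarrow> 0 * (- 2 * x) * jacobi_weight \<gamma> x * poly p x"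
        unfolding A[OF x'] by (intro tendsto_mult tendsto_const)
      moreover have "(\<lambda>n. ?B n x) \<longlonglongrightarrow> 1 * (jacobi_weight \<gamma> x * poly ?r x)"
        by (intro tendsto_mult tendsto_const flat_tendsto cutoff_argument_at_top x)
      ultimately have "(\<lambda>n. ?A n x + ?B n x) \<longlonglongrightarrow> 0 * (- 2 * x) * jacobi_weight \<gamma> x * poly p x + 1 * (jacobi_weight \<gamma> x * poly ?r x)"
        by (rule tendsto_add)
      then show ?thesis unfolding split[OF x'] by simp
    qed
  qed (simp add: jacobi_weight_endpoint)
  moreover have "h \<in> borel_measurable (lebesgue_on {-1..1})"
    using weighted_L2_facts(1)[OF less_imp_le[OF \<alpha>(1)] h] .
  then have "(\<lambda>x. poly ?r x *\<^sub>R h x) \<in> borel_measurable (lebesgue_on {-1..1})"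
    by (intro borel_measurable_scaleR poly_measurable)
  from integral_weighted(1)[OF this, of \<gamma>]
  have "(\<integral>x. (jacobi_weight \<gamma> x * poly ?r x) *\<^sub>R h x \<partial>lebesgue_on {-1..1}) = (\<integral>x. poly ?r x *\<^sub>R h x \<partial>weighted_measure \<gamma>)"
    by simp
  ultimately show ?thesis by (simp add: deriv_cutoff_weight)
qed

text \<open>
  The weak derivative is tested with \<open>\<omega>\<^bsub>\<gamma>+1\<^esub> p'\<close>, whose derivative is \<open>- \<mu> \<omega>\<^sub>\<gamma> p\<close> by the
  differential equation. This function is smooth inside the interval and vanishes at its ends, so
  the cutoffs can be removed.
\<close>

lemma weak_deriv_coefficient:
  assumes \<alpha>: "0 < \<alpha>" "\<alpha> \<le> \<gamma>" and g: "g \<in> weighted_L2 \<alpha>" and h: "h \<in> weighted_L2 \<alpha>"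
    and wd: "has_weak_deriv j f g" "has_weak_deriv (Suc j) f h"
    and p: "gegen_op \<gamma> p = smult \<mu> p"
  shows "(\<integral>x. poly (pderiv p) x *\<^sub>R h x \<partial>weighted_measure (\<gamma> + 1)) = \<mu> *\<^sub>R (\<integral>x. poly p x *\<^sub>R g x \<partial>weighted_measure \<gamma>)"
proof -
  have r: "[:0, - 2 * (\<gamma> + 1):] * pderiv p + [:1, 0, -1:] * pderiv (pderiv p) = smult (- \<mu>) p"
  proof (rule poly_ext)
    fix x
    have "(x\<^sup>2 - 1) * poly (pderiv (pderiv p)) x + 2 * (\<gamma> + 1) * x * poly (pderiv p) x = \<mu> * poly p x"
      using arg_cong[OF p, of "\<lambda>p. poly p x"] unfolding poly_gegen_op by simp
    then show "poly ([:0, - 2 * (\<gamma> + 1):] * pderiv p + [:1, 0, -1:] * pderiv (pderiv p)) x = poly (smult (- \<mu>) p) x"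
      by (simp add: algebra_simps power2_eq_square)
  qed
  let ?\<phi> = "\<lambda>n. cutoff_weight (real (Suc n)) 1 (\<gamma> + 1) (pderiv p)"
  have "(\<lambda>n. LINT x:{-1<..<1}|lebesgue. deriv (?\<phi> n) x *\<^sub>R g x) \<longlonglongrightarrow> (\<integral>x. poly (smult (- \<mu>) p) x *\<^sub>R g x \<partial>weighted_measure \<gamma>)"
    using cutoff_limit_deriv[OF \<alpha> g, of "pderiv p"] unfolding r .
  moreover have "(LINT x:{-1<..<1}|lebesgue. deriv (?\<phi> n) x *\<^sub>R g x) = - (LINT x:{-1<..<1}|lebesgue. ?\<phi> n x *\<^sub>R h x)" for n
    by (rule weak_deriv_step[OF wd cutoff_weight_test]) simp
  moreover have "(\<lambda>n. - (LINT x:{-1<..<1}|lebesgue. ?\<phi> n x *\<^sub>R h x)) \<longlonglongrightarrow> - (\<integral>x. poly (pderiv p) x *\<^sub>R h x \<partial>weighted_measure (\<gamma> + 1))"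
    using \<alpha> by (intro tendsto_minus cutoff_limit_value[OF \<alpha>(1) _ h]) simp
  ultimately have "- (\<integral>x. poly (pderiv p) x *\<^sub>R h x \<partial>weighted_measure (\<gamma> + 1)) = (\<integral>x. poly (smult (- \<mu>) p) x *\<^sub>R g x \<partial>weighted_measure \<gamma>)"
    using LIMSEQ_unique by fastforce
  also have "\<dots> = (\<integral>x. (- \<mu>) *\<^sub>R (poly p x *\<^sub>R g x) \<partial>weighted_measure \<gamma>)" by simp
  also have "\<dots> = (- \<mu>) *\<^sub>R (\<integral>x. poly p x *\<^sub>R g x \<partial>weighted_measure \<gamma>)" by (rule integral_scaleR_right) 
  finally show ?thesis by simp
qed

lemma weak_deriv_0_coefficient:
  assumes \<alpha>: "0 < \<alpha>" and f: "f \<in> weighted_L2 \<alpha>" and g: "g \<in> weighted_L2 \<alpha>" and wd: "has_weak_deriv 0 f g"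
  shows "(\<integral>x. poly p x *\<^sub>R f x \<partial>weighted_measure \<alpha>) = (\<integral>x. poly p x *\<^sub>R g x \<partial>weighted_measure \<alpha>)"
proof -
  let ?\<phi> = "\<lambda>n. cutoff_weight (real (Suc n)) 1 \<alpha> p"
  have "(LINT x:{-1<..<1}|lebesgue. ?\<phi> n x *\<^sub>R f x) = (LINT x:{-1<..<1}|lebesgue. ?\<phi> n x *\<^sub>R g x)" for n
    using wd cutoff_weight_test[of "real (Suc n)" 1 \<alpha> p] unfolding has_weak_deriv_def by simp
  then show ?thesis
    using cutoff_limit_value[OF \<alpha> order_refl f, of p] cutoff_limit_value[OF \<alpha> order_refl g, of p] LIMSEQ_unique
    by (simp only:)
qed

section \<open>Coefficient decay in Sobolev spaces\<close>

lemma weighted_L2_real_parts: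
  assumes "f \<in> weighted_L2 \<alpha>"
  shows "(\<lambda>x. Re (f x)) \<in> rL2 \<alpha>" "(\<lambda>x. Im (f x)) \<in> rL2 \<alpha>"
    "(weighted_norm \<alpha> f)\<^sup>2 = rinner \<alpha> (\<lambda>x. Re (f x)) (\<lambda>x. Re (f x)) + rinner \<alpha> (\<lambda>x. Im (f x)) (\<lambda>x. Im (f x))"
proof -
  have m: "f \<in> borel_measurable (weighted_measure \<alpha>)" and i: "integrable (weighted_measure \<alpha>) (\<lambda>x. (norm (f x))\<^sup>2)"
    using assms by (auto simp: weighted_L2_def)
  have mR: "(\<lambda>x. Re (f x)) \<in> borel_measurable (weighted_measure \<alpha>)" by (rule measurable_compose[OF m borel_measurable_Re])
  have mI: "(\<lambda>x. Im (f x)) \<in> borel_measurable (weighted_measure \<alpha>)" by (rule measurable_compose[OF m borel_measurable_Im])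
  have R: "integrable (weighted_measure \<alpha>) (\<lambda>x. (Re (f x))\<^sup>2)"
    by (rule Bochner_Integration.integrable_bound[OF i borel_measurable_power[OF mR]]) (auto simp: cmod_power2)
  have I: "integrable (weighted_measure \<alpha>) (\<lambda>x. (Im (f x))\<^sup>2)"
    by (rule Bochner_Integration.integrable_bound[OF i borel_measurable_power[OF mI]]) (auto simp: cmod_power2)
  show "(\<lambda>x. Re (f x)) \<in> rL2 \<alpha>" "(\<lambda>x. Im (f x)) \<in> rL2 \<alpha>"
    using mR mI R I by (auto simp: rL2_def)
  have "(weighted_norm \<alpha> f)\<^sup>2 = (\<integral>x. (norm (f x))\<^sup>2 \<partial>weighted_measure \<alpha>)"
    unfolding weighted_norm_def by (rule real_sqrt_pow2) (intro integral_nonneg_AE, simp)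
  also have "\<dots> = (\<integral>x. (Re (f x))\<^sup>2 + (Im (f x))\<^sup>2 \<partial>weighted_measure \<alpha>)" by (simp add: cmod_power2)
  also have "\<dots> = (\<integral>x. (Re (f x))\<^sup>2 \<partial>weighted_measure \<alpha>) + (\<integral>x. (Im (f x))\<^sup>2 \<partial>weighted_measure \<alpha>)"
    by (rule Bochner_Integration.integral_add[OF R I])
  finally show "(weighted_norm \<alpha> f)\<^sup>2 = rinner \<alpha> (\<lambda>x. Re (f x)) (\<lambda>x. Re (f x)) + rinner \<alpha> (\<lambda>x. Im (f x)) (\<lambda>x. Im (f x))"
    by (simp add: rinner_def power2_eq_square)
qed

text \<open>
  On \<open>[-1, 1]\<close> a larger exponent gives a smaller weight.
\<close>

lemma rL2_weight_mono:
  assumes \<alpha>: "\<alpha> \<le> \<gamma>" and f: "f \<in> rL2 \<alpha>"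
  shows "f \<in> rL2 \<gamma>" "rinner \<gamma> f f \<le> rinner \<alpha> f f"
proof -
  have m: "f \<in> borel_measurable (lebesgue_on {-1..1})" using rL2_measurable[OF f] unfolding measurable_weighted_iff .
  have m2: "(\<lambda>x. (f x)\<^sup>2) \<in> borel_measurable (lebesgue_on {-1..1})" by (rule borel_measurable_power[OF m])
  have i: "integrable (lebesgue_on {-1..1}) (\<lambda>x. jacobi_weight \<alpha> x *\<^sub>R (f x)\<^sup>2)"
    using f integral_weighted(2)[OF m2] by (simp add: rL2_def)
  have le: "jacobi_weight \<gamma> x *\<^sub>R (f x)\<^sup>2 \<le> jacobi_weight \<alpha> x *\<^sub>R (f x)\<^sup>2" if "x \<in> {-1..1}" for x
    using jacobi_weight_antimono[OF \<alpha> that] by (simp add: mult_right_mono)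
  have i': "integrable (lebesgue_on {-1..1}) (\<lambda>x. jacobi_weight \<gamma> x *\<^sub>R (f x)\<^sup>2)"
  proof (rule Bochner_Integration.integrable_bound[OF i])
    show "(\<lambda>x. jacobi_weight \<gamma> x *\<^sub>R (f x)\<^sup>2) \<in> borel_measurable (lebesgue_on {-1..1})"
      by (intro borel_measurable_scaleR jacobi_weight_measurable_leb m2)
    show "AE x in lebesgue_on {-1..1}. norm (jacobi_weight \<gamma> x *\<^sub>R (f x)\<^sup>2) \<le> norm (jacobi_weight \<alpha> x *\<^sub>R (f x)\<^sup>2)"
      by (rule AE_I2) (use le in simp)
  qed
  then have "integrable (weighted_measure \<gamma>) (\<lambda>x. (f x)\<^sup>2)" unfolding integral_weighted(2)[OF m2] .
  then show "f \<in> rL2 \<gamma>" using m unfolding rL2_def by (simp only: measurable_weighted_iff mem_Collect_eq simp_thms)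
  have "(\<integral>x. jacobi_weight \<gamma> x *\<^sub>R (f x)\<^sup>2 \<partial>lebesgue_on {-1..1}) \<le> (\<integral>x. jacobi_weight \<alpha> x *\<^sub>R (f x)\<^sup>2 \<partial>lebesgue_on {-1..1})"
    by (rule integral_mono[OF i' i]) (use le in simp)
  moreover have "rinner \<delta> f f = (\<integral>x. jacobi_weight \<delta> x *\<^sub>R (f x)\<^sup>2 \<partial>lebesgue_on {-1..1})" for \<delta>
    using integral_weighted(1)[OF m2, of \<delta>] by (simp add: rinner_def power2_eq_square)
  ultimately show "rinner \<gamma> f f \<le> rinner \<alpha> f f" by simp
qed

lemma weighted_L2_integrable:
  assumes \<alpha>: "0 < \<alpha>" "\<alpha> \<le> \<gamma>" and f: "f \<in> weighted_L2 \<alpha>" and q: "q \<in> rL2 \<gamma>"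
  shows "integrable (weighted_measure \<gamma>) (\<lambda>x. q x *\<^sub>R f x)"
proof -
  note RI = weighted_L2_real_parts(1,2)[OF f]
  have "integrable (weighted_measure \<gamma>) (\<lambda>x. q x * Re (f x))"
    by (rule rL2_product_integrable[OF q rL2_weight_mono(1)[OF \<alpha>(2) RI(1)]])
  moreover have "integrable (weighted_measure \<gamma>) (\<lambda>x. q x * Im (f x))"
    by (rule rL2_product_integrable[OF q rL2_weight_mono(1)[OF \<alpha>(2) RI(2)]])
  ultimately have b: "integrable (weighted_measure \<gamma>) (\<lambda>x. \<bar>q x * Re (f x)\<bar> + \<bar>q x * Im (f x)\<bar>)"
    by (intro Bochner_Integration.integrable_add integrable_abs)
  show ?thesis
  proof (rule Bochner_Integration.integrable_bound[OF b])
    have "q \<in> borel_measurable (lebesgue_on {-1..1})" using rL2_measurable[OF q] unfolding measurable_weighted_iff .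
    then have "(\<lambda>x. q x *\<^sub>R f x) \<in> borel_measurable (lebesgue_on {-1..1})"
      using weighted_L2_facts(1)[OF less_imp_le[OF \<alpha>(1)] f] by (intro borel_measurable_scaleR)
    then show "(\<lambda>x. q x *\<^sub>R f x) \<in> borel_measurable (weighted_measure \<gamma>)"
      by (simp only: measurable_cong_sets[OF sets_weighted_measure refl])
    have "norm (q x *\<^sub>R f x) \<le> \<bar>q x * Re (f x)\<bar> + \<bar>q x * Im (f x)\<bar>" for x
      using cmod_le[of "q x *\<^sub>R f x"] by simp
    then show "AE x in weighted_measure \<gamma>. norm (q x *\<^sub>R f x) \<le> norm (\<bar>q x * Re (f x)\<bar> + \<bar>q x * Im (f x)\<bar>)"
      by (intro AE_I2) (metis abs_ge_self order_trans real_norm_def)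
  qed
qed

lemma weighted_L2_coefficient_parts:
  assumes "0 < \<alpha>" "\<alpha> \<le> \<gamma>" "f \<in> weighted_L2 \<alpha>" "q \<in> rL2 \<gamma>"
  shows "Re (\<integral>x. q x *\<^sub>R f x \<partial>weighted_measure \<gamma>) = rinner \<gamma> (\<lambda>x. Re (f x)) q"
    "Im (\<integral>x. q x *\<^sub>R f x \<partial>weighted_measure \<gamma>) = rinner \<gamma> (\<lambda>x. Im (f x)) q"
  using integral_Re[OF weighted_L2_integrable[OF assms]] integral_Im[OF weighted_L2_integrable[OF assms]]
  by (simp_all add: rinner_def mult.commute)

text \<open>
  The squared norm of the \<open>r\<close>-th derivative of \<open>gpoly \<beta> k\<close> in the weight of exponent \<open>\<beta> + r\<close>,
  by \<open>higher_pderiv_gpoly_inner\<close>.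
\<close>

definition deriv_norm_sq :: "real \<Rightarrow> nat \<Rightarrow> nat \<Rightarrow> real" where
  "deriv_norm_sq \<beta> r k = (\<Prod>j<r. (real k - real j) * (real k + real j + 2 * \<beta> + 1))"

lemma higher_pderiv_gpoly_inner:
  assumes \<beta>: "0 \<le> \<beta>"
  shows "rinner (\<beta> + real r) (poly ((pderiv ^^ r) (gpoly \<beta> k))) (poly ((pderiv ^^ r) (gpoly \<beta> l)))
       = (if k = l then deriv_norm_sq \<beta> r k else 0)"
proof (induction r)
  case 0
  show ?case by (simp add: rinner_def gpoly_orthonormal[OF \<beta>] deriv_norm_sq_def)
next
  case (Suc r)
  have "0 \<le> \<beta> + real r" using \<beta> by simp
  from integral_pderiv_product[OF this gegen_op_higher_pderiv, of k "(pderiv ^^ r) (gpoly \<beta> l)"] Suc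
  show ?case by (simp add: rinner_def deriv_norm_sq_def add.assoc add.commute[of 1] mult.commute)
qed

text \<open>
  Every factor is at least \<open>gweight \<beta> k / (2 r)\<close>, since \<open>k - j \<ge> k / r\<close> for \<open>j < r \<le> k\<close>.
\<close>

lemma deriv_norm_sq_lower:
  assumes \<beta>: "0 \<le> \<beta>" and k: "r \<le> k"
  shows "gweight \<beta> k ^ r \<le> (2 * real r) ^ r * deriv_norm_sq \<beta> r k"
proof -
  have "gweight \<beta> k ^ r = (\<Prod>j<r. gweight \<beta> k)" by simp
  also have "\<dots> \<le> (\<Prod>j<r. 2 * real r * ((real k - real j) * (real k + real j + 2 * \<beta> + 1)))"
  proof (rule prod_mono, intro conjI)
    fix j assume "j \<in> {..<r}"
    then have j: "j < r" by simp
    show "0 \<le> gweight \<beta> k" using gweight_ge_1[OF \<beta>, of k] by simp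
    have k1: "1 \<le> real k" using j k by simp
    have "0 \<le> (real r - 1) * (real k - real r)" using j k by (intro mult_nonneg_nonneg) auto
    then have "real k \<le> real r * (real k - real r + 1)" by (simp add: algebra_simps)
    also have "\<dots> \<le> real r * (real k - real j)" using j by (intro mult_left_mono) auto
    finally have a: "real k \<le> real r * (real k - real j)" .
    have "gegen_eigenvalue \<beta> k \<le> (real r * (real k - real j)) * (real k + real j + 2 * \<beta> + 1)"
      unfolding gegen_eigenvalue_def using a \<beta> k1 by (intro mult_mono) auto
    moreover have "1 * 1 \<le> real k * (real k + 2 * \<beta> + 1)" using k1 \<beta> by (intro mult_mono) auto
    ultimately show "gweight \<beta> k \<le> 2 * real r * ((real k - real j) * (real k + real j + 2 * \<beta> + 1))"
      by (simp add: gweight_def gegen_eigenvalue_def mult.assoc)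
  qed
  also have "\<dots> = (2 * real r) ^ r * deriv_norm_sq \<beta> r k"
    by (simp add: deriv_norm_sq_def prod.distrib)
  finally show ?thesis .
qed

lemma deriv_norm_sq_pos:
  assumes "0 \<le> \<beta>" "r \<le> k"
  shows "0 < deriv_norm_sq \<beta> r k"
  unfolding deriv_norm_sq_def using assms by (intro prod_pos) auto

lemma sobolev_int_weak_deriv:
  assumes "f \<in> sobolev_int \<alpha> r" "i \<le> r"
  shows "weak_deriv i f \<in> weighted_L2 \<alpha>" "has_weak_deriv i f (weak_deriv i f)"
proof -
  have h: "\<exists>g. has_weak_deriv i f g" and w: "weak_deriv i f \<in> weighted_L2 \<alpha>"
    using assms unfolding sobolev_int_def by blast+
  show "weak_deriv i f \<in> weighted_L2 \<alpha>" by (rule w)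
  show "has_weak_deriv i f (weak_deriv i f)" unfolding weak_deriv_def by (rule someI_ex[OF h])
qed

lemma sobolev_coefficient:
  assumes \<alpha>: "0 < \<alpha>" and f: "f \<in> sobolev_int \<alpha> r" and j: "j \<le> r"
  shows "(\<integral>x. poly ((pderiv ^^ j) (gpoly \<alpha> k)) x *\<^sub>R weak_deriv j f x \<partial>weighted_measure (\<alpha> + real j))
      = deriv_norm_sq \<alpha> j k *\<^sub>R (\<integral>x. poly (gpoly \<alpha> k) x *\<^sub>R f x \<partial>weighted_measure \<alpha>)"
  using j
proof (induction j)
  case 0
  have fL: "f \<in> weighted_L2 \<alpha>" using f by (simp add: sobolev_int_def)
  note * = sobolev_int_weak_deriv[OF f 0]
  show ?case using weak_deriv_0_coefficient[OF \<alpha> fL *, of "gpoly \<alpha> k"]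
    by (simp add: deriv_norm_sq_def)
next
  case (Suc j)
  then have jr: "j \<le> r" "Suc j \<le> r" by auto
  have "\<alpha> \<le> \<alpha> + real j" by simp
  note d = sobolev_int_weak_deriv[OF f jr(1)] sobolev_int_weak_deriv[OF f jr(2)]
  from weak_deriv_coefficient[OF \<alpha> \<open>\<alpha> \<le> \<alpha> + real j\<close> d(1,3) d(2,4) gegen_op_higher_pderiv, of k]
  show ?case using Suc.IH jr(1)
    by (simp add: deriv_norm_sq_def add.assoc add.commute[of 1] mult.commute)
qed

lemma sobolev_term_le_norm:
  assumes "j \<le> r"
  shows "(weighted_norm \<alpha> (weak_deriv j f))\<^sup>2 \<le> (sobolev_int_norm \<alpha> r f)\<^sup>2"
proof -
  have "(weighted_norm \<alpha> (weak_deriv j f))\<^sup>2 \<le> (\<Sum>k=0..r. (weighted_norm \<alpha> (weak_deriv k f))\<^sup>2)"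
    by (rule member_le_sum) (use assms in auto)
  then show ?thesis unfolding sobolev_int_norm_def by (simp add: sum_nonneg)
qed

context gpswf
begin

text \<open>
  Bessel's inequality for the normalised \<open>r\<close>-th derivatives of the Gegenbauer polynomials in the
  weight of exponent \<open>\<alpha> + r\<close> bounds the coefficients with \<open>k \<ge> r\<close>; the other ones are bounded
  by the norm of the function itself.
\<close>

lemma weighted_coefficient_decay:
  assumes g0: "g0 \<in> rL2 \<alpha>" and gr: "gr \<in> rL2 \<alpha>"
    and rel: "\<And>k. rinner (\<alpha> + real r) gr (poly ((pderiv ^^ r) (gpoly \<alpha> k))) = deriv_norm_sq \<alpha> r k * rinner \<alpha> g0 (p k)"
  shows "(\<Sum>k<n. lam k ^ r * (rinner \<alpha> g0 (p k))\<^sup>2) \<le> lam r ^ r * rinner \<alpha> g0 g0 + (2 * real r) ^ r * rinner \<alpha> gr gr"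
proof -
  let ?c = "\<lambda>k. rinner \<alpha> g0 (p k)" and ?\<nu> = "deriv_norm_sq \<alpha> r"
  define e where "e k = (\<lambda>x. (1 / sqrt (?\<nu> k)) * poly ((pderiv ^^ r) (gpoly \<alpha> k)) x)" for k
  have a0: "0 \<le> \<alpha> + real r" by simp
  have on: "rL2_orthonormal (\<alpha> + real r) {r..<n} e"
    unfolding rL2_orthonormal_def
  proof (intro conjI ballI)
    fix k l assume k: "k \<in> {r..<n}" and l: "l \<in> {r..<n}"
    have "rinner (\<alpha> + real r) (e k) (e l) = (1 / sqrt (?\<nu> k)) * ((1 / sqrt (?\<nu> l)) * (if k = l then ?\<nu> k else 0))"
      unfolding e_def rinner_cmult_left rinner_commute[of _ _ "\<lambda>x. (1 / sqrt (?\<nu> l)) * poly ((pderiv ^^ r) (gpoly \<alpha> l)) x"]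
      using higher_pderiv_gpoly_inner[OF alpha_nonneg, of r l k] by auto
    also have "\<dots> = (if k = l then 1 else 0)" using deriv_norm_sq_pos[OF alpha_nonneg, of r k] k by auto
    finally show "rinner (\<alpha> + real r) (e k) (e l) = (if k = l then 1 else 0)" .
  next
    show "e k \<in> rL2 (\<alpha> + real r)" for k unfolding e_def by (intro rL2_cmult rL2_poly a0)
  qed simp
  have grL: "gr \<in> rL2 (\<alpha> + real r)" "rinner (\<alpha> + real r) gr gr \<le> rinner \<alpha> gr gr"
    using rL2_weight_mono[OF _ gr, of "\<alpha> + real r"] by simp_all
  have "(rinner (\<alpha> + real r) gr (e k))\<^sup>2 = ?\<nu> k * (?c k)\<^sup>2" if k: "k \<in> {r..<n}" for k
  proof -
    have \<nu>: "0 < ?\<nu> k" using deriv_norm_sq_pos[OF alpha_nonneg] k by simp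
    have "rinner (\<alpha> + real r) gr (e k) = (1 / sqrt (?\<nu> k)) * (?\<nu> k * ?c k)"
      unfolding rinner_commute[of _ gr] e_def rinner_cmult_left unfolding rinner_commute[of _ _ gr] rel ..
    then show ?thesis using \<nu> by (simp add: power_mult_distrib power_divide power2_eq_square)
  qed
  then have "(\<Sum>k\<in>{r..<n}. ?\<nu> k * (?c k)\<^sup>2) = (\<Sum>k\<in>{r..<n}. (rinner (\<alpha> + real r) gr (e k))\<^sup>2)" by simp
  also have "\<dots> \<le> rinner (\<alpha> + real r) gr gr" by (rule rL2_Bessel[OF on grL(1)])
  also have "\<dots> \<le> rinner \<alpha> gr gr" by (rule grL(2))
  finally have high: "(\<Sum>k\<in>{r..<n}. ?\<nu> k * (?c k)\<^sup>2) \<le> rinner \<alpha> gr gr" .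
  have "(\<Sum>k<n. lam k ^ r * (?c k)\<^sup>2) \<le> (\<Sum>k<n. lam r ^ r * (?c k)\<^sup>2 + (if r \<le> k then (2 * real r) ^ r * (?\<nu> k * (?c k)\<^sup>2) else 0))"
  proof (rule sum_mono)
    fix k
    have l0: "0 \<le> lam i" for i using gweight_ge_1[OF alpha_nonneg, of i] by simp
    show "lam k ^ r * (?c k)\<^sup>2 \<le> lam r ^ r * (?c k)\<^sup>2 + (if r \<le> k then (2 * real r) ^ r * (?\<nu> k * (?c k)\<^sup>2) else 0)"
    proof (cases "r \<le> k")
      case True
      have 1: "lam k ^ r * (?c k)\<^sup>2 \<le> ((2 * real r) ^ r * ?\<nu> k) * (?c k)\<^sup>2"
        by (rule mult_right_mono[OF deriv_norm_sq_lower[OF alpha_nonneg True]]) simp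
      have "0 \<le> lam r ^ r * (?c k)\<^sup>2" using l0 by simp
      then show ?thesis using 1 unfolding if_P[OF True] mult.assoc by linarith
    next
      case False
      then have "lam k ^ r \<le> lam r ^ r" using l0 by (intro power_mono lam_mono) auto
      then show ?thesis using False by (simp add: mult_right_mono)
    qed
  qed
  also have "\<dots> = lam r ^ r * (\<Sum>k<n. (?c k)\<^sup>2) + (2 * real r) ^ r * (\<Sum>k\<in>{r..<n}. ?\<nu> k * (?c k)\<^sup>2)"
  proof -
    have "{k \<in> {..<n}. r \<le> k} = {r..<n}" by auto
    then have "(\<Sum>k<n. if r \<le> k then (2 * real r) ^ r * (?\<nu> k * (?c k)\<^sup>2) else 0) = (\<Sum>k\<in>{r..<n}. (2 * real r) ^ r * (?\<nu> k * (?c k)\<^sup>2))"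
      by (subst sum.inter_filter[symmetric]) simp_all
    then show ?thesis by (simp add: sum.distrib sum_distrib_left)
  qed
  also have "\<dots> \<le> lam r ^ r * rinner \<alpha> g0 g0 + (2 * real r) ^ r * rinner \<alpha> gr gr"
  proof (intro add_mono mult_left_mono high)
    show "(\<Sum>k<n. (?c k)\<^sup>2) \<le> rinner \<alpha> g0 g0"
      by (rule rL2_Bessel[OF rL2_orthonormal_gpoly[OF alpha_nonneg] g0]) simp
    show "0 \<le> lam r ^ r" using gweight_ge_1[OF alpha_nonneg, of r] by simp
  qed simp
  finally show ?thesis .
qed

lemma gcoeffs_in_range_T_power:
  assumes f: "f \<in> rL2 \<alpha>" and bd: "\<And>n. (\<Sum>k<n. lam k ^ r * (rinner \<alpha> f (p k))\<^sup>2) \<le> A"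
  obtains w where "gcoeffs f = (T ^^ r) w" "(norm w)\<^sup>2 \<le> A"
proof -
  define w where "w k = sqrt (lam k) ^ r * rinner \<alpha> f (p k)" for k
  have "(w k)\<^sup>2 = lam k ^ r * (rinner \<alpha> f (p k))\<^sup>2" for k
    unfolding w_def power_mult_distrib by (simp add: power_mult[symmetric] mult.commute[of _ 2]) (simp add: power_mult)
  then have "(\<Sum>k<n. (w k)\<^sup>2) \<le> A" for n using bd by simp
  note W = ell2_of_bounded_sums[OF this]
  have "gcoeffs f = (T ^^ r) (Ell2 w)"
  proof (rule ell2_eqI)
    fix k show "coord (gcoeffs f) k = coord ((T ^^ r) (Ell2 w)) k"
      unfolding coord_T_power W(1) gcoeffs_props(1)[OF f] by (simp add: w_def)
  qed
  then show ?thesis using that W(2) by blast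
qed

definition gcoeffs_pair :: "(real \<Rightarrow> complex) \<Rightarrow> ell2 \<times> ell2" where
  "gcoeffs_pair f = (gcoeffs (\<lambda>x. Re (f x)), gcoeffs (\<lambda>x. Im (f x)))"

lemma sobolev_int_decay:
  "\<exists>C\<ge>0. \<forall>f\<in>sobolev_int \<alpha> r. \<exists>w1 w2. gcoeffs_pair f = ((T ^^ r) w1, (T ^^ r) w2)
     \<and> norm w1 \<le> C * sobolev_int_norm \<alpha> r f \<and> norm w2 \<le> C * sobolev_int_norm \<alpha> r f"
proof (rule exI[of _ "sqrt (lam r ^ r + (2 * real r) ^ r)"], intro conjI ballI)
  let ?C2 = "lam r ^ r + (2 * real r) ^ r"
  have C2: "0 \<le> lam r ^ r" "0 \<le> (2 * real r) ^ r" using gweight_ge_1[OF alpha_nonneg, of r] by simp_all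
  then show "0 \<le> sqrt ?C2" by simp
  fix f assume f: "f \<in> sobolev_int \<alpha> r"
  let ?n = "sobolev_int_norm \<alpha> r f"
  have n0: "0 \<le> ?n" unfolding sobolev_int_norm_def by (intro real_sqrt_ge_zero sum_nonneg) simp
  have fL: "f \<in> weighted_L2 \<alpha>" and wL: "\<And>i. i \<le> r \<Longrightarrow> weak_deriv i f \<in> weighted_L2 \<alpha>"
    using f by (auto simp: sobolev_int_def)
  note g0 = weighted_L2_real_parts[OF wL[of 0, simplified]] and gr = weighted_L2_real_parts[OF wL[OF order_refl]]
    and fR = weighted_L2_real_parts[OF fL]
  note rel = sobolev_coefficient[OF alpha_pos f]
  have ar: "\<alpha> \<le> \<alpha> + real r" and ar0: "0 \<le> \<alpha> + real r" by simp_all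
  have c0: "rinner \<alpha> (\<lambda>x. Re (weak_deriv 0 f x)) (p k) = rinner \<alpha> (\<lambda>x. Re (f x)) (p k)"
    "rinner \<alpha> (\<lambda>x. Im (weak_deriv 0 f x)) (p k) = rinner \<alpha> (\<lambda>x. Im (f x)) (p k)" for k
    using arg_cong[OF rel[of 0 k], of Re] arg_cong[OF rel[of 0 k], of Im]
      weighted_L2_coefficient_parts[OF alpha_pos order_refl fL p_rL2[of k]]
      weighted_L2_coefficient_parts[OF alpha_pos order_refl wL[of 0, simplified] p_rL2[of k]]
    by (simp_all add: deriv_norm_sq_def)
  have relR: "rinner (\<alpha> + real r) (\<lambda>x. Re (weak_deriv r f x)) (poly ((pderiv ^^ r) (gpoly \<alpha> k)))
      = deriv_norm_sq \<alpha> r k * rinner \<alpha> (\<lambda>x. Re (weak_deriv 0 f x)) (p k)" for k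
    using arg_cong[OF rel[of r k], of Re] weighted_L2_coefficient_parts[OF alpha_pos order_refl fL p_rL2[of k]]
      weighted_L2_coefficient_parts[OF alpha_pos ar wL[OF order_refl] rL2_poly[OF ar0]]
    by (simp add: c0)
  have relI: "rinner (\<alpha> + real r) (\<lambda>x. Im (weak_deriv r f x)) (poly ((pderiv ^^ r) (gpoly \<alpha> k)))
      = deriv_norm_sq \<alpha> r k * rinner \<alpha> (\<lambda>x. Im (weak_deriv 0 f x)) (p k)" for k
    using arg_cong[OF rel[of r k], of Im] weighted_L2_coefficient_parts[OF alpha_pos order_refl fL p_rL2[of k]]
      weighted_L2_coefficient_parts[OF alpha_pos ar wL[OF order_refl] rL2_poly[OF ar0]]
    by (simp add: c0)
  have part: "rinner \<alpha> u u \<le> ?n\<^sup>2" if "u = (\<lambda>x. Re (weak_deriv i f x)) \<or> u = (\<lambda>x. Im (weak_deriv i f x))" "i \<le> r" for u i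
    using that weighted_L2_real_parts(3)[OF wL[OF that(2)]] sobolev_term_le_norm[OF that(2), of \<alpha> f]
      rinner_nonneg[of \<alpha> "\<lambda>x. Re (weak_deriv i f x)"] rinner_nonneg[of \<alpha> "\<lambda>x. Im (weak_deriv i f x)"] by auto
  have fin: "\<exists>w. gcoeffs h = (T ^^ r) w \<and> norm w \<le> sqrt ?C2 * ?n"
    if h: "h \<in> rL2 \<alpha>" and u0: "u0 \<in> rL2 \<alpha>" "rinner \<alpha> u0 u0 \<le> ?n\<^sup>2" and ur: "ur \<in> rL2 \<alpha>" "rinner \<alpha> ur ur \<le> ?n\<^sup>2"
      and eq: "\<And>k. rinner \<alpha> u0 (p k) = rinner \<alpha> h (p k)"
      and re: "\<And>k. rinner (\<alpha> + real r) ur (poly ((pderiv ^^ r) (gpoly \<alpha> k))) = deriv_norm_sq \<alpha> r k * rinner \<alpha> u0 (p k)"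
    for h u0 ur
  proof -
    have "(\<Sum>k<n. lam k ^ r * (rinner \<alpha> h (p k))\<^sup>2) \<le> ?C2 * ?n\<^sup>2" for n
    proof -
      have "lam r ^ r * rinner \<alpha> u0 u0 + (2 * real r) ^ r * rinner \<alpha> ur ur \<le> lam r ^ r * ?n\<^sup>2 + (2 * real r) ^ r * ?n\<^sup>2"
        using C2 u0 ur by (intro add_mono mult_left_mono) auto
      then show ?thesis using weighted_coefficient_decay[OF u0(1) ur(1) re, of n] unfolding eq by (simp add: algebra_simps)
    qed
    then obtain w where w: "gcoeffs h = (T ^^ r) w" "(norm w)\<^sup>2 \<le> ?C2 * ?n\<^sup>2" by (rule gcoeffs_in_range_T_power[OF h])
    have "norm w \<le> sqrt (?C2 * ?n\<^sup>2)" by (rule real_le_rsqrt[OF w(2)])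
    also have "\<dots> = sqrt ?C2 * ?n" using n0 by (simp add: real_sqrt_mult)
    finally show ?thesis using w(1) by blast
  qed
  obtain w1 where "gcoeffs (\<lambda>x. Re (f x)) = (T ^^ r) w1" "norm w1 \<le> sqrt ?C2 * ?n"
    using fin[OF fR(1) g0(1) part gr(1) part c0(1) relR] by blast
  moreover obtain w2 where "gcoeffs (\<lambda>x. Im (f x)) = (T ^^ r) w2" "norm w2 \<le> sqrt ?C2 * ?n"
    using fin[OF fR(2) g0(2) part gr(2) part c0(2) relI] by blast
  ultimately show "\<exists>w1 w2. gcoeffs_pair f = ((T ^^ r) w1, (T ^^ r) w2) \<and> norm w1 \<le> sqrt ?C2 * ?n \<and> norm w2 \<le> sqrt ?C2 * ?n"
    unfolding gcoeffs_pair_def by blast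
qed

text \<open>
  The coefficients of \<open>f - S\<^sub>N f\<close>, as a pair for the real and the imaginary part, so that the
  norm of the pair is the weighted norm and the triangle inequality comes for free.
\<close>

definition proj_error :: "nat \<Rightarrow> (nat \<Rightarrow> real \<Rightarrow> real) \<Rightarrow> (real \<Rightarrow> complex) \<Rightarrow> ell2 \<times> ell2" where
  "proj_error N \<psi> f = (proj_compl N (\<lambda>i. gcoeffs (\<psi> i)) (fst (gcoeffs_pair f)), proj_compl N (\<lambda>i. gcoeffs (\<psi> i)) (snd (gcoeffs_pair f)))"

lemma norm_proj_error:
  assumes fam: "gpswf_family \<alpha> c chi \<psi>" and f: "f \<in> weighted_L2 \<alpha>"
  shows "weighted_norm \<alpha> (\<lambda>x. f x - gpswf_partial_sum \<alpha> \<psi> N f x) = norm (proj_error N \<psi> f)"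
proof -
  have L: "\<psi> n \<in> rL2 \<alpha>" for n by (rule family_spectral(1)[OF fam])
  note fR = weighted_L2_real_parts(1,2)[OF f]
  have inner: "weighted_inner \<alpha> f (\<lambda>t. complex_of_real (\<psi> n t)) = (\<integral>x. \<psi> n x *\<^sub>R f x \<partial>weighted_measure \<alpha>)" for n
    by (simp add: weighted_inner_def scaleR_conv_of_real mult.commute)
  note parts = weighted_L2_coefficient_parts[OF alpha_pos order_refl f L, folded inner]
  let ?h = "\<lambda>x. f x - gpswf_partial_sum \<alpha> \<psi> N f x"
  have partial: "(\<lambda>x. u x - (\<Sum>n\<le>N. rinner \<alpha> u (\<psi> n) * \<psi> n x)) \<in> rL2 \<alpha>"
    "rinner \<alpha> (\<lambda>x. u x - (\<Sum>n\<le>N. rinner \<alpha> u (\<psi> n) * \<psi> n x)) (\<lambda>x. u x - (\<Sum>n\<le>N. rinner \<alpha> u (\<psi> n) * \<psi> n x))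
      = (norm (proj_compl N (\<lambda>i. gcoeffs (\<psi> i)) (gcoeffs u)))\<^sup>2" if u: "u \<in> rL2 \<alpha>" for u
  proof -
    have sL: "(\<lambda>x. \<Sum>n\<le>N. rinner \<alpha> u (\<psi> n) * \<psi> n x) \<in> rL2 \<alpha>" by (intro rL2_sum rL2_cmult L)
    show dL: "(\<lambda>x. u x - (\<Sum>n\<le>N. rinner \<alpha> u (\<psi> n) * \<psi> n x)) \<in> rL2 \<alpha>" by (rule rL2_diff[OF u sL])
    have "gcoeffs (\<lambda>x. u x - (\<Sum>n\<le>N. rinner \<alpha> u (\<psi> n) * \<psi> n x)) = proj_compl N (\<lambda>i. gcoeffs (\<psi> i)) (gcoeffs u)"
      unfolding gcoeffs_diff[OF u sL] proj_compl_def
      by (simp add: gcoeffs_sum rL2_cmult L gcoeffs_cmult inner_gcoeffs u)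
    then show "rinner \<alpha> (\<lambda>x. u x - (\<Sum>n\<le>N. rinner \<alpha> u (\<psi> n) * \<psi> n x)) (\<lambda>x. u x - (\<Sum>n\<le>N. rinner \<alpha> u (\<psi> n) * \<psi> n x))
      = (norm (proj_compl N (\<lambda>i. gcoeffs (\<psi> i)) (gcoeffs u)))\<^sup>2"
      using gcoeffs_props(2)[OF dL] by simp
  qed
  have Re: "(\<lambda>x. Re (?h x)) = (\<lambda>x. Re (f x) - (\<Sum>n\<le>N. rinner \<alpha> (\<lambda>x. Re (f x)) (\<psi> n) * \<psi> n x))"
    and Im: "(\<lambda>x. Im (?h x)) = (\<lambda>x. Im (f x) - (\<Sum>n\<le>N. rinner \<alpha> (\<lambda>x. Im (f x)) (\<psi> n) * \<psi> n x))"
    by (simp_all add: gpswf_partial_sum_def parts atLeast0AtMost)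
  note R = partial[OF fR(1), folded Re] and I = partial[OF fR(2), folded Im]
  have "(weighted_norm \<alpha> ?h)\<^sup>2 = (\<integral>x. (norm (?h x))\<^sup>2 \<partial>weighted_measure \<alpha>)"
    unfolding weighted_norm_def by (rule real_sqrt_pow2) (intro integral_nonneg_AE, simp)
  also have "\<dots> = (\<integral>x. Re (?h x) * Re (?h x) + Im (?h x) * Im (?h x) \<partial>weighted_measure \<alpha>)"
    by (simp only: cmod_power2) (simp only: power2_eq_square)
  also have "\<dots> = rinner \<alpha> (\<lambda>x. Re (?h x)) (\<lambda>x. Re (?h x)) + rinner \<alpha> (\<lambda>x. Im (?h x)) (\<lambda>x. Im (?h x))"
    unfolding rinner_def by (intro Bochner_Integration.integral_add rL2_product_integrable R(1) I(1))
  also have "\<dots> = (norm (proj_error N \<psi> f))\<^sup>2"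
    unfolding R(2) I(2) proj_error_def gcoeffs_pair_def by (simp add: norm_Pair)
  finally have "(weighted_norm \<alpha> ?h)\<^sup>2 = (norm (proj_error N \<psi> f))\<^sup>2" .
  moreover have "0 \<le> weighted_norm \<alpha> ?h" unfolding weighted_norm_def by (intro real_sqrt_ge_zero integral_nonneg_AE) simp
  ultimately show ?thesis using power2_eq_imp_eq norm_ge_zero by blast
qed

lemma proj_error_add:
  assumes "f \<in> weighted_L2 \<alpha>" "g \<in> weighted_L2 \<alpha>"
  shows "proj_error N \<psi> (\<lambda>x. f x + g x) = proj_error N \<psi> f + proj_error N \<psi> g"
proof -
  have add: "gcoeffs (\<lambda>x. u x + v x) = gcoeffs u + gcoeffs v" if "u \<in> rL2 \<alpha>" "v \<in> rL2 \<alpha>" for u v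
    using that by (intro ell2_eqI) (simp add: gcoeffs_props rL2_add rinner_add_left p_rL2)
  have pc: "proj_compl N w (a + b) = proj_compl N w a + proj_compl N w b" for w :: "nat \<Rightarrow> ell2" and a b
    by (simp add: proj_compl_def inner_add_left scaleR_add_left sum.distrib)
  show ?thesis
    using weighted_L2_real_parts(1,2)[OF assms(1)] weighted_L2_real_parts(1,2)[OF assms(2)]
    by (simp add: proj_error_def gcoeffs_pair_def add pc)
qed

lemma proj_error_rate:
  "\<exists>K\<ge>0. \<forall>chi \<psi> N. \<forall>f\<in>sobolev_int \<alpha> m. gpswf_family \<alpha> c chi \<psi> \<longrightarrow> 1 \<le> N \<longrightarrow>
     norm (proj_error N \<psi> f) \<le> K * (1 + (real N / 2)\<^sup>2) powr (- real m / 2) * sobolev_int_norm \<alpha> m f"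
proof -
  obtain K where K: "0 \<le> K" "\<And>chi \<psi> N w. gpswf_family \<alpha> c chi \<psi> \<Longrightarrow> 1 \<le> N \<Longrightarrow>
     norm (proj_compl N (\<lambda>i. gcoeffs (\<psi> i)) ((T ^^ m) w)) \<le> K * (1 + (real N / 2)\<^sup>2) powr (- real m / 2) * norm w"
    using family_rate[of m] by blast
  obtain C where C: "0 \<le> C" "\<And>f. f \<in> sobolev_int \<alpha> m \<Longrightarrow> \<exists>w1 w2. gcoeffs_pair f = ((T ^^ m) w1, (T ^^ m) w2)
     \<and> norm w1 \<le> C * sobolev_int_norm \<alpha> m f \<and> norm w2 \<le> C * sobolev_int_norm \<alpha> m f"
    using sobolev_int_decay[of m] by blast
  show ?thesis
  proof (rule exI[of _ "2 * K * C"], intro conjI allI ballI impI)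
    show "0 \<le> 2 * K * C" using K C by simp
    fix chi \<psi> N f assume f: "f \<in> sobolev_int \<alpha> m" and fam: "gpswf_family \<alpha> c chi \<psi>" and N: "(1::nat) \<le> N"
    let ?Y = "(1 + (real N / 2)\<^sup>2) powr (- real m / 2)" and ?n = "sobolev_int_norm \<alpha> m f"
    obtain w1 w2 where w: "gcoeffs_pair f = ((T ^^ m) w1, (T ^^ m) w2)" "norm w1 \<le> C * ?n" "norm w2 \<le> C * ?n"
      using C(2)[OF f] by blast
    have b: "norm (proj_compl N (\<lambda>i. gcoeffs (\<psi> i)) ((T ^^ m) w)) \<le> K * ?Y * (C * ?n)" if "norm w \<le> C * ?n" for w
      using order_trans[OF K(2)[OF fam N] mult_left_mono[OF that]] K(1) by simp
    have "norm (proj_error N \<psi> f) \<le> K * ?Y * (C * ?n) + K * ?Y * (C * ?n)"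
      unfolding proj_error_def w(1) fst_conv snd_conv
      by (rule order_trans[OF norm_Pair_le add_mono[OF b[OF w(2)] b[OF w(3)]]])
    then show "norm (proj_error N \<psi> f) \<le> 2 * K * C * ?Y * ?n" by (simp add: mult_ac)
  qed
qed

end

section \<open>The K-functional at one scale\<close>

context
  fixes X0 X1 :: "(real \<Rightarrow> complex) set" and n0 n1 :: "(real \<Rightarrow> complex) \<Rightarrow> real" and f :: "real \<Rightarrow> complex"
  assumes n0: "\<And>g. 0 \<le> n0 g" and n1: "\<And>g. 0 \<le> n1 g" and dec: "decompositions X0 X1 f \<noteq> {}"
begin

lemma K_functional_lower:
  assumes "\<And>f0 f1. f0 \<in> X0 \<Longrightarrow> f1 \<in> X1 \<Longrightarrow> f = (\<lambda>x. f0 x + f1 x) \<Longrightarrow> B \<le> n0 f0 + t * n1 f1"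
  shows "B \<le> K_functional X0 n0 X1 n1 t f"
  unfolding K_functional_def using dec assms by (intro cINF_greatest) (auto simp: decompositions_def)

lemma K_functional_upper:
  assumes "0 \<le> t" "f0 \<in> X0" "f1 \<in> X1" "f = (\<lambda>x. f0 x + f1 x)"
  shows "K_functional X0 n0 X1 n1 t f \<le> n0 f0 + t * n1 f1"
proof -
  have "bdd_below ((\<lambda>(f0, f1). n0 f0 + t * n1 f1) ` decompositions X0 X1 f)"
    using n0 n1 assms(1) by (intro bdd_belowI[of _ 0]) auto
  from cINF_lower[OF this, of "(f0, f1)"] show ?thesis
    using assms(2-4) unfolding K_functional_def by (auto simp: decompositions_def)
qed

lemma K_functional_nonneg: "0 \<le> t \<Longrightarrow> 0 \<le> K_functional X0 n0 X1 n1 t f"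
  using n0 n1 by (intro K_functional_lower) simp

lemma K_functional_mono:
  assumes "0 \<le> s" "s \<le> t"
  shows "K_functional X0 n0 X1 n1 s f \<le> K_functional X0 n0 X1 n1 t f"
proof (rule K_functional_lower)
  fix f0 f1 assume f: "f0 \<in> X0" "f1 \<in> X1" "f = (\<lambda>x. f0 x + f1 x)"
  have "s * n1 f1 \<le> t * n1 f1" using assms n1 by (intro mult_right_mono)
  then show "K_functional X0 n0 X1 n1 s f \<le> n0 f0 + t * n1 f1"
    using K_functional_upper[OF assms(1) f] by linarith
qed

text \<open>
  The K-functional is increasing, so on \<open>[\<tau>, 2 \<tau>]\<close> the integrand of the interpolation norm is at
  least its value with \<open>K(\<tau>)\<close> and the worst power of \<open>t\<close>; this interval has length \<open>\<tau>\<close>, which cancels the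
  factor \<open>1 / t\<close> up to \<open>2\<close>.
\<close>

lemma K_functional_le_interpolation_norm:
  assumes \<tau>: "0 < \<tau>" and \<theta>: "0 \<le> \<theta>" and f: "f \<in> interpolation_space X0 n0 X1 n1 \<theta>"
  shows "K_functional X0 n0 X1 n1 \<tau> f \<le> sqrt 2 * (2 * \<tau>) powr \<theta> * interpolation_norm X0 n0 X1 n1 \<theta> f"
proof -
  let ?K = "\<lambda>t. K_functional X0 n0 X1 n1 t f"
  let ?g = "\<lambda>t. (t powr (- \<theta>) * ?K t)\<^sup>2 / t"
  define I where "I = (LINT t:{0<..}|lborel. ?g t)"
  define b where "b = ((2 * \<tau>) powr (- \<theta>) * ?K \<tau>)\<^sup>2 / (2 * \<tau>)"
  have K0: "0 \<le> ?K \<tau>" using \<tau> by (intro K_functional_nonneg) simp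
  have int: "set_integrable lborel {0<..} ?g" using f by (simp add: interpolation_space_def)
  have "(\<integral>t. indicator {\<tau>..2 * \<tau>} t *\<^sub>R b \<partial>lborel) \<le> I"
    unfolding I_def set_lebesgue_integral_def
  proof (rule integral_mono)
    show "integrable lborel (\<lambda>t. indicator {\<tau>..2 * \<tau>} t *\<^sub>R b)"
      using \<tau> by (intro integrable_scaleR_left integrable_real_indicator) auto
    show "integrable lborel (\<lambda>t. indicator {0<..} t *\<^sub>R ?g t)" using int unfolding set_integrable_def .
    fix t :: real
    show "indicator {\<tau>..2 * \<tau>} t *\<^sub>R b \<le> indicator {0<..} t *\<^sub>R ?g t"
    proof (cases "t \<in> {\<tau>..2 * \<tau>}")
      case True
      then have t: "\<tau> \<le> t" "t \<le> 2 * \<tau>" "0 < t" using \<tau> by auto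
      have "(2 * \<tau>) powr (- \<theta>) * ?K \<tau> \<le> t powr (- \<theta>) * ?K t"
        using t \<tau> \<theta> K0 by (intro mult_mono powr_mono2' K_functional_mono) auto
      then have "((2 * \<tau>) powr (- \<theta>) * ?K \<tau>)\<^sup>2 \<le> (t powr (- \<theta>) * ?K t)\<^sup>2"
        using K0 by (intro power_mono) auto
      then have "b \<le> ?g t" unfolding b_def using t \<tau> by (intro frac_le) auto
      then show ?thesis using True t by simp
    next
      case False
      then show ?thesis by (auto simp: indicator_def)
    qed
  qed
  also have "(\<integral>t. indicator {\<tau>..2 * \<tau>} t *\<^sub>R b \<partial>lborel) = \<tau> * b" using \<tau> by simp
  finally have "((2 * \<tau>) powr (- \<theta>) * ?K \<tau>)\<^sup>2 \<le> 2 * I" using \<tau> by (simp add: b_def field_simps)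
  then have "(2 * \<tau>) powr (- \<theta>) * ?K \<tau> \<le> sqrt (2 * I)" by (rule real_le_rsqrt)
  also have "\<dots> = sqrt 2 * interpolation_norm X0 n0 X1 n1 \<theta> f"
    by (simp add: real_sqrt_mult interpolation_norm_def I_def)
  finally have fin: "(2 * \<tau>) powr \<theta> * ((2 * \<tau>) powr (- \<theta>) * ?K \<tau>) \<le> (2 * \<tau>) powr \<theta> * (sqrt 2 * interpolation_norm X0 n0 X1 n1 \<theta> f)"
    by (intro mult_left_mono) auto
  have "(2 * \<tau>) powr \<theta> * (2 * \<tau>) powr (- \<theta>) = 1"
    using \<tau> by (simp add: powr_add[symmetric])
  then have eq: "(2 * \<tau>) powr \<theta> * ((2 * \<tau>) powr (- \<theta>) * ?K \<tau>) = ?K \<tau>"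
    by (simp only: mult.assoc[symmetric] mult_1)
  show ?thesis using fin unfolding eq by (simp only: mult.left_commute mult.assoc)
qed

end

lemma sobolev_int_norm_nonneg: "0 \<le> sobolev_int_norm \<alpha> r f"
  unfolding sobolev_int_norm_def by (intro real_sqrt_ge_zero sum_nonneg) simp

lemma sobolev_norm_nonneg: "0 \<le> sobolev_norm \<alpha> s f"
proof -
  have "0 \<le> interpolation_norm X0 n0 X1 n1 \<theta> f" for X0 n0 X1 n1 \<theta>
    unfolding interpolation_norm_def set_lebesgue_integral_def
    by (intro real_sqrt_ge_zero integral_nonneg_AE AE_I2) (simp add: indicator_def)
  then show ?thesis by (simp add: sobolev_norm_def Let_def sobolev_int_norm_nonneg)
qed

lemma weighted_L2_add:
  assumes "f \<in> weighted_L2 \<alpha>" "g \<in> weighted_L2 \<alpha>"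
  shows "(\<lambda>x. f x + g x) \<in> weighted_L2 \<alpha>"
proof -
  have m: "f \<in> borel_measurable (weighted_measure \<alpha>)" "g \<in> borel_measurable (weighted_measure \<alpha>)"
    and i: "integrable (weighted_measure \<alpha>) (\<lambda>x. (norm (f x))\<^sup>2)" "integrable (weighted_measure \<alpha>) (\<lambda>x. (norm (g x))\<^sup>2)"
    using assms by (auto simp: weighted_L2_def)
  have mm: "(\<lambda>x. f x + g x) \<in> borel_measurable (weighted_measure \<alpha>)" by (rule borel_measurable_add[OF m])
  have "integrable (weighted_measure \<alpha>) (\<lambda>x. (norm (f x + g x))\<^sup>2)"
  proof (rule Bochner_Integration.integrable_bound)
    show "integrable (weighted_measure \<alpha>) (\<lambda>x. 2 * (norm (f x))\<^sup>2 + 2 * (norm (g x))\<^sup>2)"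
      by (intro Bochner_Integration.integrable_add integrable_mult_right i)
    show "(\<lambda>x. (norm (f x + g x))\<^sup>2) \<in> borel_measurable (weighted_measure \<alpha>)"
      by (rule borel_measurable_power[OF measurable_compose[OF mm borel_measurable_norm]])
    have "(norm (f x + g x))\<^sup>2 \<le> 2 * (norm (f x))\<^sup>2 + 2 * (norm (g x))\<^sup>2" for x
    proof -
      have "(norm (f x + g x))\<^sup>2 \<le> (norm (f x) + norm (g x))\<^sup>2" by (intro power_mono norm_triangle_ineq) simp
      also have "\<dots> \<le> 2 * (norm (f x))\<^sup>2 + 2 * (norm (g x))\<^sup>2"
        using zero_le_power2[of "norm (f x) - norm (g x)"] by (simp add: power2_sum power2_diff)
      finally show ?thesis .
    qed
    then show "AE x in weighted_measure \<alpha>. norm ((norm (f x + g x))\<^sup>2) \<le> norm (2 * (norm (f x))\<^sup>2 + 2 * (norm (g x))\<^sup>2)"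
      by (intro AE_I2) simp
  qed
  then show ?thesis using mm by (simp add: weighted_L2_def)
qed

section \<open>Convergence rate for real smoothness\<close>

context gpswf
begin

text \<open>
  For every decomposition \<open>f = f0 + f1\<close> the two integer rates add up to a constant times
  \<open>Y powr (- m / 2)\<close> times \<open>n0 f0 + \<tau> * n1 f1\<close> with \<open>\<tau> = Y powr (- 1 / 2)\<close>. Taking the infimum
  leaves the K-functional at \<open>\<tau>\<close>.
\<close>

lemma interpolated_rate:
  assumes \<theta>: "0 \<le> \<theta>"
  shows "\<exists>K\<ge>0. \<forall>chi \<psi> N. \<forall>f\<in>interpolation_space (sobolev_int \<alpha> m) (sobolev_int_norm \<alpha> m)
        (sobolev_int \<alpha> (m + 1)) (sobolev_int_norm \<alpha> (m + 1)) \<theta>. gpswf_family \<alpha> c chi \<psi> \<longrightarrow> 1 \<le> N \<longrightarrow>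
     f \<in> weighted_L2 \<alpha> \<and> norm (proj_error N \<psi> f) \<le> K * (1 + (real N / 2)\<^sup>2) powr (- (real m + \<theta>) / 2)
        * interpolation_norm (sobolev_int \<alpha> m) (sobolev_int_norm \<alpha> m)
            (sobolev_int \<alpha> (m + 1)) (sobolev_int_norm \<alpha> (m + 1)) \<theta> f"
proof -
  let ?X0 = "sobolev_int \<alpha> m" and ?X1 = "sobolev_int \<alpha> (m + 1)"
    and ?n0 = "sobolev_int_norm \<alpha> m" and ?n1 = "sobolev_int_norm \<alpha> (m + 1)"
  obtain K0 where K0: "0 \<le> K0" "\<And>chi \<psi> N f. f \<in> ?X0 \<Longrightarrow> gpswf_family \<alpha> c chi \<psi> \<Longrightarrow> 1 \<le> N \<Longrightarrow>
     norm (proj_error N \<psi> f) \<le> K0 * (1 + (real N / 2)\<^sup>2) powr (- real m / 2) * ?n0 f"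
    using proj_error_rate[of m] by blast
  obtain K1 where K1: "0 \<le> K1" "\<And>chi \<psi> N f. f \<in> ?X1 \<Longrightarrow> gpswf_family \<alpha> c chi \<psi> \<Longrightarrow> 1 \<le> N \<Longrightarrow>
     norm (proj_error N \<psi> f) \<le> K1 * (1 + (real N / 2)\<^sup>2) powr (- real (m + 1) / 2) * ?n1 f"
    using proj_error_rate[of "m + 1"] by blast
  \<comment> \<open>the summand \<open>1\<close> makes \<open>K\<close> positive, as it is divided by below\<close>
  define K where "K = max K0 K1 + 1"
  have Kp: "0 < K" "0 \<le> K" "K0 \<le> K" "K1 \<le> K" using K0(1) by (auto simp: K_def)
  show ?thesis
  proof (rule exI[of _ "K * (sqrt 2 * 2 powr \<theta>)"], intro conjI allI ballI impI)
    show "0 \<le> K * (sqrt 2 * 2 powr \<theta>)" using Kp by simp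
    fix chi \<psi> N f
    assume f: "f \<in> interpolation_space ?X0 ?n0 ?X1 ?n1 \<theta>" and fam: "gpswf_family \<alpha> c chi \<psi>" and N: "(1::nat) \<le> N"
    have dec: "decompositions ?X0 ?X1 f \<noteq> {}" using f by (simp add: interpolation_space_def)
    define Y where "Y = 1 + (real N / 2)\<^sup>2"
    have Y: "0 < Y" unfolding Y_def by (rule add_pos_nonneg) auto
    define \<tau> where "\<tau> = Y powr (- 1 / 2)"
    have \<tau>: "0 < \<tau>" using Y by (simp add: \<tau>_def)
    show "f \<in> weighted_L2 \<alpha>" using dec by (auto simp: decompositions_def sobolev_int_def intro: weighted_L2_add)
    define Z where "Z = Y powr (- real m / 2)"
    have Z1: "Y powr (- real (m + 1) / 2) = Z * \<tau>"
    proof -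
      have "- real (m + 1) / 2 = - real m / 2 + - 1 / 2" by (simp add: field_simps)
      then show ?thesis unfolding Z_def \<tau>_def by (simp only: powr_add)
    qed
    have Z: "0 < Z" using Y by (simp add: Z_def)
    have "norm (proj_error N \<psi> f) / (K * Z) \<le> K_functional ?X0 ?n0 ?X1 ?n1 \<tau> f"
    proof (rule K_functional_lower[OF sobolev_int_norm_nonneg sobolev_int_norm_nonneg dec])
      fix f0 f1 assume f01: "f0 \<in> ?X0" "f1 \<in> ?X1" "f = (\<lambda>x. f0 x + f1 x)"
      have L: "f0 \<in> weighted_L2 \<alpha>" "f1 \<in> weighted_L2 \<alpha>" using f01 by (auto simp: sobolev_int_def)
      have "norm (proj_error N \<psi> f) \<le> norm (proj_error N \<psi> f0) + norm (proj_error N \<psi> f1)"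
        unfolding f01(3) proj_error_add[OF L] by (rule norm_triangle_ineq)
      also have "\<dots> \<le> K0 * Z * ?n0 f0 + K1 * (Z * \<tau>) * ?n1 f1"
        using K0(2)[OF f01(1) fam N] K1(2)[OF f01(2) fam N] unfolding Y_def[symmetric] Z1 Z_def[symmetric]
        by (intro add_mono)
      also have "\<dots> \<le> K * Z * ?n0 f0 + K * (Z * \<tau>) * ?n1 f1"
        using Kp Z \<tau> by (intro add_mono mult_right_mono sobolev_int_norm_nonneg) auto
      also have "\<dots> = (K * Z) * (?n0 f0 + \<tau> * ?n1 f1)" by (simp add: algebra_simps)
      finally show "norm (proj_error N \<psi> f) / (K * Z) \<le> ?n0 f0 + \<tau> * ?n1 f1"
        using Kp(1) Z by (simp add: divide_le_eq mult.commute)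
    qed
    then have "norm (proj_error N \<psi> f) \<le> K * Z * K_functional ?X0 ?n0 ?X1 ?n1 \<tau> f"
      using Kp(1) Z by (simp add: divide_le_eq mult.commute)
    also have "\<dots> \<le> K * Z * (sqrt 2 * (2 * \<tau>) powr \<theta> * interpolation_norm ?X0 ?n0 ?X1 ?n1 \<theta> f)"
      using Kp by (intro mult_left_mono K_functional_le_interpolation_norm[OF sobolev_int_norm_nonneg sobolev_int_norm_nonneg dec \<tau> \<theta> f])
        (simp add: Z_def)
    also have "(2 * \<tau>) powr \<theta> = 2 powr \<theta> * Y powr (- \<theta> / 2)"
      using \<tau> Y by (simp add: powr_mult \<tau>_def powr_powr)
    also have "K * Z * (sqrt 2 * (2 powr \<theta> * Y powr (- \<theta> / 2)) * interpolation_norm ?X0 ?n0 ?X1 ?n1 \<theta> f)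
        = K * (sqrt 2 * 2 powr \<theta>) * (Z * Y powr (- \<theta> / 2)) * interpolation_norm ?X0 ?n0 ?X1 ?n1 \<theta> f" by simp
    also have "Z * Y powr (- \<theta> / 2) = Y powr (- (real m + \<theta>) / 2)"
    proof -
      have "- (real m + \<theta>) / 2 = - real m / 2 + - \<theta> / 2" by (simp add: field_simps)
      then show ?thesis unfolding Z_def by (simp only: powr_add)
    qed
    finally show "norm (proj_error N \<psi> f) \<le> K * (sqrt 2 * 2 powr \<theta>) * (1 + (real N / 2)\<^sup>2) powr (- (real m + \<theta>) / 2)
        * interpolation_norm ?X0 ?n0 ?X1 ?n1 \<theta> f" by (simp only: Y_def)
  qed
qed

lemma sobolev_rate:
  assumes s: "0 < s"
  shows "\<exists>K\<ge>0. \<forall>chi \<psi> N. \<forall>f\<in>sobolev \<alpha> s. gpswf_family \<alpha> c chi \<psi> \<longrightarrow> 1 \<le> N \<longrightarrow>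
     f \<in> weighted_L2 \<alpha> \<and> norm (proj_error N \<psi> f) \<le> K * (1 + (real N / 2)\<^sup>2) powr (- s / 2) * sobolev_norm \<alpha> s f"
proof -
  define m where "m = nat \<lfloor>s\<rfloor>"
  have sm: "s = real m + frac s" using s by (simp add: m_def frac_def)
  show ?thesis
  proof (cases "frac s = 0")
    case True
    then have "sobolev \<alpha> s = sobolev_int \<alpha> m" "sobolev_norm \<alpha> s = sobolev_int_norm \<alpha> m"
      by (simp_all add: sobolev_def sobolev_norm_def m_def Let_def)
    moreover have "s = real m" using sm True by simp
    ultimately show ?thesis using proj_error_rate[of m] by (simp add: sobolev_int_def) 
  next
    case False
    then have "sobolev \<alpha> s = interpolation_space (sobolev_int \<alpha> m) (sobolev_int_norm \<alpha> m)
        (sobolev_int \<alpha> (m + 1)) (sobolev_int_norm \<alpha> (m + 1)) (frac s)"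
      "sobolev_norm \<alpha> s = interpolation_norm (sobolev_int \<alpha> m) (sobolev_int_norm \<alpha> m)
        (sobolev_int \<alpha> (m + 1)) (sobolev_int_norm \<alpha> (m + 1)) (frac s)"
      by (simp_all add: sobolev_def sobolev_norm_def m_def Let_def)
    then show ?thesis using interpolated_rate[OF frac_ge_0, of m s] by (simp only: sm[symmetric])
  qed
qed

end

theorem theorem5:
  fixes c \<alpha> s :: real
  assumes "c > 0" and "\<alpha> > 0" and "s > 0"
  shows "\<exists>K>0. \<exists>\<delta>>0. \<forall>chi \<psi>. gpswf_family \<alpha> c chi \<psi> \<longrightarrow>
    (\<forall>(N::nat) f. N \<ge> 1 \<and> real N > m_const \<alpha> * c \<and> f \<in> sobolev \<alpha> s \<longrightarrow>
      weighted_norm \<alpha> (\<lambda>x. f x - gpswf_partial_sum \<alpha> \<psi> N f x)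
        \<le> K * (1 + (real N / 2)\<^sup>2) powr (- s / 2) * sobolev_norm \<alpha> s f
          + K * exp (- \<delta> * real N) * weighted_norm \<alpha> f)"
proof -
  interpret gpswf \<alpha> c by unfold_locales (rule assms(2))
  obtain K where K: "0 \<le> K" "\<And>chi \<psi> N f. f \<in> sobolev \<alpha> s \<Longrightarrow> gpswf_family \<alpha> c chi \<psi> \<Longrightarrow> 1 \<le> N \<Longrightarrow>
     f \<in> weighted_L2 \<alpha> \<and> norm (proj_error N \<psi> f) \<le> K * (1 + (real N / 2)\<^sup>2) powr (- s / 2) * sobolev_norm \<alpha> s f"
    using sobolev_rate[OF assms(3)] by blast
  show ?thesis
  proof (rule exI[of _ "K + 1"], intro conjI exI[of _ 1] allI impI)
    fix chi \<psi> and N :: nat and f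
    assume fam: "gpswf_family \<alpha> c chi \<psi>" and h: "N \<ge> 1 \<and> real N > m_const \<alpha> * c \<and> f \<in> sobolev \<alpha> s"
    let ?A = "(1 + (real N / 2)\<^sup>2) powr (- s / 2) * sobolev_norm \<alpha> s f"
    have b: "f \<in> weighted_L2 \<alpha>" "norm (proj_error N \<psi> f) \<le> K * ?A"
      using K(2)[OF _ fam, of f N] h by (simp_all add: mult.assoc)
    have "0 \<le> weighted_norm \<alpha> f" unfolding weighted_norm_def by (intro real_sqrt_ge_zero integral_nonneg_AE) simp
    then have "0 \<le> (K + 1) * exp (- 1 * real N) * weighted_norm \<alpha> f" using K(1) by simp
    moreover have "0 \<le> ?A" using sobolev_norm_nonneg by simp
    ultimately show "weighted_norm \<alpha> (\<lambda>x. f x - gpswf_partial_sum \<alpha> \<psi> N f x)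
        \<le> (K + 1) * (1 + (real N / 2)\<^sup>2) powr (- s / 2) * sobolev_norm \<alpha> s f
          + (K + 1) * exp (- 1 * real N) * weighted_norm \<alpha> f"
      unfolding norm_proj_error[OF fam b(1)] using b(2) by (simp add: distrib_right mult.assoc)
  qed (use K(1) in simp_all)
qed

end
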